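(* Let $n=n_1+\dots+n_k=p+q$ with $k\ge 2$ and all $n_i,p,q$ positive integers, let $G=U(n)$, and let $L=U(n_1)\times\cdots\times U(n_k)$ and $H=U(p)\times U(q)$ be the natural block-diagonal subgroups of $G$. In each of the following cases there exists a subset $B\subset O(n)$ with $G=LBH$ (i.e. every $g\in G$ can be written $g=xbh$ with $x\in L$, $b\in B$, $h\in H$), where $B$ has the indicated form: Case 0 ($k=2$): $B\simeq\mathbb{T}^{\min(n_1,n_2,p,q)}$; Case I ($k=3$ and $n_1=1$): $B\simeq\mathbb{T}^{\min(p,q,n_2,n_3)}\cdot\mathbb{T}^{\min(p,q,n_2+1,n_3+1)}$; Case II ($k=3$, $\min(n_1,n_2,n_3)\ge 2$ and $\min(p,q)=2$): $B\simeq\mathbb{T}^2\cdot\mathbb{T}\cdot\mathbb{T}^2$; Case III ($\min(p,q)=1$, arbitrary $k$): $B\simeq\mathbb{T}\cdot\cdots\cdot\mathbb{T}$ with $k-1$ factors.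
   Context: $\mathbb{T}$ denotes the circle group and $\mathbb{T}^a$ an $a$-dimensional torus. A toral subgroup means a compact connected abelian (torus) subgroup. The notation $\mathbb{T}^{a_1}\cdot\mathbb{T}^{a_2}\cdots\mathbb{T}^{a_r}$ means a subset of $G$ of the form $\{x_1x_2\cdots x_r: x_j\in T_j\}$ for some toral subgroups $T_j$ with $T_j\simeq\mathbb{T}^{a_j}$; in the theorem these toral subgroups lie in $O(n)$. In Case I the indices are labeled so that $n_1=1$. *)

theory Defs
  imports "HOL-Analysis.Analysis" "Jordan_Normal_Form.Matrix"
begin

definition mat_adj :: "complex mat \<Rightarrow> complex mat" where
  "mat_adj A = map_mat cnj (transpose_mat A)"

definition unitary_group :: "nat \<Rightarrow> complex mat set" where
  "unitary_group n = {A. A \<in> carrier_mat n n \<and> A * mat_adj A = 1\<^sub>m n}"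

definition orthogonal_group :: "nat \<Rightarrow> complex mat set" where
  "orthogonal_group n = {A. A \<in> unitary_group n \<and> (\<forall>i<n. \<forall>j<n. A $$ (i,j) \<in> \<real>)}"

definition same_block :: "nat list \<Rightarrow> nat \<Rightarrow> nat \<Rightarrow> bool" where
  "same_block ns i j \<longleftrightarrow> (\<exists>m<length ns.
      sum_list (take m ns) \<le> i \<and> i < sum_list (take (Suc m) ns) \<and>
      sum_list (take m ns) \<le> j \<and> j < sum_list (take (Suc m) ns))"

definition block_unitary :: "nat list \<Rightarrow> complex mat set" where
  "block_unitary ns = {A \<in> unitary_group (sum_list ns).
      \<forall>i<sum_list ns. \<forall>j<sum_list ns. \<not> same_block ns i j \<longrightarrow> A $$ (i,j) = 0}"

text \<open>Parameter space R^a, realised as functions nat => real vanishing from index a on.\<close>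
definition param_space :: "nat \<Rightarrow> (nat \<Rightarrow> real) set" where
  "param_space a = {\<theta>. \<forall>i\<ge>a. \<theta> i = 0}"

text \<open>T is a toral subgroup of O(n) isomorphic to the a-torus R^a/Z^a: it is the image of a
  continuous homomorphism R^a -> O(n) whose kernel is exactly Z^a.\<close>
definition toral_subgroup_O :: "nat \<Rightarrow> nat \<Rightarrow> complex mat set \<Rightarrow> bool" where
  "toral_subgroup_O n a T \<longleftrightarrow> (\<exists>\<phi> :: (nat \<Rightarrow> real) \<Rightarrow> complex mat.
      (\<forall>\<theta>\<in>param_space a. \<phi> \<theta> \<in> orthogonal_group n) \<and>
      (\<forall>\<theta>\<in>param_space a. \<forall>\<eta>\<in>param_space a. \<phi> (\<lambda>i. \<theta> i + \<eta> i) = \<phi> \<theta> * \<phi> \<eta>) \<and>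
      (\<forall>\<theta>\<in>param_space a. \<phi> \<theta> = 1\<^sub>m n \<longleftrightarrow> (\<forall>i<a. \<theta> i \<in> \<int>)) \<and>
      (\<forall>i<n. \<forall>j<n. continuous_on (param_space a) (\<lambda>\<theta>. \<phi> \<theta> $$ (i,j))) \<and>
      T = \<phi> ` param_space a)"

definition prod_sets :: "nat \<Rightarrow> complex mat set list \<Rightarrow> complex mat set" where
  "prod_sets n Ts = foldr (\<lambda>T S. {x * y | x y. x \<in> T \<and> y \<in> S}) Ts {1\<^sub>m n}"

definition triple_decomp :: "complex mat set \<Rightarrow> complex mat set \<Rightarrow> complex mat set \<Rightarrow> complex mat set \<Rightarrow> bool" where
  "triple_decomp G L B H \<longleftrightarrow> G = {x * b * h | x b h. x \<in> L \<and> b \<in> B \<and> h \<in> H}"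

end

theory Submission
  imports Defs "Jordan_Normal_Form.Determinant"
begin

text \<open>Multiplying \<open>g\<close> by \<open>L\<close> on the left and \<open>H\<close> on the right, plane rotations are split off one at a
  time; what remains after each step fixes the two basis vectors already treated.

  Two blocks: a corner entry that is maximal among all translates of \<open>g\<close> spans, together with the
  complementary row and column, an invariant coordinate plane, so the rotation planes are
  \<open>(i, n-1-i)\<close>.

  Blocks \<open>1, n2, n3\<close>: right multiplication by \<open>H\<close> turns the row of the one-dimensional block into
  the row of a rotation in the plane \<open>(0, n-1)\<close>; left multiplication then turns column \<open>n-1\<close> into the
  column of a rotation in the plane \<open>(1, n-1)\<close>. What remains has the same shape, with index \<open>1\<close> as the
  new one-dimensional block, and all later factors commute past the earlier ones.

  Three blocks and a two-dimensional subspace: the two-block case is applied to \<open>n1 | n2 + n3\<close> and then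
  to the factor in \<open>U(n2 + n3)\<close>. A factor in \<open>U(2)\<close> is left over; it is a rotation up to phases, which
  can be moved to the outside.

  A line: every block is reduced to one nonnegative coordinate, and a product of plane rotations
  gives spherical coordinates.\<close>

section \<open>Unitary matrices with prescribed support\<close>

text \<open>Factoring \<open>g\<close> is not the difficulty; the difficulty is to end with few tori
  in a fixed order, so the rotations of many steps must merge into one torus of the stated rank. All
  planes of one torus therefore come from a single matching \<open>\<sigma>\<close> of the
  coordinates: rotations in the planes of a matching commute, their angles add, and one endpoint per
  plane gives a homomorphism from R^a with kernel Z^a. Merging also requires that block factors
  found later move outwards past rotations found earlier. This is why every matrix carries a
  support: matrices with disjoint supports commute. Phases are harmless as long as they stand next
  to a block factor, because diagonal matrices lie in every block group. Only in the case of a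
  two-dimensional subspace do they get caught between two tori. For blocks \<open>1, n2, n3\<close>
  the second rank contains \<open>n2 + 1\<close> and \<open>n3 + 1\<close> because a row can still
  be reduced by right multiplication when one of the two left blocks is already used up.\<close>

lemma mat_mult_entry:
  assumes "A \<in> carrier_mat n n" "B \<in> carrier_mat n n" "i < n" "j < n"
  shows "(A * B) $$ (i,j) = (\<Sum>k<n. A $$ (i,k) * B $$ (k,j))"
  using assms by (auto simp: scalar_prod_def atLeast0LessThan)

lemma sq_mult_carrier [simp]:
  "A \<in> carrier_mat n n \<Longrightarrow> B \<in> carrier_mat n n \<Longrightarrow> A * B \<in> carrier_mat n n"
  by (rule mult_carrier_mat)

lemma sq_mult_assoc:
  "A \<in> carrier_mat n n \<Longrightarrow> B \<in> carrier_mat n n \<Longrightarrow> C \<in> carrier_mat n n \<Longrightarrow>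
    A * B * C = A * (B * C)"
  by (rule assoc_mult_mat)

lemma sq_mult_one [simp]:
  fixes A :: "complex mat"
  shows "A \<in> carrier_mat n n \<Longrightarrow> A * 1\<^sub>m n = A" and "A \<in> carrier_mat n n \<Longrightarrow> 1\<^sub>m n * A = A"
  by (rule right_mult_one_mat left_mult_one_mat, assumption)+

lemma sq_transpose_entry:
  "A \<in> carrier_mat n n \<Longrightarrow> i < n \<Longrightarrow> j < n \<Longrightarrow> transpose_mat A $$ (i,j) = A $$ (j,i)"
  by auto

lemma mat_adj_carrier [simp]: "A \<in> carrier_mat n n \<Longrightarrow> mat_adj A \<in> carrier_mat n n"
  by (simp add: mat_adj_def)

lemma mat_adj_entry [simp]:
  "A \<in> carrier_mat n n \<Longrightarrow> i < n \<Longrightarrow> j < n \<Longrightarrow> mat_adj A $$ (i,j) = cnj (A $$ (j,i))"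
  by (simp add: mat_adj_def)

lemma mat_adj_adj [simp]: "mat_adj (mat_adj A) = A"
  by (rule eq_matI) (auto simp: mat_adj_def)

lemma mat_adj_mult:
  assumes "A \<in> carrier_mat n n" "B \<in> carrier_mat n n"
  shows "mat_adj (A * B) = mat_adj B * mat_adj A"
proof (rule eq_matI)
  fix i j assume "i < dim_row (mat_adj B * mat_adj A)" "j < dim_col (mat_adj B * mat_adj A)"
  then have ij: "i < n" "j < n" using assms by (auto simp: mat_adj_def)
  have "mat_adj (A * B) $$ (i,j) = cnj (\<Sum>k<n. A $$ (j,k) * B $$ (k,i))"
    using assms ij by (simp add: mat_mult_entry[OF assms] mat_adj_entry[of _ n] del: index_mult_mat)
  also have "\<dots> = (mat_adj B * mat_adj A) $$ (i,j)"
    using assms ij by (subst mat_mult_entry[of _ n]) (auto simp: mult.commute intro!: sum.cong)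
  finally show "mat_adj (A * B) $$ (i,j) = (mat_adj B * mat_adj A) $$ (i,j)" .
qed (use assms in \<open>auto simp: mat_adj_def\<close>)

lemma unitary_carrier [simp]: "A \<in> unitary_group n \<Longrightarrow> A \<in> carrier_mat n n"
  by (simp add: unitary_group_def)

lemma unitary_mult_adj [simp]: "A \<in> unitary_group n \<Longrightarrow> A * mat_adj A = 1\<^sub>m n"
  unfolding unitary_group_def by blast

lemma unitaryI: "A \<in> carrier_mat n n \<Longrightarrow> A * mat_adj A = 1\<^sub>m n \<Longrightarrow> A \<in> unitary_group n"
  unfolding unitary_group_def by blast

lemma unitary_adj_mult [simp]: "A \<in> unitary_group n \<Longrightarrow> mat_adj A * A = 1\<^sub>m n"
  by (rule mat_mult_left_right_inverse[of A]) auto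

lemma unitary_adj:
  assumes "A \<in> unitary_group n"
  shows "mat_adj A \<in> unitary_group n"
proof -
  have "mat_adj A * mat_adj (mat_adj A) = 1\<^sub>m n" using assms by simp
  then show ?thesis using unitary_carrier[OF assms] by (intro unitaryI) auto
qed

lemma unitary_mult:
  assumes "A \<in> unitary_group n" "B \<in> unitary_group n"
  shows "A * B \<in> unitary_group n"
proof -
  have c: "A \<in> carrier_mat n n" "B \<in> carrier_mat n n" using assms by auto
  have "A * B * mat_adj (A * B) = A * (B * mat_adj B) * mat_adj A"
    using c by (simp add: mat_adj_mult[OF c] sq_mult_assoc[of _ n])
  also have "\<dots> = 1\<^sub>m n" using assms c by simp
  finally show ?thesis using c by (intro unitaryI) auto
qed

lemma unitary_iff_rows:
  "A \<in> unitary_group n \<longleftrightarrow> A \<in> carrier_mat n n \<and>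
     (\<forall>i<n. \<forall>j<n. (\<Sum>k<n. A $$ (i,k) * cnj (A $$ (j,k))) = (if i = j then 1 else 0))"
proof (cases "A \<in> carrier_mat n n")
  case True
  have e: "(A * mat_adj A) $$ (i,j) = (\<Sum>k<n. A $$ (i,k) * cnj (A $$ (j,k)))"
    if "i < n" "j < n" for i j
    using that True by (subst mat_mult_entry[of _ n]) auto
  have "A * mat_adj A = 1\<^sub>m n \<longleftrightarrow>
     (\<forall>i<n. \<forall>j<n. (A * mat_adj A) $$ (i,j) = (if i = j then 1 else 0))"
  proof
    assume "\<forall>i<n. \<forall>j<n. (A * mat_adj A) $$ (i,j) = (if i = j then 1 else 0)"
    then show "A * mat_adj A = 1\<^sub>m n" using True
      by (intro eq_matI) (auto simp: mat_adj_def)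
  qed (auto)
  then show ?thesis using True e unfolding unitary_group_def by auto
qed (auto)

lemma unitary_rows:
  "A \<in> unitary_group n \<Longrightarrow> i < n \<Longrightarrow> j < n \<Longrightarrow>
    (\<Sum>k<n. A $$ (i,k) * cnj (A $$ (j,k))) = (if i = j then 1 else 0)"
  using unitary_iff_rows by blast

lemma unitary_rowsI:
  "A \<in> carrier_mat n n \<Longrightarrow>
   (\<And>i j. i < n \<Longrightarrow> j < n \<Longrightarrow> (\<Sum>k<n. A $$ (i,k) * cnj (A $$ (j,k))) = (if i = j then 1 else 0)) \<Longrightarrow>
   A \<in> unitary_group n"
  using unitary_iff_rows by blast

lemma unitary_cols:
  assumes "A \<in> unitary_group n" "i < n" "j < n"
  shows "(\<Sum>k<n. cnj (A $$ (k,i)) * A $$ (k,j)) = (if i = j then 1 else 0)"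
proof -
  have "(\<Sum>k<n. cnj (A $$ (k,i)) * A $$ (k,j)) = (\<Sum>k<n. mat_adj A $$ (i,k) * cnj (mat_adj A $$ (j,k)))"
    using assms by (intro sum.cong) (auto simp: mat_adj_entry[of _ n])
  then show ?thesis using unitary_rows[OF unitary_adj[OF assms(1)] assms(2,3)] by simp
qed

lemma unitary_transpose:
  assumes "A \<in> unitary_group n"
  shows "transpose_mat A \<in> unitary_group n"
proof -
  have c: "A \<in> carrier_mat n n" using assms by auto
  have "(\<Sum>k<n. A $$ (k,i) * cnj (A $$ (k,j))) = (if i = j then 1 else 0)" if "i < n" "j < n" for i j
    using unitary_cols[OF assms that(2,1)] by (auto simp: mult.commute)
  then show ?thesis using c by (intro unitary_rowsI) auto
qed

lemma unitary_row_norm: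
  assumes "A \<in> unitary_group n" "i < n"
  shows "(\<Sum>k<n. (cmod (A $$ (i,k)))\<^sup>2) = 1"
proof -
  have "complex_of_real (\<Sum>k<n. (cmod (A $$ (i,k)))\<^sup>2) = 1"
    using unitary_rows[OF assms assms(2)] by (simp add: complex_norm_square del: of_real_power)
  then show ?thesis by (metis of_real_eq_1_iff)
qed

text \<open>\<open>I\<close> is where the matrix may differ from the identity, and
  \<open>\<beta>\<close> labels coordinates by blocks. Groups acting on some coordinates only and
  block-diagonal groups thus become instances of one notion with one set of closure lemmas. The
  label type is left open so that cuts \<open>x < c\<close>, block numbers and \<open>id\<close>
  (diagonal matrices) all qualify.\<close>

definition supp_unitary :: "nat \<Rightarrow> nat set \<Rightarrow> (nat \<Rightarrow> 'b) \<Rightarrow> complex mat set" where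
  "supp_unitary n I \<beta> = {A \<in> unitary_group n. \<forall>i<n. \<forall>j<n.
     (i \<notin> I \<or> j \<notin> I \<longrightarrow> A $$ (i,j) = (if i = j then 1 else 0)) \<and>
     (\<beta> i \<noteq> \<beta> j \<longrightarrow> A $$ (i,j) = 0)}"

abbreviation sub_unitary :: "nat \<Rightarrow> nat set \<Rightarrow> complex mat set" where
  "sub_unitary n I \<equiv> supp_unitary n I (\<lambda>_. ())"

lemma supp_unitary_unitary: "A \<in> supp_unitary n I \<beta> \<Longrightarrow> A \<in> unitary_group n"
  by (simp add: supp_unitary_def)

lemma supp_unitary_carrier [simp]: "A \<in> supp_unitary n I \<beta> \<Longrightarrow> A \<in> carrier_mat n n"
  by (rule unitary_carrier) (rule supp_unitary_unitary)

lemma supp_unitary_outside: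
  "A \<in> supp_unitary n I \<beta> \<Longrightarrow> i < n \<Longrightarrow> j < n \<Longrightarrow> i \<notin> I \<or> j \<notin> I \<Longrightarrow>
    A $$ (i,j) = (if i = j then 1 else 0)"
  unfolding supp_unitary_def by blast

lemma supp_unitary_label:
  "A \<in> supp_unitary n I \<beta> \<Longrightarrow> i < n \<Longrightarrow> j < n \<Longrightarrow> \<beta> i \<noteq> \<beta> j \<Longrightarrow> A $$ (i,j) = 0"
  unfolding supp_unitary_def by blast

lemma supp_unitaryI:
  assumes "A \<in> unitary_group n"
    and "\<And>i j. i < n \<Longrightarrow> j < n \<Longrightarrow> i \<notin> I \<or> j \<notin> I \<Longrightarrow> A $$ (i,j) = (if i = j then 1 else 0)"
    and "\<And>i j. i < n \<Longrightarrow> j < n \<Longrightarrow> \<beta> i \<noteq> \<beta> j \<Longrightarrow> A $$ (i,j) = 0"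
  shows "A \<in> supp_unitary n I \<beta>"
  using assms unfolding supp_unitary_def by blast

text \<open>Off \<open>I\<close> the matrix is the identity, so the two labellings have to be
  compared inside \<open>I\<close> only.\<close>

lemma supp_unitary_mono:
  assumes "A \<in> supp_unitary n I \<beta>" "I \<subseteq> J"
    and "\<And>i j. i \<in> I \<Longrightarrow> j \<in> I \<Longrightarrow> i < n \<Longrightarrow> j < n \<Longrightarrow> \<beta> i = \<beta> j \<Longrightarrow> \<gamma> i = \<gamma> j"
  shows "A \<in> supp_unitary n J \<gamma>"
proof (rule supp_unitaryI)
  show "A \<in> unitary_group n" using assms(1) by (rule supp_unitary_unitary)
next
  fix i j assume "i < n" "j < n" "i \<notin> J \<or> j \<notin> J"
  then show "A $$ (i,j) = (if i = j then 1 else 0)"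
    using assms(2) by (intro supp_unitary_outside[OF assms(1)]) auto
next
  fix i j assume ij: "i < n" "j < n" "\<gamma> i \<noteq> \<gamma> j"
  show "A $$ (i,j) = 0"
  proof (cases "i \<in> I \<and> j \<in> I")
    case True
    then show ?thesis using ij assms(3) supp_unitary_label[OF assms(1)] by blast
  next
    case False
    then show ?thesis using ij supp_unitary_outside[OF assms(1), of i j] by auto
  qed
qed

lemma supp_unitary_sub:
  "A \<in> supp_unitary n I \<beta> \<Longrightarrow> I \<subseteq> J \<Longrightarrow> A \<in> sub_unitary n J"
  by (erule supp_unitary_mono) auto

lemma sub_unitary_supp:
  "A \<in> sub_unitary n I \<Longrightarrow> I \<subseteq> J \<Longrightarrow> (\<And>i. i \<in> I \<Longrightarrow> \<beta> i = b) \<Longrightarrow> A \<in> supp_unitary n J \<beta>"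
  by (erule supp_unitary_mono) auto

lemma supp_unitary_subset:
  "A \<in> supp_unitary n I \<beta> \<Longrightarrow> I \<subseteq> J \<Longrightarrow> A \<in> supp_unitary n J \<beta>"
  by (erule supp_unitary_mono) auto

lemma unitary_one [simp]: "1\<^sub>m n \<in> unitary_group n"
proof (rule unitary_rowsI)
  fix i j assume "i < n" "j < n"
  moreover have "(\<Sum>k<n. 1\<^sub>m n $$ (i,k) * cnj (1\<^sub>m n $$ (j,k))) = (\<Sum>k<n. if i = k then (if i = j then 1 else 0 :: complex) else 0)"
    using \<open>i < n\<close> \<open>j < n\<close> by (intro sum.cong) auto
  ultimately show "(\<Sum>k<n. 1\<^sub>m n $$ (i,k) * cnj (1\<^sub>m n $$ (j,k))) = (if i = j then 1 else 0 :: complex)"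
    by simp
qed simp

lemma supp_unitary_one [simp]: "1\<^sub>m n \<in> supp_unitary n I \<beta>"
  by (rule supp_unitaryI) auto

lemma sum_delta_left:
  fixes f g :: "nat \<Rightarrow> complex"
  assumes "i < n" "\<And>k. k < n \<Longrightarrow> f k = (if i = k then 1 else 0)"
  shows "(\<Sum>k<n. f k * g k) = g i"
proof -
  have "(\<Sum>k<n. f k * g k) = (\<Sum>k<n. if i = k then g k else 0)"
    using assms(2) by (intro sum.cong) auto
  then show ?thesis using assms(1) by simp
qed

lemma sum_delta_right:
  fixes f g :: "nat \<Rightarrow> complex"
  assumes "i < n" "\<And>k. k < n \<Longrightarrow> g k = (if k = i then 1 else 0)"
  shows "(\<Sum>k<n. f k * g k) = f i"
proof -
  have "(\<Sum>k<n. f k * g k) = (\<Sum>k<n. if k = i then f k else 0)"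
    using assms(2) by (intro sum.cong) auto
  then show ?thesis using assms(1) by simp
qed

lemma supp_unitary_mult:
  assumes "A \<in> supp_unitary n I \<beta>" "B \<in> supp_unitary n I \<beta>"
  shows "A * B \<in> supp_unitary n I \<beta>"
proof (rule supp_unitaryI)
  show "A * B \<in> unitary_group n"
    using assms by (intro unitary_mult supp_unitary_unitary)
next
  fix i j assume ij: "i < n" "j < n" and o: "i \<notin> I \<or> j \<notin> I"
  have e: "(A * B) $$ (i,j) = (\<Sum>k<n. A $$ (i,k) * B $$ (k,j))"
    using assms ij by (intro mat_mult_entry) auto
  show "(A * B) $$ (i,j) = (if i = j then 1 else 0)"
  proof (cases "i \<notin> I")
    case True
    then have "(\<Sum>k<n. A $$ (i,k) * B $$ (k,j)) = B $$ (i,j)"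
      using ij by (intro sum_delta_left) (auto simp: supp_unitary_outside[OF assms(1)])
    then show ?thesis using e supp_unitary_outside[OF assms(2) ij] True by simp
  next
    case False
    then have "(\<Sum>k<n. A $$ (i,k) * B $$ (k,j)) = A $$ (i,j)"
      using ij o by (intro sum_delta_right) (auto simp: supp_unitary_outside[OF assms(2)])
    then show ?thesis using e supp_unitary_outside[OF assms(1) ij o] by simp
  qed
next
  fix i j assume ij: "i < n" "j < n" and l: "\<beta> i \<noteq> \<beta> j"
  have "(A * B) $$ (i,j) = (\<Sum>k<n. A $$ (i,k) * B $$ (k,j))"
    using assms ij by (intro mat_mult_entry) auto
  also have "\<dots> = 0"
  proof (intro sum.neutral ballI)
    fix k assume "k \<in> {..<n}"
    then have k: "k < n" by simp
    show "A $$ (i,k) * B $$ (k,j) = 0"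
    proof (cases "\<beta> i = \<beta> k")
      case True
      then show ?thesis using l supp_unitary_label[OF assms(2) k ij(2)] by simp
    next
      case False
      then show ?thesis using supp_unitary_label[OF assms(1) ij(1) k] by simp
    qed
  qed
  finally show "(A * B) $$ (i,j) = 0" .
qed

lemma supp_unitary_adj:
  assumes "A \<in> supp_unitary n I \<beta>"
  shows "mat_adj A \<in> supp_unitary n I \<beta>"
proof (rule supp_unitaryI)
  show "mat_adj A \<in> unitary_group n" using assms by (intro unitary_adj supp_unitary_unitary)
next
  fix i j assume "i < n" "j < n" "i \<notin> I \<or> j \<notin> I"
  then show "mat_adj A $$ (i,j) = (if i = j then 1 else 0)"
    using supp_unitary_outside[OF assms, of j i] assms by (auto simp: mat_adj_entry[of _ n])
next
  fix i j assume "i < n" "j < n" "\<beta> i \<noteq> \<beta> j"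
  then show "mat_adj A $$ (i,j) = 0"
    using supp_unitary_label[OF assms, of j i] assms by (auto simp: mat_adj_entry[of _ n])
qed

lemma supp_unitary_transpose:
  assumes "A \<in> supp_unitary n I \<beta>"
  shows "transpose_mat A \<in> supp_unitary n I \<beta>"
proof (rule supp_unitaryI)
  show "transpose_mat A \<in> unitary_group n" using assms by (intro unitary_transpose supp_unitary_unitary)
next
  fix i j assume "i < n" "j < n" "i \<notin> I \<or> j \<notin> I"
  then show "transpose_mat A $$ (i,j) = (if i = j then 1 else 0)"
    using supp_unitary_outside[OF assms, of j i] supp_unitary_carrier[OF assms] by auto
next
  fix i j assume "i < n" "j < n" "\<beta> i \<noteq> \<beta> j"
  then show "transpose_mat A $$ (i,j) = 0"
    using supp_unitary_label[OF assms, of j i] supp_unitary_carrier[OF assms] by auto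
qed

text \<open>This is what lets factors from different steps pass each other. If row and column both
  avoid one support, both products have the entry of the other factor; if the row lies in one
  support and the column in the other, both products vanish there, since a nonzero term would need
  an index in both.\<close>

lemma supp_unitary_commute:
  assumes A: "A \<in> supp_unitary n I \<beta>" and B: "B \<in> supp_unitary n J \<gamma>" and "I \<inter> J = {}"
  shows "A * B = B * A"
proof (rule eq_matI)
  fix i j assume "i < dim_row (B * A)" "j < dim_col (B * A)"
  then have ij: "i < n" "j < n"
    using supp_unitary_carrier[OF A] supp_unitary_carrier[OF B] by auto
  have e: "(A * B) $$ (i,j) = (\<Sum>k<n. A $$ (i,k) * B $$ (k,j))"
          "(B * A) $$ (i,j) = (\<Sum>k<n. B $$ (i,k) * A $$ (k,j))"
    using A B ij by (auto intro!: mat_mult_entry)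
  have row: "(\<Sum>k<n. M $$ (i,k) * N $$ (k,j)) = N $$ (i,j)"
    if "M \<in> supp_unitary n K \<delta>" "i \<notin> K" for M N :: "complex mat" and K and \<delta> :: "nat \<Rightarrow> 'd"
    using that ij by (intro sum_delta_left) (auto simp: supp_unitary_outside[OF that(1)])
  have col: "(\<Sum>k<n. M $$ (i,k) * N $$ (k,j)) = M $$ (i,j)"
    if "N \<in> supp_unitary n K \<delta>" "j \<notin> K" for M N :: "complex mat" and K and \<delta> :: "nat \<Rightarrow> 'd"
    using that ij by (intro sum_delta_right) (auto simp: supp_unitary_outside[OF that(1)])
  note A' = supp_unitary_mono[OF A subset_refl, of "\<lambda>_. ()", simplified]
  note B' = supp_unitary_mono[OF B subset_refl, of "\<lambda>_. ()", simplified]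
  note oA = supp_unitary_outside[OF A ij] and oB = supp_unitary_outside[OF B ij]
  consider "i \<notin> I" "j \<notin> I" | "i \<notin> J" "j \<notin> J" | "i \<in> I" "j \<in> J" | "i \<in> J" "j \<in> I"
    using assms(3) by blast
  then show "(A * B) $$ (i,j) = (B * A) $$ (i,j)"
  proof cases
    case 1
    then show ?thesis using e row[OF A', of B] col[OF A', of B] by simp
  next
    case 2
    then show ?thesis using e row[OF B', of A] col[OF B', of A] by simp
  next
    case 3
    then have n: "i \<notin> J" "j \<notin> I" "i \<noteq> j" using assms(3) by auto
    have "(A * B) $$ (i,j) = 0"
    proof -
      have "A $$ (i,k) * B $$ (k,j) = 0" if "k < n" for k
        using that ij n supp_unitary_outside[OF A, of i k] supp_unitary_outside[OF B, of k j] 3 assms(3)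
        by (cases "k \<in> I"; cases "k \<in> J") auto
      then show ?thesis unfolding e by (intro sum.neutral) blast
    qed
    moreover have "(B * A) $$ (i,j) = 0"
      using e row[OF B', of A] n oA by simp
    ultimately show ?thesis by simp
  next
    case 4
    then have n: "i \<notin> I" "j \<notin> J" "i \<noteq> j" using assms(3) by auto
    have "(B * A) $$ (i,j) = 0"
    proof -
      have "B $$ (i,k) * A $$ (k,j) = 0" if "k < n" for k
        using that ij n supp_unitary_outside[OF B, of i k] supp_unitary_outside[OF A, of k j] 4 assms(3)
        by (cases "k \<in> I"; cases "k \<in> J") auto
      then show ?thesis unfolding e by (intro sum.neutral) blast
    qed
    moreover have "(A * B) $$ (i,j) = 0"
      using e row[OF A', of B] n oB by simp
    ultimately show ?thesis by simp
  qed
qed (use A B in \<open>auto dest!: supp_unitary_carrier\<close>)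

lemma unitary_unit_entry_row:
  assumes "A \<in> unitary_group n" "i < n" "j < n" "cmod (A $$ (i,j)) = 1" "k < n" "k \<noteq> j"
  shows "A $$ (i,k) = 0"
proof -
  have "1 = (\<Sum>l<n. (cmod (A $$ (i,l)))\<^sup>2)" using unitary_row_norm[OF assms(1,2)] by simp
  also have "\<dots> = 1 + (\<Sum>l\<in>{..<n}-{j}. (cmod (A $$ (i,l)))\<^sup>2)"
    using assms by (subst sum.remove[of _ j]) auto
  finally have "(\<Sum>l\<in>{..<n}-{j}. (cmod (A $$ (i,l)))\<^sup>2) = 0" by simp
  then have "\<forall>l\<in>{..<n}-{j}. (cmod (A $$ (i,l)))\<^sup>2 = 0"
    by (subst (asm) sum_nonneg_eq_0_iff) auto
  then show ?thesis using assms by auto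
qed

lemma unitary_unit_entry_col:
  assumes "A \<in> unitary_group n" "i < n" "j < n" "cmod (A $$ (i,j)) = 1" "k < n" "k \<noteq> i"
  shows "A $$ (k,j) = 0"
  using unitary_unit_entry_row[OF unitary_transpose[OF assms(1)] assms(3,2), of k] assms
    unitary_carrier[OF assms(1)] by auto

text \<open>Row and column norms leave no room beside a diagonal entry 1. Reduction steps end here:
  producing such an entry removes one index from the support.\<close>

lemma sub_unitary_remove:
  assumes "A \<in> sub_unitary n I" "a < n" "A $$ (a,a) = 1"
  shows "A \<in> sub_unitary n (I - {a})"
proof (rule supp_unitaryI)
  note u = supp_unitary_unitary[OF assms(1)]
  show "A \<in> unitary_group n" by (rule u)
  fix i j assume ij: "i < n" "j < n" and o: "i \<notin> I - {a} \<or> j \<notin> I - {a}"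
  show "A $$ (i,j) = (if i = j then 1 else 0)"
  proof (cases "i = a \<or> j = a")
    case True
    then show ?thesis
      using unitary_unit_entry_row[OF u assms(2,2)] unitary_unit_entry_col[OF u assms(2,2)] assms ij
      by auto
  next
    case False
    then show ?thesis using supp_unitary_outside[OF assms(1) ij] o by blast
  qed
qed auto

lemma sub_unitary_mult_entry:
  assumes "A \<in> sub_unitary n I" "g \<in> carrier_mat n n" "I \<subseteq> {..<n}" "i < n" "j < n"
  shows "(A * g) $$ (i,j) = (if i \<in> I then \<Sum>k\<in>I. A $$ (i,k) * g $$ (k,j) else g $$ (i,j))"
proof -
  have e: "(A * g) $$ (i,j) = (\<Sum>k<n. A $$ (i,k) * g $$ (k,j))"
    using assms by (intro mat_mult_entry) auto
  show ?thesis
  proof (cases "i \<in> I")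
    case True
    have "(\<Sum>k<n. A $$ (i,k) * g $$ (k,j)) = (\<Sum>k\<in>I. A $$ (i,k) * g $$ (k,j))"
      using assms True by (intro sum.mono_neutral_right) (auto simp: supp_unitary_outside[OF assms(1)])
    then show ?thesis using e True by simp
  next
    case False
    have "(\<Sum>k<n. A $$ (i,k) * g $$ (k,j)) = g $$ (i,j)"
      using assms False by (intro sum_delta_left) (auto simp: supp_unitary_outside[OF assms(1)])
    then show ?thesis using e False by simp
  qed
qed

lemma mult_sub_unitary_entry:
  assumes "A \<in> sub_unitary n I" "g \<in> carrier_mat n n" "I \<subseteq> {..<n}" "i < n" "j < n"
  shows "(g * A) $$ (i,j) = (if j \<in> I then \<Sum>k\<in>I. g $$ (i,k) * A $$ (k,j) else g $$ (i,j))"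
proof -
  have e: "(g * A) $$ (i,j) = (\<Sum>k<n. g $$ (i,k) * A $$ (k,j))"
    using assms by (intro mat_mult_entry) auto
  show ?thesis
  proof (cases "j \<in> I")
    case True
    have "(\<Sum>k<n. g $$ (i,k) * A $$ (k,j)) = (\<Sum>k\<in>I. g $$ (i,k) * A $$ (k,j))"
      using assms True by (intro sum.mono_neutral_right) (auto simp: supp_unitary_outside[OF assms(1)])
    then show ?thesis using e True by simp
  next
    case False
    have "(\<Sum>k<n. g $$ (i,k) * A $$ (k,j)) = g $$ (i,j)"
      using assms False by (intro sum_delta_right) (auto simp: supp_unitary_outside[OF assms(1)])
    then show ?thesis using e False by simp
  qed
qed

section \<open>Householder matrices acting on a block of coordinates\<close>

lemma householder:
  fixes v :: "nat \<Rightarrow> complex"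
  assumes I: "I \<subseteq> {..<n}" and a: "a \<in> I"
  obtains A where "A \<in> sub_unitary n I"
    "\<And>i. i \<in> I \<Longrightarrow> (\<Sum>k\<in>I. A $$ (i,k) * v k) =
       (if i = a then of_real (sqrt (\<Sum>k\<in>I. (cmod (v k))\<^sup>2)) else 0)"
proof -
  have fin: "finite I" using I finite_subset by blast
  define r where "r = sqrt (\<Sum>k\<in>I. (cmod (v k))\<^sup>2)"
  \<comment> \<open>The phase \<open>z\<close> makes \<open>z * v a\<close> real and nonnegative. A
    complex reflection carries one vector to another of equal norm only if their inner product is
    real, so this correction precedes the reflection along \<open>w\<close>.\<close>
  define z where "z = (if v a = 0 then 1 else cnj (sgn (v a)))"
  have z1: "z * cnj z = 1"
    by (auto simp: z_def complex_norm_square[symmetric] norm_sgn)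
  have za: "z * v a = of_real (cmod (v a))"
  proof (cases "v a = 0")
    case False
    then have "cnj (sgn (v a)) * v a = of_real (cmod (v a) ^ 2 / cmod (v a))"
      by (simp add: sgn_eq complex_norm_square del: of_real_power)
    then show ?thesis using False by (simp add: z_def power2_eq_square)
  qed (simp add: z_def)
  define u where "u k = z * v k" for k
  define w where "w k = u k - (if k = a then of_real r else 0)" for k
  define N where "N = (\<Sum>k\<in>I. w k * cnj (w k))"
  \<comment> \<open>If \<open>w\<close> vanishes on \<open>I\<close>, then \<open>N = 0\<close> and
    \<open>c = 0\<close>, division by zero being zero; the matrix below is then \<open>z\<close>
    times the identity on \<open>I\<close>, which is what is wanted.\<close>
  define c where "c = 2 / N"
  have rr: "complex_of_real (r * r) = (\<Sum>k\<in>I. u k * cnj (u k))"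
  proof -
    have "complex_of_real (r * r) = (\<Sum>k\<in>I. v k * cnj (v k))"
      by (simp add: r_def sum_nonneg complex_norm_square del: of_real_power flip: of_real_mult)
    also have "\<dots> = (\<Sum>k\<in>I. (z * cnj z) * (v k * cnj (v k)))" by (simp add: z1)
    also have "\<dots> = (\<Sum>k\<in>I. u k * cnj (u k))"
      by (intro sum.cong) (auto simp: u_def algebra_simps)
    finally show ?thesis .
  qed
  have ua: "u a = of_real (cmod (v a))" "cnj (u a) = u a" using za by (auto simp: u_def)
  have X: "(\<Sum>k\<in>I. cnj (w k) * u k) = of_real (r * r) - of_real r * u a"
  proof -
    have "(\<Sum>k\<in>I. cnj (w k) * u k) = (\<Sum>k\<in>I. u k * cnj (u k) - (if k = a then of_real r * u k else 0))"
      by (intro sum.cong) (auto simp: w_def algebra_simps)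
    then show ?thesis using fin a by (simp add: sum_subtractf rr[symmetric])
  qed
  \<comment> \<open>Here \<open>u a\<close> being real is used. The squared norm of \<open>w\<close>
    is twice its inner product with \<open>u\<close>, so the reflection subtracts exactly
    \<open>w\<close> from \<open>u\<close>.\<close>
  have N2: "N = 2 * (\<Sum>k\<in>I. cnj (w k) * u k)"
  proof -
    have "N = (\<Sum>k\<in>I. cnj (w k) * u k - (if k = a then of_real r * cnj (w k) else 0))"
      unfolding N_def by (intro sum.cong) (auto simp: w_def algebra_simps)
    also have "\<dots> = (\<Sum>k\<in>I. cnj (w k) * u k) - of_real r * cnj (w a)"
      using fin a by (simp add: sum_subtractf)
    also have "of_real r * cnj (w a) = - (\<Sum>k\<in>I. cnj (w k) * u k)"
      unfolding X by (simp add: w_def ua(2) algebra_simps)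
    finally show ?thesis by simp
  qed
  have cN: "c * c * N = 2 * c" by (simp add: c_def)
  have w0: "w i = 0" if "N = 0" "i \<in> I" for i
  proof -
    have "complex_of_real (\<Sum>k\<in>I. (cmod (w k))\<^sup>2) = 0"
      using that(1) by (simp add: N_def complex_norm_square del: of_real_power)
    then have "(\<Sum>k\<in>I. (cmod (w k))\<^sup>2) = 0" by (metis of_real_eq_0_iff)
    then show ?thesis using that(2) fin by (simp add: sum_nonneg_eq_0_iff)
  qed
  define A where "A = mat n n (\<lambda>(i,k). if i \<in> I \<and> k \<in> I
     then z * ((if i = k then 1 else 0) - c * w i * cnj (w k)) else (if i = k then 1 else 0))"
  have Ac: "A \<in> carrier_mat n n" by (simp add: A_def)
  have cr: "cnj c = c"
  proof -
    have "cnj N = N" by (simp add: N_def mult.commute)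
    then show ?thesis by (simp add: c_def)
  qed
  have "A \<in> unitary_group n"
  proof (rule unitary_rowsI[OF Ac])
    fix i j assume ij: "i < n" "j < n"
    show "(\<Sum>k<n. A $$ (i,k) * cnj (A $$ (j,k))) = (if i = j then 1 else 0)"
    proof (cases "i \<in> I \<and> j \<in> I")
      case True
      have "(\<Sum>k<n. A $$ (i,k) * cnj (A $$ (j,k))) = (\<Sum>k\<in>I. A $$ (i,k) * cnj (A $$ (j,k)))"
        using ij True I by (intro sum.mono_neutral_right) (auto simp: A_def)
      also have "\<dots> = (\<Sum>k\<in>I. (if i = k then (if i = j then 1 else 0) else 0)
          - (if i = k then c * cnj (w j) * w k else 0)
          - (if j = k then c * w i * cnj (w k) else 0) + c * c * w i * cnj (w j) * (w k * cnj (w k)))"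
      proof (intro sum.cong refl)
        fix k assume "k \<in> I"
        then have "A $$ (i,k) * cnj (A $$ (j,k)) = (z * cnj z) *
           (((if i = k then 1 else 0) - c * w i * cnj (w k)) * ((if j = k then 1 else 0) - c * cnj (w j) * w k))"
          using ij True I by (auto simp: A_def cr algebra_simps)
        also have "\<dots> = (if i = k then (if i = j then 1 else 0) else 0)
          - (if i = k then c * cnj (w j) * w k else 0)
          - (if j = k then c * w i * cnj (w k) else 0) + c * c * w i * cnj (w j) * (w k * cnj (w k))"
          unfolding z1 by (auto simp: algebra_simps)
        finally show "A $$ (i,k) * cnj (A $$ (j,k)) = \<dots>" .
      qed
      also have "\<dots> = (if i = j then 1 else 0) - c * cnj (w j) * w i - c * w i * cnj (w j)
          + c * c * w i * cnj (w j) * N"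
        using fin True by (simp add: sum.distrib sum_subtractf N_def sum_distrib_left)
      also have "c * c * w i * cnj (w j) * N = (c * c * N) * (w i * cnj (w j))"
        by (simp only: ac_simps)
      also have "\<dots> = 2 * c * (w i * cnj (w j))" unfolding cN ..
      finally show ?thesis by (simp add: algebra_simps)
    next
      case False
      show ?thesis
      proof (cases "i \<in> I")
        case True
        then have "j \<notin> I" using False by simp
        then have "(\<Sum>k<n. A $$ (i,k) * cnj (A $$ (j,k))) = A $$ (i,j)"
          using ij by (intro sum_delta_right) (auto simp: A_def)
        then show ?thesis using ij \<open>j \<notin> I\<close> by (auto simp: A_def)
      next
        case False
        then have "(\<Sum>k<n. A $$ (i,k) * cnj (A $$ (j,k))) = cnj (A $$ (j,i))"
          using ij by (intro sum_delta_left) (auto simp: A_def)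
        then show ?thesis using ij False by (auto simp: A_def)
      qed
    qed
  qed
  then have "A \<in> sub_unitary n I"
    by (rule supp_unitaryI) (auto simp: A_def)
  moreover have "(\<Sum>k\<in>I. A $$ (i,k) * v k) = (if i = a then of_real r else 0)" if i: "i \<in> I" for i
  proof -
    have "(\<Sum>k\<in>I. A $$ (i,k) * v k) = (\<Sum>k\<in>I. (if i = k then u k else 0) - c * w i * (cnj (w k) * u k))"
    proof (intro sum.cong refl)
      fix k assume "k \<in> I"
      moreover from this have "i < n" "k < n" using i I by auto
      ultimately have "A $$ (i,k) = z * ((if i = k then 1 else 0) - c * w i * cnj (w k))"
        using i by (simp add: A_def)
      then have "A $$ (i,k) * v k = z * ((if i = k then 1 else 0) - c * w i * cnj (w k)) * v k" by simp
      then show "A $$ (i,k) * v k = (if i = k then u k else 0) - c * w i * (cnj (w k) * u k)"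
        by (simp add: u_def algebra_simps split: if_splits)
    qed
    also have "\<dots> = u i - c * w i * (\<Sum>k\<in>I. cnj (w k) * u k)"
      using fin i by (simp add: sum_subtractf sum_distrib_left)
    also have "\<dots> = u i - w i"
    proof (cases "N = 0")
      case True
      then show ?thesis using w0 i by simp
    next
      case False
      have "c * (\<Sum>k\<in>I. cnj (w k) * u k) = c * N / 2" using N2 by simp
      also have "\<dots> = 1" using False by (simp add: c_def)
      finally have "w i * (c * (\<Sum>k\<in>I. cnj (w k) * u k)) = w i" by simp
      then show ?thesis by (simp add: mult.assoc mult.left_commute)
    qed
    also have "\<dots> = (if i = a then of_real r else 0)" by (simp add: w_def)
    finally show ?thesis .
  qed
  ultimately show thesis using that unfolding r_def by blast
qed

lemma householder_col:
  assumes I: "I \<subseteq> {..<n}" and a: "a \<in> I" and g: "g \<in> carrier_mat n n" and j: "j < n"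
  obtains A where "A \<in> sub_unitary n I"
    "\<And>i. i \<in> I \<Longrightarrow> (A * g) $$ (i,j) =
       (if i = a then of_real (sqrt (\<Sum>k\<in>I. (cmod (g $$ (k,j)))\<^sup>2)) else 0)"
proof -
  obtain A where A: "A \<in> sub_unitary n I"
    "\<And>i. i \<in> I \<Longrightarrow> (\<Sum>k\<in>I. A $$ (i,k) * g $$ (k,j)) =
       (if i = a then of_real (sqrt (\<Sum>k\<in>I. (cmod (g $$ (k,j)))\<^sup>2)) else 0)"
    using householder[OF I a, of "\<lambda>k. g $$ (k,j)"] by blast
  then show thesis using I j sub_unitary_mult_entry[OF A(1) g I _ j]
    by (intro that[OF A(1)]) auto
qed

lemma householder_row:
  assumes I: "I \<subseteq> {..<n}" and a: "a \<in> I" and g: "g \<in> carrier_mat n n" and i: "i < n"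
  obtains A where "A \<in> sub_unitary n I"
    "\<And>j. j \<in> I \<Longrightarrow> (g * A) $$ (i,j) =
       (if j = a then of_real (sqrt (\<Sum>k\<in>I. (cmod (g $$ (i,k)))\<^sup>2)) else 0)"
proof -
  have gt: "transpose_mat g \<in> carrier_mat n n" using g by simp
  obtain A where A: "A \<in> sub_unitary n I"
    "\<And>j. j \<in> I \<Longrightarrow> (A * transpose_mat g) $$ (j,i) =
       (if j = a then of_real (sqrt (\<Sum>k\<in>I. (cmod (transpose_mat g $$ (k,i)))\<^sup>2)) else 0)"
    using householder_col[OF I a gt i] by blast
  note Ac = supp_unitary_carrier[OF A(1)]
  have s: "(\<Sum>k\<in>I. (cmod (transpose_mat g $$ (k,i)))\<^sup>2) = (\<Sum>k\<in>I. (cmod (g $$ (i,k)))\<^sup>2)"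
    using g i I by (intro sum.cong) auto
  have "(g * transpose_mat A) $$ (i,j) =
       (if j = a then of_real (sqrt (\<Sum>k\<in>I. (cmod (g $$ (i,k)))\<^sup>2)) else 0)" if j: "j \<in> I" for j
  proof -
    have jn: "j < n" using j I by auto
    have "g * transpose_mat A = transpose_mat (A * transpose_mat g)"
      using transpose_mult[OF Ac gt] by simp
    then have "(g * transpose_mat A) $$ (i,j) = (A * transpose_mat g) $$ (j,i)"
      using Ac g i jn by (simp del: index_mult_mat(1) add: index_mult_mat(2,3))
    then show ?thesis using A(2)[OF j] s by simp
  qed
  then show thesis using that supp_unitary_transpose[OF A(1)] by blast
qed

section \<open>Rotations and tori\<close>

text \<open>A matching of the coordinates below \<open>n\<close>; fixed points are unmatched
  coordinates. Each matching supplies the planes of one torus.\<close>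

definition involutive_below :: "nat \<Rightarrow> (nat \<Rightarrow> nat) \<Rightarrow> bool" where
  "involutive_below n \<sigma> \<longleftrightarrow> (\<forall>i<n. \<sigma> i < n \<and> \<sigma> (\<sigma> i) = i)"

definition odd_angle :: "nat \<Rightarrow> (nat \<Rightarrow> nat) \<Rightarrow> (nat \<Rightarrow> real) \<Rightarrow> bool" where
  "odd_angle n \<sigma> \<tau> \<longleftrightarrow> (\<forall>i<n. \<tau> (\<sigma> i) = - \<tau> i)"

text \<open>Rotation by \<open>\<tau> i\<close> in each coordinate plane \<open>(i, \<sigma> i)\<close>. Oddness of \<open>\<tau>\<close> makes the two
  descriptions of a plane agree and forces \<open>\<tau> i = 0\<close> at fixed points of \<open>\<sigma>\<close>.\<close>

definition rot :: "nat \<Rightarrow> (nat \<Rightarrow> nat) \<Rightarrow> (nat \<Rightarrow> real) \<Rightarrow> complex mat" where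
  "rot n \<sigma> \<tau> = mat n n (\<lambda>(i,j).
     (if i = j then of_real (cos (\<tau> i)) else 0) - (if j = \<sigma> i then of_real (sin (\<tau> i)) else 0))"

lemma rot_carrier [simp]: "rot n \<sigma> \<tau> \<in> carrier_mat n n"
  by (simp add: rot_def)

lemma rot_entry: "i < n \<Longrightarrow> j < n \<Longrightarrow> rot n \<sigma> \<tau> $$ (i,j) =
   (if i = j then of_real (cos (\<tau> i)) else 0) - (if j = \<sigma> i then of_real (sin (\<tau> i)) else 0)"
  by (simp add: rot_def)

lemma rot_mult_entry:
  assumes "involutive_below n \<sigma>" "g \<in> carrier_mat n n" "i < n" "j < n"
  shows "(rot n \<sigma> \<tau> * g) $$ (i,j) =
    of_real (cos (\<tau> i)) * g $$ (i,j) - of_real (sin (\<tau> i)) * g $$ (\<sigma> i,j)"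
proof -
  have s: "\<sigma> i < n" using assms by (simp add: involutive_below_def)
  have "(rot n \<sigma> \<tau> * g) $$ (i,j) = (\<Sum>k<n. rot n \<sigma> \<tau> $$ (i,k) * g $$ (k,j))"
    using assms by (intro mat_mult_entry) auto
  also have "\<dots> = (\<Sum>k<n. (if k = i then of_real (cos (\<tau> i)) * g $$ (k,j) else 0) -
      (if k = \<sigma> i then of_real (sin (\<tau> i)) * g $$ (k,j) else 0))"
    using assms by (intro sum.cong) (auto simp: rot_entry algebra_simps)
  also have "\<dots> = of_real (cos (\<tau> i)) * g $$ (i,j) - of_real (sin (\<tau> i)) * g $$ (\<sigma> i,j)"
    using assms s by (simp add: sum_subtractf)
  finally show ?thesis .
qed

text \<open>The planes of a matching are mutually orthogonal, so this is the addition theorem in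
  each plane separately. It is the reason why rotations in many planes count as a single torus
  factor.\<close>

lemma rot_mult:
  assumes "involutive_below n \<sigma>" "odd_angle n \<sigma> \<upsilon>"
  shows "rot n \<sigma> \<tau> * rot n \<sigma> \<upsilon> = rot n \<sigma> (\<lambda>i. \<tau> i + \<upsilon> i)"
proof (rule eq_matI)
  fix i j assume "i < dim_row (rot n \<sigma> (\<lambda>i. \<tau> i + \<upsilon> i))" "j < dim_col (rot n \<sigma> (\<lambda>i. \<tau> i + \<upsilon> i))"
  then have ij: "i < n" "j < n" by (auto simp: rot_def)
  have s: "\<sigma> i < n" "\<sigma> (\<sigma> i) = i" "\<upsilon> (\<sigma> i) = - \<upsilon> i"
    using assms ij by (auto simp: involutive_below_def odd_angle_def)
  show "(rot n \<sigma> \<tau> * rot n \<sigma> \<upsilon>) $$ (i,j) = rot n \<sigma> (\<lambda>i. \<tau> i + \<upsilon> i) $$ (i,j)"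
    unfolding rot_mult_entry[OF assms(1) rot_carrier ij] rot_entry[OF ij] rot_entry[OF s(1) ij(2)] s(2,3)
    by (auto simp: cos_add sin_add algebra_simps)
qed (auto simp: rot_def)

lemma rot_zero [simp]: "rot n \<sigma> (\<lambda>_. 0) = 1\<^sub>m n"
  by (rule eq_matI) (auto simp: rot_def)

lemma rot_adj:
  assumes "involutive_below n \<sigma>" "odd_angle n \<sigma> \<tau>"
  shows "mat_adj (rot n \<sigma> \<tau>) = rot n \<sigma> (\<lambda>i. - \<tau> i)"
proof (rule eq_matI)
  fix i j assume "i < dim_row (rot n \<sigma> (\<lambda>i. - \<tau> i))" "j < dim_col (rot n \<sigma> (\<lambda>i. - \<tau> i))"
  then have ij: "i < n" "j < n" by (auto simp: rot_def)
  have "i = \<sigma> j \<longleftrightarrow> j = \<sigma> i" "j = \<sigma> i \<Longrightarrow> \<tau> j = - \<tau> i"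
    using assms ij by (auto simp: involutive_below_def odd_angle_def)
  then show "mat_adj (rot n \<sigma> \<tau>) $$ (i,j) = rot n \<sigma> (\<lambda>i. - \<tau> i) $$ (i,j)"
    using ij by (auto simp: mat_adj_entry[of _ n] rot_entry)
qed (auto simp: rot_def mat_adj_def)

lemma odd_angle_uminus: "odd_angle n \<sigma> \<tau> \<Longrightarrow> odd_angle n \<sigma> (\<lambda>i. - \<tau> i)"
  by (simp add: odd_angle_def)

lemma odd_angle_add: "odd_angle n \<sigma> \<tau> \<Longrightarrow> odd_angle n \<sigma> \<upsilon> \<Longrightarrow> odd_angle n \<sigma> (\<lambda>i. \<tau> i + \<upsilon> i)"
  by (simp add: odd_angle_def)

lemma odd_angle_zero [simp]: "odd_angle n \<sigma> (\<lambda>_. 0)"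
  by (simp add: odd_angle_def)

lemma rot_unitary:
  assumes "involutive_below n \<sigma>" "odd_angle n \<sigma> \<tau>"
  shows "rot n \<sigma> \<tau> \<in> unitary_group n"
  using assms by (intro unitaryI) (auto simp: rot_adj rot_mult odd_angle_uminus)

lemma rot_orthogonal:
  assumes "involutive_below n \<sigma>" "odd_angle n \<sigma> \<tau>"
  shows "rot n \<sigma> \<tau> \<in> orthogonal_group n"
  unfolding orthogonal_group_def using rot_unitary[OF assms] by (auto simp: rot_entry)

lemma rot_sub_unitary:
  assumes "involutive_below n \<sigma>" "odd_angle n \<sigma> \<tau>" "\<And>i. i < n \<Longrightarrow> i \<notin> I \<Longrightarrow> \<tau> i = 0"
  shows "rot n \<sigma> \<tau> \<in> sub_unitary n I"
proof (rule supp_unitaryI[OF rot_unitary[OF assms(1,2)]])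
  fix i j assume ij: "i < n" "j < n" "i \<notin> I \<or> j \<notin> I"
  have "j = \<sigma> i \<Longrightarrow> \<tau> j = - \<tau> i" using assms ij by (auto simp: odd_angle_def)
  then show "rot n \<sigma> \<tau> $$ (i,j) = (if i = j then 1 else 0)"
    using ij assms(3)[of i] assms(3)[of j] by (auto simp: rot_entry)
qed auto

section \<open>Rotations in a single plane and tori of simultaneous rotations\<close>

definition plane_angle :: "(nat \<Rightarrow> nat) \<Rightarrow> nat \<Rightarrow> real \<Rightarrow> nat \<Rightarrow> real" where
  "plane_angle \<sigma> a \<theta> i = (if i = a then \<theta> else if i = \<sigma> a then - \<theta> else 0)"

lemma plane_angle_odd:
  assumes "involutive_below n \<sigma>" "a < n" "\<sigma> a \<noteq> a"
  shows "odd_angle n \<sigma> (plane_angle \<sigma> a \<theta>)"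
proof -
  have "\<sigma> i = a \<longleftrightarrow> i = \<sigma> a" "\<sigma> i = \<sigma> a \<longleftrightarrow> i = a" if "i < n" for i
    using assms that unfolding involutive_below_def by metis+
  then show ?thesis using assms(3) by (auto simp: odd_angle_def plane_angle_def)
qed

lemma rot_plane_sub_unitary:
  assumes "involutive_below n \<sigma>" "a < n" "\<sigma> a \<noteq> a" "a \<in> I" "\<sigma> a \<in> I"
  shows "rot n \<sigma> (plane_angle \<sigma> a \<theta>) \<in> sub_unitary n I"
  using assms by (intro rot_sub_unitary plane_angle_odd) (auto simp: plane_angle_def)

lemma rot_plane_adj:
  assumes "involutive_below n \<sigma>" "a < n" "\<sigma> a \<noteq> a"
  shows "mat_adj (rot n \<sigma> (plane_angle \<sigma> a \<theta>)) = rot n \<sigma> (plane_angle \<sigma> a (- \<theta>))"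
proof -
  have "(\<lambda>i. - plane_angle \<sigma> a \<theta> i) = plane_angle \<sigma> a (- \<theta>)" by (auto simp: plane_angle_def)
  then show ?thesis using rot_adj[OF assms(1) plane_angle_odd[OF assms]] by simp
qed

lemma rot_plane_transpose:
  assumes "involutive_below n \<sigma>" "a < n" "\<sigma> a \<noteq> a"
  shows "transpose_mat (rot n \<sigma> (plane_angle \<sigma> a \<theta>)) = rot n \<sigma> (plane_angle \<sigma> a (- \<theta>))"
proof -
  have "transpose_mat (rot n \<sigma> \<tau>) = mat_adj (rot n \<sigma> \<tau>)" for \<tau>
    by (rule eq_matI) (auto simp: mat_adj_def rot_def)
  then show ?thesis using rot_plane_adj[OF assms] by simp
qed

definition torus :: "nat \<Rightarrow> (nat \<Rightarrow> nat) \<Rightarrow> nat set \<Rightarrow> complex mat set" where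
  "torus n \<sigma> A = {rot n \<sigma> \<tau> | \<tau>. odd_angle n \<sigma> \<tau> \<and> (\<forall>i<n. \<tau> i \<noteq> 0 \<longrightarrow> i \<in> A \<or> \<sigma> i \<in> A)}"

lemma rot_cong:
  assumes "\<And>i. i < n \<Longrightarrow> \<tau> i = \<upsilon> i"
  shows "rot n \<sigma> \<tau> = rot n \<sigma> \<upsilon>"
  using assms by (intro eq_matI) (auto simp: rot_def)

text \<open>When \<open>A\<close> contains at most one endpoint of each plane and no fixed point of
  \<open>\<sigma>\<close>, the angles at the points of \<open>A\<close> are free and determine all
  others, so the rank is \<open>card A\<close>.\<close>

lemma torus_toral:
  assumes inv: "involutive_below n \<sigma>" and A: "A \<subseteq> {..<n}" and disj: "\<And>i. i \<in> A \<Longrightarrow> \<sigma> i \<notin> A"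
  shows "toral_subgroup_O n (card A) (torus n \<sigma> A)"
proof -
  define a where "a = card A"
  have "finite A" using A finite_subset by blast
  then obtain \<alpha> where bij: "bij_betw \<alpha> {..<a} A"
    using ex_bij_betw_nat_finite[of A] unfolding a_def atLeast0LessThan by blast
  define ind where "ind \<theta> x = (\<Sum>i<a. if \<alpha> i = x then \<theta> i else 0)" for \<theta> :: "nat \<Rightarrow> real" and x
  \<comment> \<open>Subtracting the value at the partner makes the angle odd automatically. The
    factor \<open>2 * pi\<close> turns integer parameters into full turns, as the kernel condition
    demands.\<close>
  define ang where "ang \<theta> x = 2 * pi * (ind \<theta> x - ind \<theta> (\<sigma> x))" for \<theta> x
  have \<alpha>A: "\<alpha> i \<in> A" if "i < a" for i using bij that by (auto simp: bij_betw_def)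
  have ind_\<alpha>: "ind \<theta> (\<alpha> i) = \<theta> i" if "i < a" for \<theta> i
  proof -
    have "ind \<theta> (\<alpha> i) = (\<Sum>k<a. if k = i then \<theta> k else 0)"
      unfolding ind_def using bij that by (intro sum.cong) (auto simp: bij_betw_def inj_on_def)
    then show ?thesis using that by simp
  qed
  have ind_out: "ind \<theta> x = 0" if "x \<notin> A" for \<theta> x
    unfolding ind_def using \<alpha>A that by (intro sum.neutral) auto
  have ang_\<alpha>: "ang \<theta> (\<alpha> i) = 2 * pi * \<theta> i" if "i < a" for \<theta> i
    using ind_\<alpha>[OF that] ind_out[OF disj[OF \<alpha>A[OF that]]] by (simp add: ang_def)
  have odd: "odd_angle n \<sigma> (ang \<theta>)" for \<theta>
    using inv by (auto simp: odd_angle_def ang_def involutive_below_def algebra_simps)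
  have add: "ang (\<lambda>i. \<theta> i + \<eta> i) = (\<lambda>x. ang \<theta> x + ang \<eta> x)" for \<theta> \<eta>
  proof
    fix x
    have "ind (\<lambda>i. \<theta> i + \<eta> i) y = ind \<theta> y + ind \<eta> y" for y
      unfolding ind_def by (simp add: sum.distrib[symmetric] if_distrib cong: if_cong)
    then show "ang (\<lambda>i. \<theta> i + \<eta> i) x = ang \<theta> x + ang \<eta> x" by (simp add: ang_def algebra_simps)
  qed
  have ker: "rot n \<sigma> (ang \<theta>) = 1\<^sub>m n \<longleftrightarrow> (\<forall>i<a. \<theta> i \<in> \<int>)" for \<theta>
  proof
    assume r: "rot n \<sigma> (ang \<theta>) = 1\<^sub>m n"
    show "\<forall>i<a. \<theta> i \<in> \<int>"
    proof (intro allI impI)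
      fix i assume i: "i < a"
      have an: "\<alpha> i < n" using \<alpha>A[OF i] A by auto
      \<comment> \<open>Since \<open>\<sigma>\<close> moves this index, the sine term stays off the
        diagonal and the diagonal entry is the cosine alone.\<close>
      have "\<sigma> (\<alpha> i) \<noteq> \<alpha> i" using disj[OF \<alpha>A[OF i]] \<alpha>A[OF i] by metis
      then have "complex_of_real (cos (ang \<theta> (\<alpha> i))) = 1"
        using arg_cong[OF r, of "\<lambda>M. M $$ (\<alpha> i, \<alpha> i)"] an by (simp add: rot_entry)
      then have "cos (2 * pi * \<theta> i) = 1" using ang_\<alpha>[OF i] by simp
      then obtain k :: int where "2 * pi * \<theta> i = of_int k * 2 * pi" using cos_one_2pi_int by blast
      then have "\<theta> i = of_int k" by simp
      then show "\<theta> i \<in> \<int>" by simp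
    qed
  next
    assume t: "\<forall>i<a. \<theta> i \<in> \<int>"
    have "ind \<theta> x \<in> \<int>" for x unfolding ind_def using t by (intro Ints_sum) auto
    then have "\<exists>k::int. ang \<theta> x = 2 * pi * of_int k" for x
      unfolding ang_def by (metis Ints_cases Ints_diff)
    then have "cos (ang \<theta> x) = 1" "sin (ang \<theta> x) = 0" for x
      using cos_int_2pin sin_int_2pin by metis+
    then show "rot n \<sigma> (ang \<theta>) = 1\<^sub>m n" by (intro eq_matI) (auto simp: rot_def)
  qed
  have cont: "continuous_on S (\<lambda>\<theta>. rot n \<sigma> (ang \<theta>) $$ (i,j))" if "i < n" "j < n" for i j S
  proof -
    have "continuous_on S (\<lambda>\<theta>::nat \<Rightarrow> real. if \<alpha> k = x then \<theta> k else 0)" for k x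
      by (cases "\<alpha> k = x") (auto intro: continuous_on_subset[OF continuous_on_product_coordinates])
    then have "continuous_on S (\<lambda>\<theta>. ind \<theta> x)" for x
      unfolding ind_def by (intro continuous_on_sum)
    then have "continuous_on S (\<lambda>\<theta>. ang \<theta> x)" for x
      unfolding ang_def by (intro continuous_on_mult continuous_on_const continuous_on_diff)
    note c = this
    have "continuous_on S (\<lambda>\<theta>. if i = j then complex_of_real (cos (ang \<theta> i)) else 0)"
      by (cases "i = j") (auto intro!: continuous_intros c)
    moreover have "continuous_on S (\<lambda>\<theta>. if j = \<sigma> i then complex_of_real (sin (ang \<theta> i)) else 0)"
      by (cases "j = \<sigma> i") (auto intro!: continuous_intros c)
    ultimately show ?thesis
      unfolding rot_entry[OF that] by (rule continuous_on_diff)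
  qed
  have img: "torus n \<sigma> A = (\<lambda>\<theta>. rot n \<sigma> (ang \<theta>)) ` param_space a"
  proof
    show "torus n \<sigma> A \<subseteq> (\<lambda>\<theta>. rot n \<sigma> (ang \<theta>)) ` param_space a"
    proof
      fix M assume "M \<in> torus n \<sigma> A"
      then obtain \<tau> where M: "M = rot n \<sigma> \<tau>" and o: "odd_angle n \<sigma> \<tau>"
        and z: "\<And>i. i < n \<Longrightarrow> \<tau> i \<noteq> 0 \<Longrightarrow> i \<in> A \<or> \<sigma> i \<in> A" unfolding torus_def by blast
      define \<theta> where "\<theta> i = (if i < a then \<tau> (\<alpha> i) / (2 * pi) else 0)" for i
      have angA: "ang \<theta> x = \<tau> x" if "x \<in> A" for x
      proof -
        have "x \<in> \<alpha> ` {..<a}" using that bij by (simp add: bij_betw_def)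
        then obtain i where "i < a" "x = \<alpha> i" by blast
        then show ?thesis using ang_\<alpha>[of i \<theta>] by (simp add: \<theta>_def)
      qed
      have "ang \<theta> x = \<tau> x" if x: "x < n" for x
      proof -
        have s: "\<sigma> x < n" "\<tau> (\<sigma> x) = - \<tau> x" "ang \<theta> (\<sigma> x) = - ang \<theta> x"
          using inv o odd x by (auto simp: involutive_below_def odd_angle_def)
        consider "x \<in> A" | "\<sigma> x \<in> A" | "x \<notin> A" "\<sigma> x \<notin> A" by blast
        then show ?thesis
        proof cases
          case 1 then show ?thesis by (rule angA)
        next
          case 2 then show ?thesis using angA[OF 2] s by simp
        next
          case 3
          then have "\<tau> x = 0" using z[OF x] by blast
          then show ?thesis using 3 ind_out by (simp add: ang_def)
        qed
      qed
      then have "M = rot n \<sigma> (ang \<theta>)" unfolding M by (intro rot_cong) auto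
      moreover have "\<theta> \<in> param_space a" by (auto simp: param_space_def \<theta>_def)
      ultimately show "M \<in> (\<lambda>\<theta>. rot n \<sigma> (ang \<theta>)) ` param_space a" by blast
    qed
    show "(\<lambda>\<theta>. rot n \<sigma> (ang \<theta>)) ` param_space a \<subseteq> torus n \<sigma> A"
    proof
      fix M assume "M \<in> (\<lambda>\<theta>. rot n \<sigma> (ang \<theta>)) ` param_space a"
      then obtain \<theta> where "M = rot n \<sigma> (ang \<theta>)" by blast
      moreover have "ang \<theta> i = 0" if "i \<notin> A" "\<sigma> i \<notin> A" for i
        using ind_out[OF that(1)] ind_out[OF that(2)] by (simp add: ang_def)
      ultimately show "M \<in> torus n \<sigma> A" unfolding torus_def using odd by blast
    qed
  qed
  show ?thesis unfolding toral_subgroup_O_def a_def[symmetric]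
    by (rule exI[of _ "\<lambda>\<theta>. rot n \<sigma> (ang \<theta>)"])
       (use rot_orthogonal[OF inv odd] rot_mult[OF inv odd] ker cont img in \<open>auto simp: add\<close>)
qed

lemma torus_mult:
  assumes "involutive_below n \<sigma>" "x \<in> torus n \<sigma> A" "y \<in> torus n \<sigma> B" "A \<subseteq> C" "B \<subseteq> C"
  shows "x * y \<in> torus n \<sigma> C"
proof -
  obtain \<tau> where \<tau>: "x = rot n \<sigma> \<tau>" "odd_angle n \<sigma> \<tau>" "\<forall>i<n. \<tau> i \<noteq> 0 \<longrightarrow> i \<in> A \<or> \<sigma> i \<in> A"
    using assms(2) unfolding torus_def by blast
  obtain \<upsilon> where \<upsilon>: "y = rot n \<sigma> \<upsilon>" "odd_angle n \<sigma> \<upsilon>" "\<forall>i<n. \<upsilon> i \<noteq> 0 \<longrightarrow> i \<in> B \<or> \<sigma> i \<in> B"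
    using assms(3) unfolding torus_def by blast
  have "x * y = rot n \<sigma> (\<lambda>i. \<tau> i + \<upsilon> i)" using rot_mult[OF assms(1) \<upsilon>(2)] \<tau> \<upsilon> by simp
  moreover have "i \<in> C \<or> \<sigma> i \<in> C" if "i < n" "\<tau> i + \<upsilon> i \<noteq> 0" for i
  proof -
    have "\<tau> i \<noteq> 0 \<or> \<upsilon> i \<noteq> 0" using that(2) by auto
    then show ?thesis using \<tau>(3) \<upsilon>(3) assms(4,5) that(1) by blast
  qed
  ultimately show ?thesis unfolding torus_def using odd_angle_add[OF \<tau>(2) \<upsilon>(2)] by blast
qed

lemma one_in_torus [simp]: "1\<^sub>m n \<in> torus n \<sigma> A"
proof -
  have "rot n \<sigma> (\<lambda>_. 0) \<in> torus n \<sigma> A" unfolding torus_def using odd_angle_zero by fastforce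
  then show ?thesis by simp
qed

lemma plane_in_torus:
  assumes "involutive_below n \<sigma>" "a < n" "\<sigma> a \<noteq> a" "a \<in> A \<or> \<sigma> a \<in> A"
  shows "rot n \<sigma> (plane_angle \<sigma> a \<theta>) \<in> torus n \<sigma> A"
proof -
  have "\<sigma> (\<sigma> a) = a" using assms by (simp add: involutive_below_def)
  then have "\<forall>i<n. plane_angle \<sigma> a \<theta> i \<noteq> 0 \<longrightarrow> i \<in> A \<or> \<sigma> i \<in> A"
    using assms(4) by (auto simp: plane_angle_def)
  then show ?thesis unfolding torus_def using plane_angle_odd[OF assms(1-3)] by blast
qed

lemma torus_sub_unitary:
  assumes "involutive_below n \<sigma>" "t \<in> torus n \<sigma> A" "\<And>i. i \<in> A \<Longrightarrow> i \<in> I" "\<And>i. i \<in> A \<Longrightarrow> \<sigma> i \<in> I"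
  shows "t \<in> sub_unitary n I"
proof -
  obtain \<tau> where \<tau>: "t = rot n \<sigma> \<tau>" "odd_angle n \<sigma> \<tau>" "\<forall>i<n. \<tau> i \<noteq> 0 \<longrightarrow> i \<in> A \<or> \<sigma> i \<in> A"
    using assms(2) unfolding torus_def by blast
  have "\<tau> i = 0" if i: "i < n" "i \<notin> I" for i
  proof (rule ccontr)
    assume "\<tau> i \<noteq> 0"
    then have "i \<in> A \<or> \<sigma> i \<in> A" using \<tau>(3) i by blast
    then show False using assms(3)[of i] assms(4)[of "\<sigma> i"] assms(1) i by (auto simp: involutive_below_def)
  qed
  then show ?thesis unfolding \<tau>(1) by (intro rot_sub_unitary assms(1) \<tau>(2))
qed

section \<open>Splitting off a plane rotation\<close>

text \<open>Row \<open>a\<close> is concentrated on \<open>C\<close> and \<open>C'\<close>. A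
  Householder matrix on each part collects the norm of that part at \<open>a\<close> and at
  \<open>\<sigma> a\<close>; the two values have squares adding up to 1, hence are a cosine and a
  sine, and one rotation turns the row into a basis vector. Index \<open>a\<close> then leaves the
  support.\<close>

lemma row_to_rot:
  assumes inv: "involutive_below n \<sigma>" and a: "a < n" "\<sigma> a \<noteq> a"
    and g: "g \<in> sub_unitary n I" and I: "I \<subseteq> {..<n}"
    and C: "C \<subseteq> I" "C' \<subseteq> I" "C \<inter> C' = {}" "a \<in> C" "\<sigma> a \<in> C'"
    and z: "\<And>j. j \<in> I \<Longrightarrow> j \<notin> C \<Longrightarrow> j \<notin> C' \<Longrightarrow> g $$ (a,j) = 0"
  obtains h1 h2 \<theta> where "h1 \<in> sub_unitary n C" "h2 \<in> sub_unitary n C'"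
    "g * h1 * h2 * rot n \<sigma> (plane_angle \<sigma> a \<theta>) \<in> sub_unitary n (I - {a})"
proof -
  let ?b = "\<sigma> a"
  have b: "?b < n" "\<sigma> ?b = a" using inv a by (auto simp: involutive_below_def)
  have Cn: "C \<subseteq> {..<n}" "C' \<subseteq> {..<n}" using C I by auto
  note gc = supp_unitary_carrier[OF g]
  obtain h1 where h1: "h1 \<in> sub_unitary n C"
    and e1: "\<And>j. j \<in> C \<Longrightarrow> (g * h1) $$ (a,j) =
       (if j = a then of_real (sqrt (\<Sum>k\<in>C. (cmod (g $$ (a,k)))\<^sup>2)) else 0)"
    using householder_row[OF Cn(1) C(4) gc a(1)] by blast
  have g1: "g * h1 \<in> carrier_mat n n" using gc h1 by simp
  obtain h2 where h2: "h2 \<in> sub_unitary n C'"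
    and e2: "\<And>j. j \<in> C' \<Longrightarrow> (g * h1 * h2) $$ (a,j) =
       (if j = ?b then of_real (sqrt (\<Sum>k\<in>C'. (cmod ((g * h1) $$ (a,k)))\<^sup>2)) else 0)"
    using householder_row[OF Cn(2) C(5) g1 a(1)] by blast
  define f where "f = g * h1 * h2"
  define r1 where "r1 = sqrt (\<Sum>k\<in>C. (cmod (g $$ (a,k)))\<^sup>2)"
  define r2 where "r2 = sqrt (\<Sum>k\<in>C'. (cmod ((g * h1) $$ (a,k)))\<^sup>2)"
  have hI: "h1 \<in> sub_unitary n I" "h2 \<in> sub_unitary n I"
    using h1 h2 C by (auto elim: supp_unitary_mono)
  have fI: "f \<in> sub_unitary n I" unfolding f_def using g hI by (intro supp_unitary_mult)
  note fc = supp_unitary_carrier[OF fI]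
  have fj: "f $$ (a,j) = (g * h1) $$ (a,j)" if "j < n" "j \<notin> C'" for j
    using mult_sub_unitary_entry[OF h2 g1 Cn(2) a(1) that(1)] that by (simp add: f_def)
  have fz: "f $$ (a,j) = 0" if j: "j < n" "j \<noteq> a" "j \<noteq> ?b" for j
  proof -
    consider "j \<in> C'" | "j \<in> C" "j \<notin> C'" | "j \<in> I" "j \<notin> C" "j \<notin> C'" | "j \<notin> I" by blast
    then show ?thesis
    proof cases
      case 1 then show ?thesis using e2[of j] j by (simp add: f_def)
    next
      case 2 then show ?thesis using fj[of j] e1[of j] j by simp
    next
      case 3
      then show ?thesis
        using fj[of j] mult_sub_unitary_entry[OF h1 gc Cn(1) a(1) j(1)] z[of j] j by simp
    next
      case 4
      then show ?thesis using supp_unitary_outside[OF fI a(1) j(1)] j by auto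
    qed
  qed
  have fa: "f $$ (a,a) = of_real r1" using fj[of a] e1[of a] C a by (auto simp: r1_def)
  have fb: "f $$ (a,?b) = of_real r2" using e2[of ?b] C by (simp add: f_def r2_def)
  have sum2: "(\<Sum>k<n. G k) = G a + G ?b" if "\<And>k. k < n \<Longrightarrow> k \<noteq> a \<Longrightarrow> k \<noteq> ?b \<Longrightarrow> G k = 0"
    for G :: "nat \<Rightarrow> 'x :: comm_monoid_add"
  proof -
    have "(\<Sum>k<n. G k) = (\<Sum>k\<in>{a,?b}. G k)"
      using a b that by (intro sum.mono_neutral_right) auto
    then show ?thesis using a by simp
  qed
  have "(\<Sum>k<n. (cmod (f $$ (a,k)))\<^sup>2) = r1\<^sup>2 + r2\<^sup>2"
    using sum2[of "\<lambda>k. (cmod (f $$ (a,k)))\<^sup>2"] fz fa fb by simp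
  then have "r1\<^sup>2 + r2\<^sup>2 = 1"
    using unitary_row_norm[OF supp_unitary_unitary[OF fI] a(1)] by simp
  then obtain \<theta> where t: "r1 = cos \<theta>" "r2 = sin \<theta>" using sincos_total_2pi by blast
  let ?R = "rot n \<sigma> (plane_angle \<sigma> a \<theta>)"
  have R: "?R \<in> sub_unitary n I" using inv a C by (intro rot_plane_sub_unitary) auto
  \<comment> \<open>In the plane, row \<open>a\<close> of \<open>f\<close> and column
    \<open>a\<close> of the rotation are both \<open>(cos \<theta>, sin \<theta>)\<close>; the entry
    at \<open>\<sigma> a\<close> has positive sign because the angle is negated there.\<close>
  have "(f * ?R) $$ (a,a) = (\<Sum>k<n. f $$ (a,k) * ?R $$ (k,a))"
    using fc a by (intro mat_mult_entry) auto
  also have "\<dots> = f $$ (a,a) * ?R $$ (a,a) + f $$ (a,?b) * ?R $$ (?b,a)"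
    using fz by (intro sum2) auto
  also have "\<dots> = of_real (cos \<theta>) * of_real (cos \<theta>) + of_real (sin \<theta>) * of_real (sin \<theta>)"
    using a b fa fb t by (simp add: rot_entry plane_angle_def)
  also have "\<dots> = 1" by (metis of_real_1 of_real_add of_real_mult sin_cos_squared_add3)
  finally have "f * ?R \<in> sub_unitary n (I - {a})"
    using fI R a by (intro sub_unitary_remove supp_unitary_mult) auto
  then show thesis using that h1 h2 unfolding f_def by blast
qed

lemma col_to_rot:
  assumes inv: "involutive_below n \<sigma>" and a: "a < n" "\<sigma> a \<noteq> a"
    and g: "g \<in> sub_unitary n I" and I: "I \<subseteq> {..<n}"
    and C: "C \<subseteq> I" "C' \<subseteq> I" "C \<inter> C' = {}" "a \<in> C" "\<sigma> a \<in> C'"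
    and z: "\<And>j. j \<in> I \<Longrightarrow> j \<notin> C \<Longrightarrow> j \<notin> C' \<Longrightarrow> g $$ (j,a) = 0"
  obtains l1 l2 \<theta> where "l1 \<in> sub_unitary n C" "l2 \<in> sub_unitary n C'"
    "rot n \<sigma> (plane_angle \<sigma> a \<theta>) * (l2 * (l1 * g)) \<in> sub_unitary n (I - {a})"
proof -
  note gc = supp_unitary_carrier[OF g]
  have z': "transpose_mat g $$ (a,j) = 0" if "j \<in> I" "j \<notin> C" "j \<notin> C'" for j
    using z[OF that] gc a I that by auto
  obtain h1 h2 \<theta> where h: "h1 \<in> sub_unitary n C" "h2 \<in> sub_unitary n C'"
    and k: "transpose_mat g * h1 * h2 * rot n \<sigma> (plane_angle \<sigma> a \<theta>) \<in> sub_unitary n (I - {a})"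
    using row_to_rot[OF inv a supp_unitary_transpose[OF g] I C z'] by blast
  note hc = h[THEN supp_unitary_carrier]
  have tg: "transpose_mat g \<in> carrier_mat n n" using gc by simp
  have "transpose_mat (transpose_mat g * h1 * h2 * rot n \<sigma> (plane_angle \<sigma> a \<theta>)) =
     rot n \<sigma> (plane_angle \<sigma> a (- \<theta>)) * (transpose_mat h2 * (transpose_mat h1 * g))"
    using tg hc by (simp add: transpose_mult[of _ n n _ n] rot_plane_transpose[OF inv a])
  then show thesis
    using that[OF supp_unitary_transpose[OF h(1)] supp_unitary_transpose[OF h(2)]]
      supp_unitary_transpose[OF k] by metis
qed

section \<open>Compactness and entries of maximal modulus\<close>

lemma unit_vector_compact:
  assumes "finite S"
  shows "compact {v :: nat \<Rightarrow> complex. (\<forall>i. i \<notin> S \<longrightarrow> v i = 0) \<and> (\<Sum>i\<in>S. (cmod (v i))\<^sup>2) = 1}"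
    (is "compact ?K")
proof -
  \<comment> \<open>Discs on \<open>S\<close> and a single point elsewhere give a compact product,
    and the sphere is closed in it. Pinning the coordinates off \<open>S\<close> lets functions on
    all naturals stand for finite vectors.\<close>
  define B where "B i = (if i \<in> S then cball (0::complex) 1 else {0})" for i
  have "compactin (product_topology (\<lambda>i. euclidean) UNIV) (PiE UNIV B)"
    unfolding compactin_PiE by (auto simp: B_def)
  then have cB: "compact (PiE UNIV B)"
    by (simp add: euclidean_product_topology)
  have cl: "closed {v :: nat \<Rightarrow> complex. (\<Sum>i\<in>S. (cmod (v i))\<^sup>2) = 1}"
    by (intro closed_Collect_eq continuous_on_sum continuous_on_power continuous_on_norm
        continuous_on_product_coordinates continuous_on_const)
  moreover have "?K = PiE UNIV B \<inter> {v. (\<Sum>i\<in>S. (cmod (v i))\<^sup>2) = 1}"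
  proof -
    have "cmod (v i) \<le> 1" if "(\<Sum>i\<in>S. (cmod (v i))\<^sup>2) = 1" "i \<in> S" for v :: "nat \<Rightarrow> complex" and i
    proof -
      have "(cmod (v i))\<^sup>2 \<le> (\<Sum>i\<in>S. (cmod (v i))\<^sup>2)"
        using assms that(2) by (intro member_le_sum) auto
      then show ?thesis using that(1) by (simp add: power_le_one_iff)
    qed
    then show ?thesis by (auto simp: B_def PiE_def Pi_def split: if_splits)
  qed
  ultimately show ?thesis using compact_Int_closed[OF cB cl] by simp
qed

text \<open>A unitary carrying \<open>v\<close> to the basis vector at \<open>a\<close> has an
  adjoint with \<open>v\<close> as its column \<open>a\<close>.\<close>

lemma unit_column:
  fixes v :: "nat \<Rightarrow> complex"
  assumes S: "S \<subseteq> {..<n}" "a \<in> S" and v: "(\<Sum>i\<in>S. (cmod (v i))\<^sup>2) = 1"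
  obtains A where "A \<in> sub_unitary n S" "\<And>i. i \<in> S \<Longrightarrow> A $$ (i,a) = v i"
proof -
  \<comment> \<open>Every column is \<open>v\<close> extended by zero, since the Householder step
    acts on a column of a matrix.\<close>
  define M where "M = mat n n (\<lambda>(i,j). if i \<in> S then v i else 0)"
  have a: "a < n" using S by auto
  have Mc: "M \<in> carrier_mat n n" by (simp add: M_def)
  have Me: "M $$ (i,a) = (if i \<in> S then v i else 0)" if "i < n" for i
    using that a by (simp add: M_def)
  obtain A where A: "A \<in> sub_unitary n S"
    and e: "\<And>i. i \<in> S \<Longrightarrow> (A * M) $$ (i,a) =
       (if i = a then of_real (sqrt (\<Sum>k\<in>S. (cmod (M $$ (k,a)))\<^sup>2)) else 0)"
    using householder_col[OF S Mc a] by blast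
  note Ac = supp_unitary_carrier[OF A] and Au = supp_unitary_unitary[OF A]
  have "(\<Sum>k\<in>S. (cmod (M $$ (k,a)))\<^sup>2) = (\<Sum>i\<in>S. (cmod (v i))\<^sup>2)"
    using S Me by (intro sum.cong) auto
  then have e': "(A * M) $$ (i,a) = (if i = a then 1 else 0)" if "i < n" for i
    using e[of i] sub_unitary_mult_entry[OF A Mc S(1) that a] Me[OF that] v S by auto
  have "mat_adj A $$ (i,a) = v i" if i: "i \<in> S" for i
  proof -
    have n: "i < n" using i S by auto
    have "v i = M $$ (i,a)" using Me[OF n] i by simp
    also have "M = mat_adj A * (A * M)"
      using Ac Mc Au by (simp flip: sq_mult_assoc[of _ n])
    also have "(mat_adj A * (A * M)) $$ (i,a) = (\<Sum>k<n. mat_adj A $$ (i,k) * (A * M) $$ (k,a))"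
      using Ac Mc n a by (intro mat_mult_entry) auto
    also have "\<dots> = mat_adj A $$ (i,a)" using e' a by (intro sum_delta_right) auto
    finally show ?thesis by simp
  qed
  then show thesis using that supp_unitary_adj[OF A] by blast
qed

lemma unit_row:
  fixes v :: "nat \<Rightarrow> complex"
  assumes S: "S \<subseteq> {..<n}" "a \<in> S" and v: "(\<Sum>i\<in>S. (cmod (v i))\<^sup>2) = 1"
  obtains A where "A \<in> sub_unitary n S" "\<And>i. i \<in> S \<Longrightarrow> A $$ (a,i) = v i"
proof -
  obtain A where A: "A \<in> sub_unitary n S" "\<And>i. i \<in> S \<Longrightarrow> A $$ (i,a) = v i"
    using unit_column[OF S v] by blast
  then have "transpose_mat A $$ (a,i) = v i" if "i \<in> S" for i
    using that S sq_transpose_entry[OF supp_unitary_carrier[OF A(1)], of a i] by auto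
  then show thesis using that supp_unitary_transpose[OF A(1)] by blast
qed

lemma sub_unitary_row_norm:
  assumes "A \<in> sub_unitary n S" "S \<subseteq> {..<n}" "a \<in> S"
  shows "(\<Sum>i\<in>S. (cmod (A $$ (a,i)))\<^sup>2) = 1"
proof -
  have "(\<Sum>i<n. (cmod (A $$ (a,i)))\<^sup>2) = (\<Sum>i\<in>S. (cmod (A $$ (a,i)))\<^sup>2)"
    using assms by (intro sum.mono_neutral_right) (auto simp: supp_unitary_outside[OF assms(1)])
  then show ?thesis using unitary_row_norm[OF supp_unitary_unitary[OF assms(1)], of a] assms by auto
qed

lemma sub_unitary_col_norm:
  assumes "A \<in> sub_unitary n S" "S \<subseteq> {..<n}" "a \<in> S"
  shows "(\<Sum>i\<in>S. (cmod (A $$ (i,a)))\<^sup>2) = 1"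
proof -
  have "(\<Sum>i\<in>S. (cmod (A $$ (i,a)))\<^sup>2) = (\<Sum>i\<in>S. (cmod (transpose_mat A $$ (a,i)))\<^sup>2)"
    using assms(2,3) sq_transpose_entry[OF supp_unitary_carrier[OF assms(1)], of a]
    by (intro sum.cong) (auto simp: subset_eq)
  then show ?thesis using sub_unitary_row_norm[OF supp_unitary_transpose[OF assms(1)] assms(2,3)] by simp
qed

text \<open>The entry depends only on row \<open>a\<close> of \<open>l\<close> and column
  \<open>b\<close> of \<open>h\<close>, and these run through all unit vectors on \<open>V\<close>
  and \<open>C\<close>. So its modulus is that of a bilinear form on a product of two compact
  spheres and attains its maximum; a maximising pair of vectors is then completed to unitary
  matrices.\<close>

lemma max_entry:
  assumes g: "g \<in> carrier_mat n n" and V: "V \<subseteq> {..<n}" "a \<in> V" and C: "C \<subseteq> {..<n}" "b \<in> C"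
  obtains l h where "l \<in> sub_unitary n V" "h \<in> sub_unitary n C"
    "\<And>l' h'. l' \<in> sub_unitary n V \<Longrightarrow> h' \<in> sub_unitary n C \<Longrightarrow>
       cmod ((l' * g * h') $$ (a,b)) \<le> cmod ((l * g * h) $$ (a,b))"
proof -
  define K where "K S = {v :: nat \<Rightarrow> complex. (\<forall>i. i \<notin> S \<longrightarrow> v i = 0) \<and> (\<Sum>i\<in>S. (cmod (v i))\<^sup>2) = 1}" for S
  define F where "F x = cmod (\<Sum>j\<in>C. (\<Sum>i\<in>V. fst x i * g $$ (i,j)) * snd x j)"
    for x :: "(nat \<Rightarrow> complex) \<times> (nat \<Rightarrow> complex)"
  have fin: "finite V" "finite C" using V C finite_subset by auto
  have ab: "a < n" "b < n" using V C by auto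
  have "compact (K V \<times> K C)"
    unfolding K_def by (intro compact_Times unit_vector_compact fin)
  moreover have "K V \<times> K C \<noteq> {}"
  proof -
    have "(\<lambda>i. if i = s then 1 else 0) \<in> K S" if "finite S" "s \<in> S" for S s
      using that by (auto simp: K_def if_distrib[of cmod] if_distrib[of "\<lambda>x. x\<^sup>2"] cong: if_cong)
    then show ?thesis using fin V C by blast
  qed
  moreover have "continuous_on (K V \<times> K C) F"
  proof -
    have coord: "continuous_on UNIV (\<lambda>x :: (nat \<Rightarrow> complex) \<times> (nat \<Rightarrow> complex). fst x i)"
      "continuous_on UNIV (\<lambda>x :: (nat \<Rightarrow> complex) \<times> (nat \<Rightarrow> complex). snd x i)" for i
      by (rule continuous_on_product_then_coordinatewise, rule continuous_on_fst continuous_on_snd,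
          rule continuous_on_id)+
    have "continuous_on UNIV F" unfolding F_def
      by (intro continuous_on_norm continuous_on_sum continuous_on_mult coord continuous_on_const)
    then show ?thesis by (rule continuous_on_subset) simp
  qed
  ultimately obtain x where x: "x \<in> K V \<times> K C" "\<And>y. y \<in> K V \<times> K C \<Longrightarrow> F y \<le> F x"
    using continuous_attains_sup by metis
  obtain v c where xvc: "x = (v,c)" by (cases x)
  have vc: "(\<Sum>i\<in>V. (cmod (v i))\<^sup>2) = 1" "(\<Sum>i\<in>C. (cmod (c i))\<^sup>2) = 1"
    using x(1) by (auto simp: K_def xvc)
  obtain l where l: "l \<in> sub_unitary n V" "\<And>i. i \<in> V \<Longrightarrow> l $$ (a,i) = v i"
    using unit_row[OF V vc(1)] by blast
  obtain h where h: "h \<in> sub_unitary n C" "\<And>i. i \<in> C \<Longrightarrow> h $$ (i,b) = c i"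
    using unit_column[OF C vc(2)] by blast
  have entry: "(l' * g * h') $$ (a,b) = (\<Sum>j\<in>C. (\<Sum>i\<in>V. l' $$ (a,i) * g $$ (i,j)) * h' $$ (j,b))"
    if "l' \<in> sub_unitary n V" "h' \<in> sub_unitary n C" for l' h'
  proof -
    have "(l' * g * h') $$ (a,b) = (\<Sum>j\<in>C. (l' * g) $$ (a,j) * h' $$ (j,b))"
      using mult_sub_unitary_entry[OF that(2) _ C(1) ab] C(2) that g by simp
    also have "\<dots> = (\<Sum>j\<in>C. (\<Sum>i\<in>V. l' $$ (a,i) * g $$ (i,j)) * h' $$ (j,b))"
    proof (intro sum.cong refl)
      fix j assume "j \<in> C"
      then have "(l' * g) $$ (a,j) = (\<Sum>i\<in>V. l' $$ (a,i) * g $$ (i,j))"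
        using sub_unitary_mult_entry[OF that(1) g V(1) ab(1), of j] V(2) C(1) by auto
      then show "(l' * g) $$ (a,j) * h' $$ (j,b) = (\<Sum>i\<in>V. l' $$ (a,i) * g $$ (i,j)) * h' $$ (j,b)"
        by simp
    qed
    finally show ?thesis .
  qed
  have "cmod ((l * g * h) $$ (a,b)) = F x"
    unfolding entry[OF l(1) h(1)] F_def xvc using l(2) h(2) by simp
  moreover have "cmod ((l' * g * h') $$ (a,b)) \<le> F x"
    if "l' \<in> sub_unitary n V" "h' \<in> sub_unitary n C" for l' h'
  proof -
    \<comment> \<open>A competing pair of matrices becomes a point of the compact set by cutting its
      row and column off to \<open>V\<close> and \<open>C\<close>.\<close>
    define y where "y = ((\<lambda>i. if i \<in> V then l' $$ (a,i) else 0), (\<lambda>j. if j \<in> C then h' $$ (j,b) else 0))"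
    have "y \<in> K V \<times> K C"
      using sub_unitary_row_norm[OF that(1) V] sub_unitary_col_norm[OF that(2) C]
      by (auto simp: y_def K_def)
    moreover have "F y = cmod ((l' * g * h') $$ (a,b))"
      unfolding entry[OF that] F_def y_def by simp
    ultimately show ?thesis using x(2) by metis
  qed
  ultimately show thesis using that[OF l(1) h(1)] by metis
qed

lemma sum_le_single_imp_zero:
  fixes f :: "nat \<Rightarrow> complex"
  assumes "finite S" "a \<in> S" "sqrt (\<Sum>k\<in>S. (cmod (f k))\<^sup>2) \<le> cmod (f a)" "j \<in> S" "j \<noteq> a"
  shows "f j = 0"
proof -
  have "(sqrt (\<Sum>k\<in>S. (cmod (f k))\<^sup>2))\<^sup>2 \<le> (cmod (f a))\<^sup>2"
    using assms(3) by (intro power_mono) (auto simp: sum_nonneg)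
  then have "(\<Sum>k\<in>S. (cmod (f k))\<^sup>2) \<le> (cmod (f a))\<^sup>2" by (simp add: sum_nonneg)
  then have "(\<Sum>k\<in>S-{a}. (cmod (f k))\<^sup>2) \<le> 0" using assms(1,2) by (simp add: sum.remove)
  moreover have "(cmod (f j))\<^sup>2 \<le> (\<Sum>k\<in>S-{a}. (cmod (f k))\<^sup>2)"
    using assms by (intro member_le_sum) auto
  ultimately have "(cmod (f j))\<^sup>2 \<le> 0" by linarith
  then show ?thesis by simp
qed

text \<open>A corner of maximal modulus among all translates: its row and column vanish inside the block,
  because otherwise a Householder matrix would enlarge it.\<close>

lemma block_corner:
  assumes g: "g \<in> carrier_mat n n" and V: "V \<subseteq> {..<n}" "a \<in> V" and C: "C \<subseteq> {..<n}" "b \<in> C"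
  obtains l h where "l \<in> sub_unitary n V" "h \<in> sub_unitary n C"
    "\<And>j. j \<in> C \<Longrightarrow> j \<noteq> b \<Longrightarrow> (l * g * h) $$ (a,j) = 0"
    "\<And>i. i \<in> V \<Longrightarrow> i \<noteq> a \<Longrightarrow> (l * g * h) $$ (i,b) = 0"
proof -
  obtain l h where l: "l \<in> sub_unitary n V" and h: "h \<in> sub_unitary n C"
    and mx: "\<And>l' h'. l' \<in> sub_unitary n V \<Longrightarrow> h' \<in> sub_unitary n C \<Longrightarrow>
       cmod ((l' * g * h') $$ (a,b)) \<le> cmod ((l * g * h) $$ (a,b))"
    using max_entry[OF assms] by blast
  define f where "f = l * g * h"
  have ab: "a < n" "b < n" and fin: "finite V" "finite C" using V C finite_subset by auto
  note lc = supp_unitary_carrier[OF l] and hc = supp_unitary_carrier[OF h]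
  have fc: "f \<in> carrier_mat n n" unfolding f_def using lc hc g by simp
  show thesis
  proof (rule that[OF l h])
    fix j assume j: "j \<in> C" "j \<noteq> b"
    obtain h' where h': "h' \<in> sub_unitary n C"
      and e: "\<And>j. j \<in> C \<Longrightarrow> (f * h') $$ (a,j) =
         (if j = b then of_real (sqrt (\<Sum>k\<in>C. (cmod (f $$ (a,k)))\<^sup>2)) else 0)"
      using householder_row[OF C fc ab(1)] by blast
    have "f * h' = l * g * (h * h')"
      unfolding f_def using lc hc g supp_unitary_carrier[OF h'] by (simp add: sq_mult_assoc[of _ n])
    then have "cmod ((f * h') $$ (a,b)) \<le> cmod (f $$ (a,b))"
      using mx[OF l supp_unitary_mult[OF h h']] by (simp add: f_def)
    then have "sqrt (\<Sum>k\<in>C. (cmod (f $$ (a,k)))\<^sup>2) \<le> cmod (f $$ (a,b))"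
      using e[OF C(2)] by (simp add: sum_nonneg)
    then show "(l * g * h) $$ (a,j) = 0"
      using sum_le_single_imp_zero[OF fin(2) C(2), of "\<lambda>k. f $$ (a,k)"] j by (simp add: f_def)
  next
    fix i assume i: "i \<in> V" "i \<noteq> a"
    obtain l' where l': "l' \<in> sub_unitary n V"
      and e: "\<And>i. i \<in> V \<Longrightarrow> (l' * f) $$ (i,b) =
         (if i = a then of_real (sqrt (\<Sum>k\<in>V. (cmod (f $$ (k,b)))\<^sup>2)) else 0)"
      using householder_col[OF V fc ab(2)] by blast
    have "l' * f = l' * l * g * h"
      unfolding f_def using lc hc g supp_unitary_carrier[OF l'] by (simp add: sq_mult_assoc[of _ n])
    then have "cmod ((l' * f) $$ (a,b)) \<le> cmod (f $$ (a,b))"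
      using mx[OF supp_unitary_mult[OF l' l] h] by (simp add: f_def)
    then have "sqrt (\<Sum>k\<in>V. (cmod (f $$ (k,b)))\<^sup>2) \<le> cmod (f $$ (a,b))"
      using e[OF V(2)] by (simp add: sum_nonneg)
    then show "(l * g * h) $$ (i,b) = 0"
      using sum_le_single_imp_zero[OF fin(1) V(2), of "\<lambda>k. f $$ (k,b)"] i by (simp add: f_def)
  qed
qed

lemma unitary_solve:
  assumes "l \<in> unitary_group n" "h \<in> unitary_group n" "g \<in> carrier_mat n n" "f = l * g * h"
  shows "g = mat_adj l * f * mat_adj h"
proof -
  note c = unitary_carrier[OF assms(1)] unitary_carrier[OF assms(2)] assms(3)
  have "mat_adj l * f * mat_adj h = (mat_adj l * l) * g * (h * mat_adj h)"
    using c unfolding assms(4) by (simp add: sq_mult_assoc[of _ n] del: unitary_mult_adj unitary_adj_mult)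
  then show ?thesis using assms c by simp
qed

text \<open>Matrices on \<open>V'\<close> and \<open>C'\<close> gather the rest of column
  \<open>a\<close> and of row \<open>a\<close> at \<open>a'\<close> without touching the corner.
  Column \<open>a\<close> then lives on \<open>a\<close> and \<open>a'\<close>, and its entry at
  \<open>a'\<close> is nonzero because the corner does not have modulus one. Orthogonality of any
  other column to it therefore clears row \<open>a'\<close> as well.\<close>

lemma split_plane_corner:
  assumes g: "g \<in> sub_unitary n I" and I: "I \<subseteq> {..<n}"
    and V: "I = V \<union> V'" "V \<inter> V' = {}" "a \<in> V" "a' \<in> V'"
    and C: "I = C \<union> C'" "C \<inter> C' = {}" "a \<in> C" "a' \<in> C'"
    and row: "\<And>j. j \<in> C \<Longrightarrow> j \<noteq> a \<Longrightarrow> g $$ (a,j) = 0"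
    and col: "\<And>i. i \<in> V \<Longrightarrow> i \<noteq> a \<Longrightarrow> g $$ (i,a) = 0"
    and ne: "cmod (g $$ (a,a)) \<noteq> 1"
  obtains l h where "l \<in> sub_unitary n V'" "h \<in> sub_unitary n C'"
    "\<And>r j. r \<in> {a,a'} \<Longrightarrow> j < n \<Longrightarrow> j \<notin> {a,a'} \<Longrightarrow> (l * g * h) $$ (r,j) = 0"
proof -
  have n: "a < n" "a' < n" "V \<subseteq> {..<n}" "V' \<subseteq> {..<n}" "C \<subseteq> {..<n}" "C' \<subseteq> {..<n}"
    using I V C by auto
  have aa: "a \<noteq> a'" "a \<notin> V'" "a \<notin> C'" using V C by auto
  note gc = supp_unitary_carrier[OF g]
  obtain h where h: "h \<in> sub_unitary n C'"
    and eh: "\<And>j. j \<in> C' \<Longrightarrow> (g * h) $$ (a,j) =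
       (if j = a' then of_real (sqrt (\<Sum>k\<in>C'. (cmod (g $$ (a,k)))\<^sup>2)) else 0)"
    using householder_row[OF n(6) C(4) gc n(1)] by blast
  have ghc: "g * h \<in> carrier_mat n n" using gc supp_unitary_carrier[OF h] by simp
  obtain l where l: "l \<in> sub_unitary n V'"
    and el: "\<And>i. i \<in> V' \<Longrightarrow> (l * (g * h)) $$ (i,a) =
       (if i = a' then of_real (sqrt (\<Sum>k\<in>V'. (cmod ((g * h) $$ (k,a)))\<^sup>2)) else 0)"
    using householder_col[OF n(4) V(4) ghc n(1)] by blast
  define f where "f = l * (g * h)"
  have f: "f = l * g * h"
    using gc supp_unitary_carrier[OF h] supp_unitary_carrier[OF l] by (simp add: f_def sq_mult_assoc[of _ n])
  have hI: "h \<in> sub_unitary n I" "l \<in> sub_unitary n I"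
    using supp_unitary_sub[OF h, of I] supp_unitary_sub[OF l, of I] V(1) C(1) by blast+
  have fI: "f \<in> sub_unitary n I" unfolding f using g hI by (intro supp_unitary_mult)
  note fu = supp_unitary_unitary[OF fI]
  have frow: "f $$ (a,j) = (g * h) $$ (a,j)" if "j < n" for j
    using sub_unitary_mult_entry[OF l ghc n(4) n(1) that] aa by (simp add: f_def)
  have ghcol: "(g * h) $$ (i,a) = g $$ (i,a)" if "i < n" for i
    using mult_sub_unitary_entry[OF h gc n(6) that n(1)] aa by simp
  have fa0: "f $$ (a,j) = 0" if "j < n" "j \<noteq> a" "j \<noteq> a'" for j
  proof (cases "j \<in> C'")
    case True
    then show ?thesis using frow[OF that(1)] eh that by simp
  next
    case False
    then have "(g * h) $$ (a,j) = g $$ (a,j)"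
      using mult_sub_unitary_entry[OF h gc n(6) n(1) that(1)] by simp
    also have "\<dots> = 0"
      using row[of j] supp_unitary_outside[OF g n(1) that(1)] that False C by (cases "j \<in> I") auto
    finally show ?thesis using frow[OF that(1)] by simp
  qed
  have fc0: "f $$ (i,a) = 0" if "i < n" "i \<noteq> a" "i \<noteq> a'" for i
  proof (cases "i \<in> V'")
    case True
    then show ?thesis using el that by (simp add: f_def)
  next
    case False
    then have "f $$ (i,a) = g $$ (i,a)"
      using sub_unitary_mult_entry[OF l ghc n(4) that(1) n(1)] ghcol[OF that(1)] by (simp add: f_def)
    also have "\<dots> = 0"
      using col[of i] supp_unitary_outside[OF g that(1) n(1)] that False V by (cases "i \<in> I") auto
    finally show ?thesis .
  qed
  have faa: "f $$ (a,a) = g $$ (a,a)" using frow[OF n(1)] ghcol[OF n(1)] by simp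
  have nz: "f $$ (a',a) \<noteq> 0"
  proof
    assume "f $$ (a',a) = 0"
    then have "i < n \<Longrightarrow> i \<noteq> a \<Longrightarrow> f $$ (i,a) = 0" for i using fc0 by blast
    then have "(\<Sum>k<n. cnj (f $$ (k,a)) * f $$ (k,a)) = cnj (f $$ (a,a)) * f $$ (a,a)"
      using n(1) by (subst sum.remove[of _ a]) auto
    then have "cnj (f $$ (a,a)) * f $$ (a,a) = 1" using unitary_cols[OF fu n(1,1)] by simp
    then have "complex_of_real ((cmod (f $$ (a,a)))\<^sup>2) = 1" by (simp add: complex_norm_square mult.commute del: of_real_power)
    then have "(cmod (f $$ (a,a)))\<^sup>2 = 1" using of_real_eq_1_iff by blast
    then have "cmod (f $$ (a,a)) = 1" by (simp add: power2_eq_1_iff) (metis norm_ge_zero not_one_le_zero neg_0_le_iff_le)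
    then show False using ne faa by simp
  qed
  have fa'0: "f $$ (a',j) = 0" if j: "j < n" "j \<noteq> a" "j \<noteq> a'" for j
  proof -
    have "(\<Sum>k<n. cnj (f $$ (k,a)) * f $$ (k,j)) = (\<Sum>k\<in>{a,a'}. cnj (f $$ (k,a)) * f $$ (k,j))"
      using n fc0 by (intro sum.mono_neutral_right) auto
    also have "\<dots> = cnj (f $$ (a',a)) * f $$ (a',j)" using aa fa0[OF j] by simp
    finally show ?thesis using unitary_cols[OF fu n(1) j(1)] j nz by simp
  qed
  show thesis
  proof (rule that[OF l h])
    fix r j assume "r \<in> {a,a'}" "j < n" "j \<notin> {a,a'}"
    then show "(l * g * h) $$ (r,j) = 0" unfolding f[symmetric] using fa0 fa'0 by blast
  qed
qed

text \<open>If the corner entry of the block \<open>V \<times> C\<close> has modulus less than one, orthogonality to its row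
  and column splits off the plane. If not, the complementary block gives the second basis vector.\<close>

lemma split_plane:
  assumes g: "g \<in> sub_unitary n I" and I: "I \<subseteq> {..<n}" and a: "a \<in> I" "P a" "Q a"
    and a': "a' \<in> I" "\<not> P a'" "\<not> Q a'"
  obtains l h where "l \<in> supp_unitary n I P" "h \<in> supp_unitary n I Q"
    "\<And>r j. r \<in> {a,a'} \<Longrightarrow> j < n \<Longrightarrow> j \<notin> {a,a'} \<Longrightarrow> (l * g * h) $$ (r,j) = 0"
proof -
  define V where "V = {i \<in> I. P i}"
  define V' where "V' = {i \<in> I. \<not> P i}"
  define C where "C = {i \<in> I. Q i}"
  define C' where "C' = {i \<in> I. \<not> Q i}"
  have VC: "I = V \<union> V'" "V \<inter> V' = {}" "a \<in> V" "a' \<in> V'"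
    "I = C \<union> C'" "C \<inter> C' = {}" "a \<in> C" "a' \<in> C'"
    using a a' by (auto simp: V_def V'_def C_def C'_def)
  then have VC': "I = V' \<union> V" "V' \<inter> V = {}" "I = C' \<union> C" "C' \<inter> C = {}" by auto
  have n: "a < n" "a' < n" "V \<subseteq> {..<n}" "V' \<subseteq> {..<n}" "C \<subseteq> {..<n}" "C' \<subseteq> {..<n}"
    using I VC by auto
  have inP: "x \<in> supp_unitary n I P" if "x \<in> sub_unitary n V \<or> x \<in> sub_unitary n V'" for x
    using that by (auto simp: V_def V'_def elim!: sub_unitary_supp)
  have inQ: "x \<in> supp_unitary n I Q" if "x \<in> sub_unitary n C \<or> x \<in> sub_unitary n C'" for x
    using that by (auto simp: C_def C'_def elim!: sub_unitary_supp)
  have toI: "x \<in> sub_unitary n I" if "x \<in> supp_unitary n I R" for x and R :: "nat \<Rightarrow> bool"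
    using that by (rule supp_unitary_sub) simp
  note gc = supp_unitary_carrier[OF g]
  obtain l h where l: "l \<in> sub_unitary n V" and h: "h \<in> sub_unitary n C"
    and row: "\<And>j. j \<in> C \<Longrightarrow> j \<noteq> a \<Longrightarrow> (l * g * h) $$ (a,j) = 0"
    and col: "\<And>i. i \<in> V \<Longrightarrow> i \<noteq> a \<Longrightarrow> (l * g * h) $$ (i,a) = 0"
    using block_corner[OF gc n(3) VC(3) n(5) VC(7)] by blast
  define f where "f = l * g * h"
  note lP = inP[OF disjI1[OF l]] and hQ = inQ[OF disjI1[OF h]]
  note lc = supp_unitary_carrier[OF l] and hc = supp_unitary_carrier[OF h]
  have fI: "f \<in> sub_unitary n I" unfolding f_def using g toI[OF lP] toI[OF hQ] by (intro supp_unitary_mult)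
  note fc = supp_unitary_carrier[OF fI] and fu = supp_unitary_unitary[OF fI]
  show thesis
  proof (cases "cmod (f $$ (a,a)) = 1")
    case False
    obtain l2 h2 where 2: "l2 \<in> sub_unitary n V'" "h2 \<in> sub_unitary n C'"
      "\<And>r j. r \<in> {a,a'} \<Longrightarrow> j < n \<Longrightarrow> j \<notin> {a,a'} \<Longrightarrow> (l2 * f * h2) $$ (r,j) = 0"
      using split_plane_corner[OF fI I VC row[folded f_def] col[folded f_def] False] by blast
    have "l2 * f * h2 = (l2 * l) * g * (h * h2)"
      unfolding f_def using lc hc gc 2(1,2)[THEN supp_unitary_carrier] by (simp add: sq_mult_assoc[of _ n])
    then show thesis
      using that[OF supp_unitary_mult[OF inP[OF disjI2[OF 2(1)]] lP] supp_unitary_mult[OF hQ inQ[OF disjI2[OF 2(2)]]]] 2(3)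
      by simp
  next
    case True
    obtain l2 h2 where l2: "l2 \<in> sub_unitary n V'" and h2: "h2 \<in> sub_unitary n C'"
      and row2: "\<And>j. j \<in> C' \<Longrightarrow> j \<noteq> a' \<Longrightarrow> (l2 * f * h2) $$ (a',j) = 0"
      and col2: "\<And>i. i \<in> V' \<Longrightarrow> i \<noteq> a' \<Longrightarrow> (l2 * f * h2) $$ (i,a') = 0"
      using block_corner[OF fc n(4) VC(4) n(6) VC(8)] by blast
    define k where "k = l2 * f * h2"
    note l2P = inP[OF disjI2[OF l2]] and h2Q = inQ[OF disjI2[OF h2]]
    note l2c = supp_unitary_carrier[OF l2] and h2c = supp_unitary_carrier[OF h2]
    have kI: "k \<in> sub_unitary n I" unfolding k_def using fI toI[OF l2P] toI[OF h2Q] by (intro supp_unitary_mult)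
    note ku = supp_unitary_unitary[OF kI]
    have kg: "k = (l2 * l) * g * (h * h2)"
      unfolding k_def f_def using lc hc gc l2c h2c by (simp add: sq_mult_assoc[of _ n])
    show thesis
    proof (cases "cmod (k $$ (a',a')) = 1")
      case True
      have fhc: "f * h2 \<in> carrier_mat n n" using fc h2c by simp
      \<comment> \<open>\<open>l2\<close> and \<open>h2\<close> act on \<open>V'\<close> and
        \<open>C'\<close>, which do not contain \<open>a\<close>, so the first corner keeps modulus
        one. With both corners of modulus one, each of the two rows is concentrated on the
        diagonal.\<close>
      have ka: "k $$ (a,a) = f $$ (a,a)"
      proof -
        have "k $$ (a,a) = (l2 * (f * h2)) $$ (a,a)" unfolding k_def using l2c fc h2c by (simp add: sq_mult_assoc[of _ n])
        also have "\<dots> = (f * h2) $$ (a,a)"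
          using sub_unitary_mult_entry[OF l2 fhc n(4) n(1) n(1)] VC by auto
        also have "\<dots> = f $$ (a,a)"
          using mult_sub_unitary_entry[OF h2 fc n(6) n(1) n(1)] VC by auto
        finally show ?thesis .
      qed
      have "k $$ (r,j) = 0" if "r \<in> {a,a'}" "j < n" "j \<notin> {a,a'}" for r j
        using that unitary_unit_entry_row[OF ku n(1,1)] unitary_unit_entry_row[OF ku n(2,2)] True
          \<open>cmod (f $$ (a,a)) = 1\<close> ka by auto
      then show thesis
        using that[OF supp_unitary_mult[OF l2P lP] supp_unitary_mult[OF hQ h2Q]] kg by simp
    next
      case False
      \<comment> \<open>The second corner is not of modulus one, so the corner argument applies with
        \<open>a\<close> and \<open>a'\<close> exchanged and each part replaced by its
        complement.\<close>
      obtain l3 h3 where 3: "l3 \<in> sub_unitary n V" "h3 \<in> sub_unitary n C"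
        "\<And>r j. r \<in> {a',a} \<Longrightarrow> j < n \<Longrightarrow> j \<notin> {a',a} \<Longrightarrow> (l3 * k * h3) $$ (r,j) = 0"
        using split_plane_corner[OF kI I VC'(1,2) VC(4,3) VC'(3,4) VC(8,7)
            row2[folded k_def] col2[folded k_def] False] by blast
      have "l3 * k * h3 = (l3 * (l2 * l)) * g * (h * h2 * h3)"
        unfolding kg using lc hc gc l2c h2c 3(1,2)[THEN supp_unitary_carrier] by (simp add: sq_mult_assoc[of _ n])
      then show thesis
        using that[OF supp_unitary_mult[OF inP[OF disjI1[OF 3(1)]] supp_unitary_mult[OF l2P lP]]
              supp_unitary_mult[OF supp_unitary_mult[OF hQ h2Q] inQ[OF disjI1[OF 3(2)]]]] 3(3)
        by (simp add: insert_commute)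
    qed
  qed
qed

text \<open>On the plane \<open>g\<close> is a 2x2 unitary matrix, and the four dimensions of U(2)
  are one rotation angle and three phases. The phases are \<open>l\<close>, \<open>h1\<close> and
  \<open>h2\<close>, each acting on one coordinate; what \<open>g\<close> does on the other
  coordinates is \<open>g'\<close>.\<close>

lemma split_rot_of_plane:
  assumes inv: "involutive_below n \<sigma>" and g: "g \<in> sub_unitary n I" and I: "I \<subseteq> {..<n}"
    and a: "a \<in> I" "\<sigma> a \<in> I" "\<sigma> a \<noteq> a"
    and rows: "\<And>r j. r \<in> {a,\<sigma> a} \<Longrightarrow> j < n \<Longrightarrow> j \<notin> {a,\<sigma> a} \<Longrightarrow> g $$ (r,j) = 0"
  obtains l h1 h2 \<theta> g' where "l \<in> sub_unitary n {\<sigma> a}" "h1 \<in> sub_unitary n {a}"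
    "h2 \<in> sub_unitary n {\<sigma> a}" "g' \<in> sub_unitary n (I - {a, \<sigma> a})"
    "g = l * rot n \<sigma> (plane_angle \<sigma> a \<theta>) * g' * (h2 * h1)"
proof -
  let ?b = "\<sigma> a"
  have n: "a < n" "?b < n" using a I by auto
  note gc = supp_unitary_carrier[OF g]
  obtain h1 h2 \<theta> where h1: "h1 \<in> sub_unitary n {a}" and h2: "h2 \<in> sub_unitary n {?b}"
    and k: "g * h1 * h2 * rot n \<sigma> (plane_angle \<sigma> a \<theta>) \<in> sub_unitary n (I - {a})"
    by (rule row_to_rot[OF inv n(1) a(3) g I, of "{a}" "{?b}"]) (use a rows I in auto)
  define R where "R = rot n \<sigma> (plane_angle \<sigma> a \<theta>)"
  define X where "X = h1 * h2 * R"
  have R: "R \<in> sub_unitary n {a,?b}" unfolding R_def using inv n a by (intro rot_plane_sub_unitary) auto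
  have h12: "h1 \<in> sub_unitary n {a,?b}" "h2 \<in> sub_unitary n {a,?b}"
    using supp_unitary_sub[OF h1] supp_unitary_sub[OF h2] by auto
  have X: "X \<in> sub_unitary n {a,?b}" unfolding X_def using R h12 by (intro supp_unitary_mult)
  note c = supp_unitary_carrier[OF h1] supp_unitary_carrier[OF h2] supp_unitary_carrier[OF R] supp_unitary_carrier[OF X]
  have kX: "g * h1 * h2 * rot n \<sigma> (plane_angle \<sigma> a \<theta>) = g * X"
    unfolding X_def R_def[symmetric] using gc c by (simp add: sq_mult_assoc[of _ n])
  define f where "f = g * X"
  have f: "f \<in> sub_unitary n (I - {a})" using k unfolding kX f_def .
  note fc = supp_unitary_carrier[OF f] and fu = supp_unitary_unitary[OF f]
  have f0: "f $$ (?b,j) = 0" if "j < n" "j \<noteq> ?b" for j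
  proof (cases "j = a")
    case True
    then show ?thesis using supp_unitary_outside[OF f n(2) that(1)] a by auto
  next
    case False
    then show ?thesis
      using mult_sub_unitary_entry[OF X gc _ n(2) that(1)] n that rows[of ?b j] by (simp add: f_def)
  qed
  have "(\<Sum>k<n. (cmod (f $$ (?b,k)))\<^sup>2) = (cmod (f $$ (?b,?b)))\<^sup>2"
    using f0 n by (subst sum.remove[of _ ?b]) auto
  then have fb: "(cmod (f $$ (?b,?b)))\<^sup>2 = 1" using unitary_row_norm[OF fu n(2)] by simp
  obtain l where l: "l \<in> sub_unitary n {?b}"
    and el: "\<And>i. i \<in> {?b} \<Longrightarrow> (l * f) $$ (i,?b) =
       (if i = ?b then of_real (sqrt (\<Sum>k\<in>{?b}. (cmod (f $$ (k,?b)))\<^sup>2)) else 0)"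
    using householder_col[OF _ _ fc n(2), of "{?b}" ?b] n by blast
  have l1: "(l * f) $$ (?b,?b) = 1" using el[of ?b] fb by simp
  have lI: "l \<in> sub_unitary n (I - {a})" using supp_unitary_sub[OF l, of "I - {a}"] a by auto
  have "I - {a} - {?b} = I - {a,?b}" by auto
  then have g': "l * f \<in> sub_unitary n (I - {a,?b})"
    using sub_unitary_remove[OF supp_unitary_mult[OF lI f] n(2) l1] by (simp only:)
  note lc = supp_unitary_carrier[OF l] and lu = supp_unitary_unitary[OF l]
  have "g = mat_adj l * (l * f) * mat_adj X"
    using unitary_solve[OF lu supp_unitary_unitary[OF X] gc] lc gc c by (simp add: f_def sq_mult_assoc[of _ n])
  also have "mat_adj X = mat_adj R * (mat_adj h2 * mat_adj h1)"
    unfolding X_def using c by (simp add: mat_adj_mult[of _ n] sq_mult_assoc[of _ n])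
  also have "mat_adj l * (l * f) * (mat_adj R * (mat_adj h2 * mat_adj h1)) =
     mat_adj l * ((l * f) * mat_adj R) * (mat_adj h2 * mat_adj h1)"
    using lc fc c by (simp add: sq_mult_assoc[of _ n])
  \<comment> \<open>The plane is disjoint from the support of the remainder. The rotation has to
    stand to the left of it so that rotations of successive steps become neighbours.\<close>
  also have "(l * f) * mat_adj R = mat_adj R * (l * f)"
    by (rule supp_unitary_commute[OF g' supp_unitary_adj[OF R]]) auto
  also have "mat_adj l * (mat_adj R * (l * f)) * (mat_adj h2 * mat_adj h1) =
    mat_adj l * mat_adj R * (l * f) * (mat_adj h2 * mat_adj h1)"
    using lc fc c by (simp add: sq_mult_assoc[of _ n])
  also have "mat_adj R = rot n \<sigma> (plane_angle \<sigma> a (- \<theta>))"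
    unfolding R_def by (rule rot_plane_adj[OF inv n(1) a(3)])
  finally show thesis
    by (rule that[OF supp_unitary_adj[OF l] supp_unitary_adj[OF h1] supp_unitary_adj[OF h2] g'])
qed

section \<open>Two blocks on either side\<close>

lemma split_rot:
  assumes inv: "involutive_below n \<sigma>" and g: "g \<in> sub_unitary n I" and I: "I \<subseteq> {..<n}"
    and a: "a \<in> I" "P a" "Q a" and b: "\<sigma> a \<in> I" "\<not> P (\<sigma> a)" "\<not> Q (\<sigma> a)"
  obtains l h \<theta> g' where "l \<in> supp_unitary n I P" "h \<in> supp_unitary n I Q"
    "g' \<in> sub_unitary n (I - {a, \<sigma> a})" "g = l * rot n \<sigma> (plane_angle \<sigma> a \<theta>) * g' * h"
proof -
  note gc = supp_unitary_carrier[OF g]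
  obtain l h where l: "l \<in> supp_unitary n I P" and h: "h \<in> supp_unitary n I Q"
    and z: "\<And>r j. r \<in> {a,\<sigma> a} \<Longrightarrow> j < n \<Longrightarrow> j \<notin> {a,\<sigma> a} \<Longrightarrow> (l * g * h) $$ (r,j) = 0"
    using split_plane[OF g I a b] by blast
  have ne: "\<sigma> a \<noteq> a" using a b by metis
  have toI: "x \<in> sub_unitary n I" if "x \<in> supp_unitary n I R" for x and R :: "nat \<Rightarrow> bool"
    using that by (rule supp_unitary_sub) simp
  have f: "l * g * h \<in> sub_unitary n I" using g toI[OF l] toI[OF h] by (intro supp_unitary_mult)
  obtain l' h1 h2 \<theta> g' where l': "l' \<in> sub_unitary n {\<sigma> a}" and h1: "h1 \<in> sub_unitary n {a}"
    and h2: "h2 \<in> sub_unitary n {\<sigma> a}" and g': "g' \<in> sub_unitary n (I - {a, \<sigma> a})"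
    and e: "l * g * h = l' * rot n \<sigma> (plane_angle \<sigma> a \<theta>) * g' * (h2 * h1)"
    by (rule split_rot_of_plane[OF inv f I a(1) b(1) ne z])
  \<comment> \<open>A phase on one coordinate respects every labelling and is absorbed by the
    neighbouring block factor.\<close>
  have lP: "mat_adj l * l' \<in> supp_unitary n I P"
    using b by (intro supp_unitary_mult supp_unitary_adj[OF l] sub_unitary_supp[OF l']) auto
  have hQ: "h2 * h1 * mat_adj h \<in> supp_unitary n I Q"
    using a b
    by (intro supp_unitary_mult supp_unitary_adj[OF h] sub_unitary_supp[OF h1] sub_unitary_supp[OF h2]) auto
  have "g = mat_adj l * (l * g * h) * mat_adj h"
    using unitary_solve[OF supp_unitary_unitary[OF l] supp_unitary_unitary[OF h] gc] by simp
  also have "\<dots> = (mat_adj l * l') * rot n \<sigma> (plane_angle \<sigma> a \<theta>) * g' * (h2 * h1 * mat_adj h)"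
    unfolding e using supp_unitary_carrier[OF l] supp_unitary_carrier[OF h] supp_unitary_carrier[OF h1]
      supp_unitary_carrier[OF h2] supp_unitary_carrier[OF l'] supp_unitary_carrier[OF g']
    by (simp add: sq_mult_assoc[of _ n])
  finally show thesis by (rule that[OF lP hQ g'])
qed

text \<open>Removing both end points of the interval takes one coordinate from each of the four
  parts cut off by \<open>c\<close> and \<open>d\<close>, so \<open>m\<close> counts the possible
  steps. The cuts stay in place while the interval shrinks around them. Arbitrary intervals are
  allowed because the result is also applied to a proper subinterval.\<close>

lemma unitary_two_block_decomp:
  assumes inv: "involutive_below n \<sigma>"
    and "hi \<le> n" "lo \<le> c" "c \<le> hi" "lo \<le> d" "d \<le> hi"
    and "\<And>x. lo \<le> x \<Longrightarrow> x < hi \<Longrightarrow> \<sigma> x = lo + hi - 1 - x"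
    and "m = min (min (c - lo) (hi - c)) (min (d - lo) (hi - d))"
    and "g \<in> sub_unitary n {lo..<hi}"
  shows "\<exists>l \<in> supp_unitary n {lo..<hi} (\<lambda>x. x < c). \<exists>h \<in> supp_unitary n {lo..<hi} (\<lambda>x. x < d).
    \<exists>t \<in> torus n \<sigma> {lo..<lo + m}. g = l * t * h"
  using assms(2-)
proof (induction m arbitrary: lo hi g)
  case 0
  note gc = supp_unitary_carrier[OF "0.prems"(8)]
  \<comment> \<open>One of the four parts is empty, so one of the two labels is constant on the
    interval and \<open>g\<close> itself is a block factor.\<close>
  consider "c = lo" | "c = hi" | "d = lo" | "d = hi" using 0 by (auto simp: min_def split: if_splits)
  then have "g \<in> supp_unitary n {lo..<hi} (\<lambda>x. x < c) \<or> g \<in> supp_unitary n {lo..<hi} (\<lambda>x. x < d)"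
    using sub_unitary_supp[OF "0.prems"(8) subset_refl, of "\<lambda>x. x < c"]
      sub_unitary_supp[OF "0.prems"(8) subset_refl, of "\<lambda>x. x < d"]
    by cases fastforce+
  moreover have "g = g * 1\<^sub>m n * 1\<^sub>m n" "g = 1\<^sub>m n * 1\<^sub>m n * g" using gc by auto
  ultimately show ?case by (meson one_in_torus supp_unitary_one)
next
  case (Suc m)
  have ineq: "lo < c" "c < hi" "lo < d" "d < hi" using Suc.prems(7) by auto
  have sl: "\<sigma> lo = hi - 1" using Suc.prems(6)[of lo] ineq by simp
  obtain l h \<theta> g' where l: "l \<in> supp_unitary n {lo..<hi} (\<lambda>x. x < c)"
    and h: "h \<in> supp_unitary n {lo..<hi} (\<lambda>x. x < d)"
    and g': "g' \<in> sub_unitary n ({lo..<hi} - {lo, \<sigma> lo})"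
    and e: "g = l * rot n \<sigma> (plane_angle \<sigma> lo \<theta>) * g' * h"
    by (rule split_rot[OF inv Suc.prems(8), of lo "\<lambda>x. x < c" "\<lambda>x. x < d"])
       (use ineq sl Suc.prems(1) in auto)
  have I': "{lo..<hi} - {lo, \<sigma> lo} = {Suc lo..<hi - 1}" unfolding sl by auto
  have "\<exists>l \<in> supp_unitary n {Suc lo..<hi - 1} (\<lambda>x. x < c). \<exists>h \<in> supp_unitary n {Suc lo..<hi - 1} (\<lambda>x. x < d).
    \<exists>t \<in> torus n \<sigma> {Suc lo..<Suc lo + m}. g' = l * t * h"
  proof (rule Suc.IH)
    show "\<sigma> x = Suc lo + (hi - 1) - 1 - x" if "Suc lo \<le> x" "x < hi - 1" for x
      using Suc.prems(6)[of x] that ineq by simp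
    have "min (x - Suc 0) (y - Suc 0) = min x y - Suc 0" for x y :: nat by (simp add: min_def)
    moreover have "c - Suc lo = c - lo - Suc 0" "hi - 1 - c = hi - c - Suc 0"
      "d - Suc lo = d - lo - Suc 0" "hi - 1 - d = hi - d - Suc 0" by simp_all
    ultimately show "m = min (min (c - Suc lo) (hi - 1 - c)) (min (d - Suc lo) (hi - 1 - d))"
      using Suc.prems(7)[symmetric] by (simp only: diff_Suc_Suc diff_zero)
    show "g' \<in> sub_unitary n {Suc lo..<hi - 1}" using g' unfolding I' .
  qed (use Suc.prems(1) ineq in simp_all)
  then obtain l' h' t where l': "l' \<in> supp_unitary n {Suc lo..<hi - 1} (\<lambda>x. x < c)"
    and h': "h' \<in> supp_unitary n {Suc lo..<hi - 1} (\<lambda>x. x < d)"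
    and t: "t \<in> torus n \<sigma> {Suc lo..<Suc lo + m}" and e': "g' = l' * t * h'" by blast
  define R where "R = rot n \<sigma> (plane_angle \<sigma> lo \<theta>)"
  have ne: "\<sigma> lo \<noteq> lo" "lo < n" using sl ineq Suc.prems(1) by auto
  have R: "R \<in> torus n \<sigma> {lo}" "R \<in> sub_unitary n {lo, hi - 1}"
    unfolding R_def using inv ne sl by (auto intro!: plane_in_torus rot_plane_sub_unitary)
  \<comment> \<open>\<open>l'\<close> lives strictly inside the interval, while \<open>R\<close>
    moves only its two end points.\<close>
  have Rl: "R * l' = l' * R"
    by (rule supp_unitary_commute[OF R(2) l']) auto
  have tc: "t \<in> carrier_mat n n" using t by (auto simp: torus_def)
  note c = supp_unitary_carrier[OF l] supp_unitary_carrier[OF h] supp_unitary_carrier[OF l']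
    supp_unitary_carrier[OF h'] supp_unitary_carrier[OF R(2)] tc
  have "g = l * (R * l') * (t * (h' * h))"
    unfolding e e' R_def[symmetric] using c by (simp add: sq_mult_assoc[of _ n])
  also have "\<dots> = (l * l') * (R * t) * (h' * h)"
    unfolding Rl using c by (simp add: sq_mult_assoc[of _ n])
  finally have g: "g = (l * l') * (R * t) * (h' * h)" .
  have "R * t \<in> torus n \<sigma> {lo..<lo + Suc m}"
    by (rule torus_mult[OF inv R(1) t]) auto
  moreover have "l * l' \<in> supp_unitary n {lo..<hi} (\<lambda>x. x < c)"
    by (intro supp_unitary_mult l supp_unitary_subset[OF l']) auto
  moreover have "h' * h \<in> supp_unitary n {lo..<hi} (\<lambda>x. x < d)"
    by (intro supp_unitary_mult h supp_unitary_subset[OF h']) auto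
  ultimately show ?case using g by blast
qed

section \<open>Blocks of sizes 1, n2, n3\<close>

lemma involutive_below_reflect: "involutive_below n (\<lambda>x. n - 1 - x)"
  by (auto simp: involutive_below_def)

lemma involutive_below_reflect1: "involutive_below n (\<lambda>x. if x = 0 then 0 else n - x)"
  by (auto simp: involutive_below_def)

text \<open>The bounds on \<open>s\<close> say that the cut at \<open>p\<close> splits
  \<open>{s..<n - s}\<close>, and the cut after \<open>n2\<close> splits
  \<open>{Suc s..<n - s}\<close>, into two nonempty parts; each rotation plane has one endpoint on
  either side. Index \<open>s\<close> is missing from the support of \<open>l\<close>: it is the
  one-dimensional block of this stage, and its row is reduced by right multiplication alone.\<close>

lemma unitary_line_block_step:
  fixes n n2 n3 p q s :: nat
  defines "\<sigma>1 \<equiv> (\<lambda>x. if x = 0 then 0 else n - x)" and "\<sigma>2 \<equiv> (\<lambda>x. n - 1 - x)"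
  assumes n: "n = 1 + n2 + n3" "n = p + q" and s: "s < n2" "s < n3" "s < p" "s < q"
    and g: "g \<in> sub_unitary n {s..<n - s}"
  obtains l R1 R2 h g' where "l \<in> supp_unitary n {Suc s..<n - s} (\<lambda>x. x \<le> n2)"
    "h \<in> supp_unitary n {s..<n - s} (\<lambda>x. x < p)" "g' \<in> sub_unitary n {Suc s..<n - Suc s}"
    "R1 \<in> torus n \<sigma>1 {Suc s}" "R2 \<in> torus n \<sigma>2 {s}"
    "g = l * R1 * g' * R2 * h"
proof -
  have inv: "involutive_below n \<sigma>1" "involutive_below n \<sigma>2"
    unfolding \<sigma>1_def \<sigma>2_def by (rule involutive_below_reflect involutive_below_reflect1)+
  let ?I = "{s..<n - s}" and ?b = "n - 1 - s"
  have In: "?I \<subseteq> {..<n}" by auto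
  have sn: "s < n" using n s by simp
  have s2: "\<sigma>2 s = ?b" by (simp add: \<sigma>2_def)
  note gc = supp_unitary_carrier[OF g]
  obtain h1 h2 \<theta> where h1: "h1 \<in> sub_unitary n {s..<p}" and h2: "h2 \<in> sub_unitary n {p..<n - s}"
    and k: "g * h1 * h2 * rot n \<sigma>2 (plane_angle \<sigma>2 s \<theta>) \<in> sub_unitary n (?I - {s})"
    by (rule row_to_rot[OF inv(2) sn _ g In, of "{s..<p}" "{p..<n - s}"]) (use n s s2 in auto)
  define R where "R = rot n \<sigma>2 (plane_angle \<sigma>2 s \<theta>)"
  have sne: "\<sigma>2 s \<noteq> s" using s2 n s by simp
  have R: "R \<in> sub_unitary n {s, ?b}"
    unfolding R_def using inv(2) sn sne s2 by (intro rot_plane_sub_unitary) auto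
  define X where "X = h1 * h2 * R"
  have XU: "X \<in> unitary_group n" unfolding X_def
    using supp_unitary_unitary[OF h1] supp_unitary_unitary[OF h2] supp_unitary_unitary[OF R]
    by (intro unitary_mult)
  define f where "f = g * X"
  note c1 = supp_unitary_carrier[OF h1] supp_unitary_carrier[OF h2] supp_unitary_carrier[OF R]
  have fk: "g * h1 * h2 * rot n \<sigma>2 (plane_angle \<sigma>2 s \<theta>) = f"
    unfolding f_def X_def R_def[symmetric] using gc c1 by (simp add: sq_mult_assoc[of _ n])
  have I': "?I - {s} = {Suc s..<n - s}" by auto
  have f: "f \<in> sub_unitary n {Suc s..<n - s}" using k unfolding fk I' .
  note fc = supp_unitary_carrier[OF f]
  have bn: "?b < n" using n by simp
  \<comment> \<open>Column \<open>n - 1 - s\<close> is paired with \<open>s + 1\<close> because the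
    row step has already removed \<open>s\<close>. This is why a second matching is needed.\<close>
  have s1: "\<sigma>1 ?b = Suc s" using n s by (simp add: \<sigma>1_def)
  have bne: "\<sigma>1 ?b \<noteq> ?b" using s1 n s by simp
  obtain l1 l2 \<phi> where l1: "l1 \<in> sub_unitary n {Suc n2..<n - s}" and l2: "l2 \<in> sub_unitary n {Suc s..n2}"
    and g': "rot n \<sigma>1 (plane_angle \<sigma>1 ?b \<phi>) * (l2 * (l1 * f)) \<in> sub_unitary n ({Suc s..<n - s} - {?b})"
    by (rule col_to_rot[OF inv(1) bn bne f, of "{Suc n2..<n - s}" "{Suc s..n2}"]) (use n s s1 in auto)
  define S where "S = rot n \<sigma>1 (plane_angle \<sigma>1 ?b \<phi>)"
  have S: "S \<in> sub_unitary n {Suc s, ?b}"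
    unfolding S_def using inv(1) bn bne s1 by (intro rot_plane_sub_unitary) auto
  define g1 where "g1 = S * (l2 * (l1 * f))"
  have J: "{Suc s..<n - s} - {?b} = {Suc s..<n - Suc s}" by auto
  have g1: "g1 \<in> sub_unitary n {Suc s..<n - Suc s}" using g' unfolding g1_def S_def J .
  note c2 = supp_unitary_carrier[OF l1] supp_unitary_carrier[OF l2] supp_unitary_carrier[OF S]
  define Y where "Y = S * l2 * l1"
  have YU: "Y \<in> unitary_group n" unfolding Y_def
    using supp_unitary_unitary[OF l1] supp_unitary_unitary[OF l2] supp_unitary_unitary[OF S]
    by (intro unitary_mult)
  have Xc: "X \<in> carrier_mat n n" "Y \<in> carrier_mat n n" using XU YU by auto
  have "g1 = Y * g * X"
    unfolding g1_def Y_def f_def using c2 gc Xc by (simp add: sq_mult_assoc[of _ n])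
  then have "g = mat_adj Y * g1 * mat_adj X" by (rule unitary_solve[OF YU XU gc])
  also have "mat_adj Y = (mat_adj l1 * mat_adj l2) * mat_adj S"
    unfolding Y_def using c2 by (simp add: mat_adj_mult[of _ n] sq_mult_assoc[of _ n])
  also have "mat_adj X = mat_adj R * (mat_adj h2 * mat_adj h1)"
    unfolding X_def using c1 by (simp add: mat_adj_mult[of _ n] sq_mult_assoc[of _ n])
  also have "(mat_adj l1 * mat_adj l2) * mat_adj S * g1 * (mat_adj R * (mat_adj h2 * mat_adj h1)) =
     (mat_adj l1 * mat_adj l2) * mat_adj S * g1 * mat_adj R * (mat_adj h2 * mat_adj h1)"
    using c1 c2 supp_unitary_carrier[OF g1] by (simp add: sq_mult_assoc[of _ n])
  finally have e: "g = (mat_adj l1 * mat_adj l2) * mat_adj S * g1 * mat_adj R * (mat_adj h2 * mat_adj h1)" .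
  have "mat_adj S \<in> torus n \<sigma>1 {Suc s}"
    unfolding S_def rot_plane_adj[OF inv(1) bn bne]
    using s1 by (intro plane_in_torus inv(1) bn bne) auto
  moreover have "mat_adj R \<in> torus n \<sigma>2 {s}"
    unfolding R_def rot_plane_adj[OF inv(2) sn sne] by (intro plane_in_torus inv(2) sn sne) auto
  moreover have "mat_adj l1 * mat_adj l2 \<in> supp_unitary n {Suc s..<n - s} (\<lambda>x. x \<le> n2)"
    using n s
    by (intro supp_unitary_mult sub_unitary_supp[OF supp_unitary_adj[OF l1], of _ _ False]
        sub_unitary_supp[OF supp_unitary_adj[OF l2], of _ _ True]) auto
  moreover have "mat_adj h2 * mat_adj h1 \<in> supp_unitary n ?I (\<lambda>x. x < p)"
    using n s
    by (intro supp_unitary_mult sub_unitary_supp[OF supp_unitary_adj[OF h1], of _ _ True]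
        sub_unitary_supp[OF supp_unitary_adj[OF h2], of _ _ False]) auto
  ultimately show thesis using that g1 e by blast
qed

text \<open>With one left block used up, whatever the row step leaves over is supported in the other
  left block and is itself a left factor. This row rotation without a companion column rotation
  accounts for the difference between the two ranks.\<close>

lemma unitary_line_block_last:
  fixes n n2 n3 p q s :: nat
  defines "\<sigma>2 \<equiv> (\<lambda>x. n - 1 - x)"
  assumes n: "n = 1 + n2 + n3" "n = p + q" and s: "s = n2 \<or> s = n3" "s < p" "s < q"
    and g: "g \<in> sub_unitary n {s..<n - s}"
  obtains l R2 h where "l \<in> supp_unitary n {Suc s..<n - s} (\<lambda>x. x \<le> n2)"
    "h \<in> supp_unitary n {s..<n - s} (\<lambda>x. x < p)" "R2 \<in> torus n \<sigma>2 {s}" "g = l * R2 * h"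
proof -
  have inv: "involutive_below n \<sigma>2" unfolding \<sigma>2_def by (rule involutive_below_reflect)
  let ?I = "{s..<n - s}"
  have In: "?I \<subseteq> {..<n}" by auto
  have sn: "s < n" using n s by simp
  have s2: "\<sigma>2 s = n - 1 - s" by (simp add: \<sigma>2_def)
  note gc = supp_unitary_carrier[OF g]
  obtain h1 h2 \<theta> where h1: "h1 \<in> sub_unitary n {s..<p}" and h2: "h2 \<in> sub_unitary n {p..<n - s}"
    and k: "g * h1 * h2 * rot n \<sigma>2 (plane_angle \<sigma>2 s \<theta>) \<in> sub_unitary n (?I - {s})"
    by (rule row_to_rot[OF inv sn _ g In, of "{s..<p}" "{p..<n - s}"]) (use n s s2 in auto)
  define R where "R = rot n \<sigma>2 (plane_angle \<sigma>2 s \<theta>)"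
  have sne: "\<sigma>2 s \<noteq> s" using s2 n s by simp
  have R: "R \<in> sub_unitary n {s, \<sigma>2 s}"
    unfolding R_def using inv sn sne by (intro rot_plane_sub_unitary) auto
  define X where "X = h1 * h2 * R"
  have XU: "X \<in> unitary_group n" unfolding X_def
    using supp_unitary_unitary[OF h1] supp_unitary_unitary[OF h2] supp_unitary_unitary[OF R]
    by (intro unitary_mult)
  note c1 = supp_unitary_carrier[OF h1] supp_unitary_carrier[OF h2] supp_unitary_carrier[OF R]
  define f where "f = g * X"
  have fk: "g * h1 * h2 * rot n \<sigma>2 (plane_angle \<sigma>2 s \<theta>) = f"
    unfolding f_def X_def R_def[symmetric] using gc c1 by (simp add: sq_mult_assoc[of _ n])
  have I': "?I - {s} = {Suc s..<n - s}" by auto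
  have f: "f \<in> sub_unitary n {Suc s..<n - s}" using k unfolding fk I' .
  note fc = supp_unitary_carrier[OF f]
  \<comment> \<open>The constant label is true when the block of size \<open>n3\<close> is the
    exhausted one and false when it is the block of size \<open>n2\<close>; if both are, the
    interval is empty.\<close>
  have fl: "f \<in> supp_unitary n {Suc s..<n - s} (\<lambda>x. x \<le> n2)"
    by (rule sub_unitary_supp[OF f, of _ _ "s = n3 \<and> s \<noteq> n2"]) (use n s in auto)
  have "f = 1\<^sub>m n * g * X" unfolding f_def using gc by simp
  from unitary_solve[OF unitary_one XU gc this] have "g = mat_adj (1\<^sub>m n) * f * mat_adj X" .
  also have "mat_adj (1\<^sub>m n) = (1\<^sub>m n :: complex mat)" by (rule eq_matI) (auto simp: mat_adj_def)
  also have "mat_adj X = mat_adj R * (mat_adj h2 * mat_adj h1)"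
    unfolding X_def using c1 by (simp add: mat_adj_mult[of _ n] sq_mult_assoc[of _ n])
  also have "1\<^sub>m n * f * (mat_adj R * (mat_adj h2 * mat_adj h1)) =
     f * mat_adj R * (mat_adj h2 * mat_adj h1)"
    using c1 fc by (simp add: sq_mult_assoc[of _ n])
  finally have e: "g = f * mat_adj R * (mat_adj h2 * mat_adj h1)" .
  have "mat_adj R \<in> torus n \<sigma>2 {s}"
    unfolding R_def rot_plane_adj[OF inv sn sne] by (intro plane_in_torus inv sn sne) auto
  moreover have "mat_adj h2 * mat_adj h1 \<in> supp_unitary n ?I (\<lambda>x. x < p)"
    using n s
    by (intro supp_unitary_mult sub_unitary_supp[OF supp_unitary_adj[OF h1], of _ _ True]
        sub_unitary_supp[OF supp_unitary_adj[OF h2], of _ _ False]) auto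
  ultimately show thesis using that fl e by blast
qed

text \<open>The matchings \<open>x \<leftrightarrow> n - x\<close> and \<open>x \<leftrightarrow> n - 1 - x\<close> link all indices into one zigzag path
  starting at the one-dimensional block; each step of the induction consumes one edge of each.\<close>

lemma unitary_line_block_decomp:
  fixes n n2 n3 p q s :: nat
  defines "\<sigma>1 \<equiv> (\<lambda>x. if x = 0 then 0 else n - x)" and "\<sigma>2 \<equiv> (\<lambda>x. n - 1 - x)"
  defines "m1 \<equiv> min (min p q) (min n2 n3)" and "m2 \<equiv> min (min p q) (min (n2 + 1) (n3 + 1))"
  assumes n: "n = 1 + n2 + n3" "n = p + q" and s: "s \<le> m1"
    and g: "g \<in> sub_unitary n {s..<n - s}"
  shows "\<exists>l \<in> supp_unitary n {Suc s..<n - s} (\<lambda>x. x \<le> n2). \<exists>t1 \<in> torus n \<sigma>1 {Suc s..m1}.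
     \<exists>t2 \<in> torus n \<sigma>2 {s..<m2}. \<exists>h \<in> supp_unitary n {s..<n - s} (\<lambda>x. x < p). g = l * t1 * t2 * h"
proof -
  have inv: "involutive_below n \<sigma>1" "involutive_below n \<sigma>2"
    unfolding \<sigma>1_def \<sigma>2_def by (rule involutive_below_reflect involutive_below_reflect1)+
  show ?thesis using s g
  proof (induction s arbitrary: g rule: inc_induct)
    case base
    show ?case
    \<comment> \<open>Either a left block runs out strictly before both parts of the right cut, and
      one row rotation remains, so \<open>m2 = m1 + 1\<close>; or one part of the right cut is
      empty, \<open>g\<close> is a right factor and both tori contribute the identity.\<close>
    proof (cases "m1 < p \<and> m1 < q")
      case True
      then have m: "m1 = n2 \<or> m1 = n3" "m1 < p" "m1 < q" "m2 = Suc m1"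
        by (auto simp: m1_def m2_def min_def split: if_splits)
      obtain l R2 h where "l \<in> supp_unitary n {Suc m1..<n - m1} (\<lambda>x. x \<le> n2)"
        "h \<in> supp_unitary n {m1..<n - m1} (\<lambda>x. x < p)" and R2: "R2 \<in> torus n \<sigma>2 {m1}" and e: "g = l * R2 * h"
        by (rule unitary_line_block_last[OF n m(1-3) base, folded \<sigma>2_def])
      moreover have "g = l * 1\<^sub>m n * R2 * h" using e calculation(1) by simp
      moreover have "R2 \<in> torus n \<sigma>2 {m1..<m2}" using R2 m by simp
      ultimately show ?thesis using one_in_torus by blast
    next
      case False
      then have "m1 = p \<or> m1 = q" by (auto simp: m1_def)
      then have "g \<in> supp_unitary n {m1..<n - m1} (\<lambda>x. x < p)"
        by (intro sub_unitary_supp[OF base, of _ _ "m1 \<noteq> p"]) (use n in auto)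
      moreover have "g = 1\<^sub>m n * 1\<^sub>m n * 1\<^sub>m n * g" using supp_unitary_carrier[OF base] by simp
      ultimately show ?thesis using one_in_torus supp_unitary_one by blast
    qed
  next
    case (step s)
    have sl: "s < n2" "s < n3" "s < p" "s < q" "s < m2" using step.hyps by (auto simp: m1_def m2_def)
    obtain l R1 R2 h g' where l: "l \<in> supp_unitary n {Suc s..<n - s} (\<lambda>x. x \<le> n2)"
      and h: "h \<in> supp_unitary n {s..<n - s} (\<lambda>x. x < p)" and g': "g' \<in> sub_unitary n {Suc s..<n - Suc s}"
      and R1: "R1 \<in> torus n \<sigma>1 {Suc s}" and R2: "R2 \<in> torus n \<sigma>2 {s}" and e: "g = l * R1 * g' * R2 * h"
      by (rule unitary_line_block_step[OF n sl(1-4) step.prems, folded \<sigma>1_def \<sigma>2_def])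
    obtain l' t1 t2 h' where l': "l' \<in> supp_unitary n {Suc (Suc s)..<n - Suc s} (\<lambda>x. x \<le> n2)"
      and t1: "t1 \<in> torus n \<sigma>1 {Suc (Suc s)..m1}" and t2: "t2 \<in> torus n \<sigma>2 {Suc s..<m2}"
      and h': "h' \<in> supp_unitary n {Suc s..<n - Suc s} (\<lambda>x. x < p)" and e': "g' = l' * t1 * t2 * h'"
      using step.IH[OF g'] by blast
    have R1s: "R1 \<in> sub_unitary n {Suc s, n - Suc s}"
      by (rule torus_sub_unitary[OF inv(1) R1]) (auto simp: \<sigma>1_def)
    have R2s: "R2 \<in> sub_unitary n {s, n - Suc s}"
      by (rule torus_sub_unitary[OF inv(2) R2]) (auto simp: \<sigma>2_def)
    have cR1: "R1 * l' = l' * R1"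
      by (rule supp_unitary_commute[OF R1s l']) auto
    have cR2: "h' * R2 = R2 * h'"
      by (rule supp_unitary_commute[OF h' R2s]) auto
    have tc: "t1 \<in> carrier_mat n n" "t2 \<in> carrier_mat n n" using t1 t2 by (auto simp: torus_def)
    note c = supp_unitary_carrier[OF l] supp_unitary_carrier[OF h] supp_unitary_carrier[OF l']
      supp_unitary_carrier[OF h'] supp_unitary_carrier[OF R1s] supp_unitary_carrier[OF R2s] tc
    \<comment> \<open>\<open>R1\<close> stands to the left of the remainder and \<open>R2\<close> to
      its right, so the two tori never have to pass each other; only block factors move.\<close>
    have "g = l * (R1 * l') * (t1 * (t2 * (h' * R2) * h))"
      unfolding e e' using c by (simp add: sq_mult_assoc[of _ n])
    also have "\<dots> = (l * l') * (R1 * t1) * (t2 * R2) * (h' * h)"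
      unfolding cR1 cR2 using c by (simp add: sq_mult_assoc[of _ n])
    finally have g: "g = (l * l') * (R1 * t1) * (t2 * R2) * (h' * h)" .
    have "R1 * t1 \<in> torus n \<sigma>1 {Suc s..m1}"
      by (rule torus_mult[OF inv(1) R1 t1]) (use step.hyps in auto)
    moreover have "t2 * R2 \<in> torus n \<sigma>2 {s..<m2}"
      by (rule torus_mult[OF inv(2) t2 R2]) (use sl in auto)
    moreover have "l * l' \<in> supp_unitary n {Suc s..<n - s} (\<lambda>x. x \<le> n2)"
      by (intro supp_unitary_mult l supp_unitary_subset[OF l']) auto
    moreover have "h' * h \<in> supp_unitary n {s..<n - s} (\<lambda>x. x < p)"
      by (intro supp_unitary_mult h supp_unitary_subset[OF h']) auto
    ultimately show ?case using g by blast
  qed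
qed

section \<open>Subspaces of dimension two\<close>

lemma supp_unitary_split:
  assumes A: "A \<in> supp_unitary n I P" and I: "I \<subseteq> {..<n}"
  obtains B C where "B \<in> sub_unitary n {i \<in> I. P i}" "C \<in> sub_unitary n {i \<in> I. \<not> P i}" "A = B * C"
proof -
  define V where "V = {i \<in> I. P i}"
  have V: "V \<subseteq> {..<n}" using I by (auto simp: V_def)
  note Ac = supp_unitary_carrier[OF A] and Au = supp_unitary_unitary[OF A]
  have z: "A $$ (i,j) = 0" if "i < n" "j < n" "(i \<in> V) \<noteq> (j \<in> V)" for i j
  proof (cases "i \<in> I \<and> j \<in> I")
    case True
    then have "P i \<noteq> P j" using that by (auto simp: V_def)
    then show ?thesis using supp_unitary_label[OF A that(1,2)] by simp
  next
    case False
    then show ?thesis using supp_unitary_outside[OF A that(1,2)] that(3) by auto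
  qed
  define B where "B = mat n n (\<lambda>(i,j). if i \<in> V then A $$ (i,j) else if i = j then 1 else 0)"
  have Bc: "B \<in> carrier_mat n n" by (simp add: B_def)
  have Be: "B $$ (i,j) = (if i \<in> V then A $$ (i,j) else if i = j then 1 else 0)" if "i < n" "j < n" for i j
    using that by (simp add: B_def)
  have Bu: "B \<in> unitary_group n"
  proof (rule unitary_rowsI[OF Bc])
    fix i j assume ij: "i < n" "j < n"
    show "(\<Sum>k<n. B $$ (i,k) * cnj (B $$ (j,k))) = (if i = j then 1 else 0)"
    proof (cases "i \<in> V")
      case True
      note i = this
      show ?thesis
      proof (cases "j \<in> V")
        case True
        then have "(\<Sum>k<n. B $$ (i,k) * cnj (B $$ (j,k))) = (\<Sum>k<n. A $$ (i,k) * cnj (A $$ (j,k)))"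
          using i ij by (intro sum.cong) (auto simp: Be)
        then show ?thesis using unitary_rows[OF Au ij] by simp
      next
        case False
        then have "(\<Sum>k<n. B $$ (i,k) * cnj (B $$ (j,k))) = B $$ (i,j)"
          using ij by (intro sum_delta_right) (auto simp: Be)
        then show ?thesis using i False ij z[OF ij] by (auto simp: Be)
      qed
    next
      case False
      then have "(\<Sum>k<n. B $$ (i,k) * cnj (B $$ (j,k))) = cnj (B $$ (j,i))"
        using ij by (intro sum_delta_left) (auto simp: Be)
      then show ?thesis using False ij z[OF ij(2,1)] by (auto simp: Be)
    qed
  qed
  have B: "B \<in> sub_unitary n V"
    by (rule supp_unitaryI[OF Bu]) (auto simp: Be z)
  \<comment> \<open>Taking \<open>C\<close> as a quotient gives unitarity at once; only its entries
    remain to be computed.\<close>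
  define C where "C = mat_adj B * A"
  have Cu: "C \<in> unitary_group n" unfolding C_def by (intro unitary_mult unitary_adj Bu Au)
  have Ce: "C $$ (i,j) = (if i \<in> V then (if i = j then 1 else 0) else A $$ (i,j))"
    if ij: "i < n" "j < n" for i j
  proof -
    have e: "C $$ (i,j) = (if i \<in> V then \<Sum>k\<in>V. mat_adj B $$ (i,k) * A $$ (k,j) else A $$ (i,j))"
      unfolding C_def by (rule sub_unitary_mult_entry[OF supp_unitary_adj[OF B] Ac V ij])
    have "(\<Sum>k\<in>V. mat_adj B $$ (i,k) * A $$ (k,j)) = (if i = j then 1 else 0)" if "i \<in> V"
    proof -
      have "(\<Sum>k\<in>V. mat_adj B $$ (i,k) * A $$ (k,j)) = (\<Sum>k\<in>V. cnj (A $$ (k,i)) * A $$ (k,j))"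
        using V ij Bc by (intro sum.cong) (auto simp: mat_adj_entry[of _ n] Be subset_eq)
      also have "\<dots> = (\<Sum>k<n. cnj (A $$ (k,i)) * A $$ (k,j))"
        using V ij that z by (intro sum.mono_neutral_left) auto
      finally show ?thesis using unitary_cols[OF Au ij] by simp
    qed
    then show ?thesis using e by simp
  qed
  have C: "C \<in> sub_unitary n {i \<in> I. \<not> P i}"
  proof (rule supp_unitaryI[OF Cu])
    fix i j assume ij: "i < n" "j < n" and o: "i \<notin> {i \<in> I. \<not> P i} \<or> j \<notin> {i \<in> I. \<not> P i}"
    consider "i \<in> V" | "i \<notin> V" "j \<in> V" | "i \<notin> V" "j \<notin> V" "i \<notin> I \<or> j \<notin> I" using o by (auto simp: V_def)
    then show "C $$ (i,j) = (if i = j then 1 else 0)"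
    proof cases
      case 1 then show ?thesis using Ce[OF ij] by simp
    next
      case 2 then show ?thesis using Ce[OF ij] z[OF ij] by auto
    next
      case 3 then show ?thesis using Ce[OF ij] supp_unitary_outside[OF A ij] by simp
    qed
  qed simp
  have "A = B * C" unfolding C_def using Ac Bc Bu by (simp flip: sq_mult_assoc[of _ n])
  then show thesis using that B C unfolding V_def by blast
qed

lemma supp_unitary_diag:
  "A \<in> supp_unitary n I id \<Longrightarrow> I \<subseteq> J \<Longrightarrow> A \<in> supp_unitary n J \<beta>"
  by (erule supp_unitary_mono) auto

text \<open>A phase on one coordinate of a rotation plane can be traded for a phase on the other
  coordinate, up to a phase on the whole plane, which commutes with the rotations.\<close>

lemma phase_rot_exchange:
  assumes inv: "involutive_below n \<sigma>" and b: "b < n" "\<sigma> b \<noteq> b" and d: "d \<in> sub_unitary n {b}"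
  obtains d' d'' where "d' \<in> sub_unitary n {\<sigma> b}" "d'' \<in> supp_unitary n {b, \<sigma> b} id"
    "\<And>\<tau>. odd_angle n \<sigma> \<tau> \<Longrightarrow> d * rot n \<sigma> \<tau> = d' * rot n \<sigma> \<tau> * d''"
    "\<And>\<tau>. odd_angle n \<sigma> \<tau> \<Longrightarrow> rot n \<sigma> \<tau> * d = d'' * rot n \<sigma> \<tau> * d'"
proof -
  define ph where "ph S z = mat n n (\<lambda>(i,j). if i = j then (if i \<in> S then z else 1) else 0)"
    for S and z :: complex
  have phc: "ph S z \<in> carrier_mat n n" for S z by (simp add: ph_def)
  have phe: "ph S z $$ (i,j) = (if i = j then (if i \<in> S then z else 1) else 0)" if "i < n" "j < n" for S z i j
    using that by (simp add: ph_def)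
  have L: "(ph S z * A) $$ (i,j) = (if i \<in> S then z else 1) * A $$ (i,j)"
    if "A \<in> carrier_mat n n" "i < n" "j < n" for S z A i j
  proof -
    have "(ph S z * A) $$ (i,j) = (\<Sum>k<n. ph S z $$ (i,k) * A $$ (k,j))"
      using that phc by (intro mat_mult_entry) auto
    also have "\<dots> = (\<Sum>k<n. if k = i then (if i \<in> S then z else 1) * A $$ (i,j) else 0)"
      using that by (intro sum.cong) (auto simp: phe)
    finally show ?thesis using that by simp
  qed
  have Rr: "(A * ph S z) $$ (i,j) = A $$ (i,j) * (if j \<in> S then z else 1)"
    if "A \<in> carrier_mat n n" "i < n" "j < n" for S z A i j
  proof -
    have "(A * ph S z) $$ (i,j) = (\<Sum>k<n. A $$ (i,k) * ph S z $$ (k,j))"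
      using that phc by (intro mat_mult_entry) auto
    also have "\<dots> = (\<Sum>k<n. if k = j then A $$ (i,j) * (if j \<in> S then z else 1) else 0)"
      using that by (intro sum.cong) (auto simp: phe)
    finally show ?thesis using that by simp
  qed
  have phu: "ph S z \<in> supp_unitary n S id" if "z * cnj z = 1" for S z
  proof (rule supp_unitaryI)
    show "ph S z \<in> unitary_group n"
    proof (rule unitary_rowsI[OF phc])
      fix i j assume ij: "i < n" "j < n"
      have "(\<Sum>k<n. ph S z $$ (i,k) * cnj (ph S z $$ (j,k))) =
        (\<Sum>k<n. if k = i then (if i = j then 1 else 0) else 0)"
        using ij that by (intro sum.cong) (auto simp: phe)
      then show "(\<Sum>k<n. ph S z $$ (i,k) * cnj (ph S z $$ (j,k))) = (if i = j then 1 else 0)"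
        using ij by simp
    qed
  qed (auto simp: phe)
  define z where "z = d $$ (b,b)"
  note dc = supp_unitary_carrier[OF d]
  have bn: "{b} \<subseteq> {..<n}" using b by simp
  have z1: "z * cnj z = 1"
    using sub_unitary_row_norm[OF d bn] by (simp add: z_def complex_norm_square[symmetric])
  have z2: "cnj z * cnj (cnj z) = 1" using z1 by (simp add: mult.commute)
  \<comment> \<open>A phase \<open>z\<close> at \<open>b\<close> equals \<open>cnj z\<close> at the
    partner times \<open>z\<close> on both coordinates, and the last factor is scalar on the
    plane.\<close>
  define d' where "d' = ph {\<sigma> b} (cnj z)"
  define d'' where "d'' = ph {b, \<sigma> b} z"
  have d1: "d' \<in> sub_unitary n {\<sigma> b}" unfolding d'_def by (rule supp_unitary_sub[OF phu[OF z2] subset_refl])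
  have d2: "d'' \<in> supp_unitary n {b, \<sigma> b} id" unfolding d''_def by (rule phu[OF z1])
  have de: "d $$ (i,j) = (if i = j then if i = b then z else 1 else 0)" if "i < n" "j < n" for i j
    using supp_unitary_outside[OF d that] by (auto simp: z_def)
  have eqI: "M = N" if "M \<in> carrier_mat n n" "N \<in> carrier_mat n n"
    "\<And>i j. i < n \<Longrightarrow> j < n \<Longrightarrow> M $$ (i,j) = N $$ (i,j)" for M N :: "complex mat"
    using that by (intro eq_matI) auto
  have dd: "d = d' * d''"
    unfolding d'_def d''_def
  proof (rule eqI)
    fix i j assume ij: "i < n" "j < n"
    show "d $$ (i,j) = (ph {\<sigma> b} (cnj z) * ph {b, \<sigma> b} z) $$ (i,j)"
      using b z1 unfolding L[OF phc ij] phe[OF ij] de[OF ij] by (auto simp: mult.commute)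
  qed (use dc phc in auto)
  have dd2: "d = d'' * d'"
    unfolding d'_def d''_def
  proof (rule eqI)
    fix i j assume ij: "i < n" "j < n"
    show "d $$ (i,j) = (ph {b, \<sigma> b} z * ph {\<sigma> b} (cnj z)) $$ (i,j)"
      using b z1 unfolding L[OF phc ij] phe[OF ij] de[OF ij] by (auto simp: mult.commute)
  qed (use dc phc in auto)
  have com: "d'' * rot n \<sigma> \<tau> = rot n \<sigma> \<tau> * d''" for \<tau>
  proof (rule eq_matI)
    fix i j assume "i < dim_row (rot n \<sigma> \<tau> * d'')" "j < dim_col (rot n \<sigma> \<tau> * d'')"
    then have ij: "i < n" "j < n" using supp_unitary_carrier[OF d2] by (auto simp: rot_def)
    have "\<sigma> i \<in> {b, \<sigma> b} \<longleftrightarrow> i \<in> {b, \<sigma> b}" using inv ij b unfolding involutive_below_def by (metis insert_iff singletonD)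
    then show "(d'' * rot n \<sigma> \<tau>) $$ (i,j) = (rot n \<sigma> \<tau> * d'') $$ (i,j)"
      unfolding d''_def L[OF rot_carrier ij] Rr[OF rot_carrier ij] rot_entry[OF ij] by auto
  qed (use supp_unitary_carrier[OF d2] in \<open>auto simp: rot_def\<close>)
  note c = supp_unitary_carrier[OF d1] supp_unitary_carrier[OF d2]
  show thesis
  proof (rule that[OF d1 d2])
    fix \<tau>
    have "d * rot n \<sigma> \<tau> = d' * (d'' * rot n \<sigma> \<tau>)" unfolding dd using c by (simp add: sq_mult_assoc[of _ n])
    also have "\<dots> = d' * rot n \<sigma> \<tau> * d''" unfolding com using c by (simp add: sq_mult_assoc[of _ n])
    finally show "d * rot n \<sigma> \<tau> = d' * rot n \<sigma> \<tau> * d''" .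
    have "rot n \<sigma> \<tau> * d = (rot n \<sigma> \<tau> * d'') * d'" unfolding dd2 using c by (simp add: sq_mult_assoc[of _ n])
    then show "rot n \<sigma> \<tau> * d = d'' * rot n \<sigma> \<tau> * d'" unfolding com .
  qed
qed

lemma sub_unitary_empty: "A \<in> sub_unitary n {} \<Longrightarrow> A = 1\<^sub>m n"
  by (rule eq_matI) (auto dest: supp_unitary_carrier simp: supp_unitary_outside)

text \<open>In the applications \<open>e0\<close>, \<open>e1\<close> span the two-dimensional part
  of the right group, \<open>f0\<close>, \<open>f1\<close> are their partners under
  \<open>\<sigma>3\<close>, and \<open>g0\<close>, \<open>g1\<close> are the partners of these under
  \<open>\<sigma>1\<close>. The unitary \<open>y\<close> on \<open>f0\<close>, \<open>f1\<close> is
  a rotation with one phase on its left and two on its right. The left phase crosses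
  \<open>t1\<close>, reappears at \<open>g1\<close>, commutes with the rotation and with
  \<open>t3\<close>, and joins \<open>h\<close>. The right phases cross \<open>t3\<close>, reappear
  at \<open>e0\<close> and \<open>e1\<close>, commute with the rotation and with \<open>t1\<close>,
  and join \<open>l\<close>. The phases on whole planes left behind by these crossings are diagonal
  and already outside.\<close>

lemma three_block_assemble:
  fixes e0 e1 f0 f1 g0 g1 n :: nat
  assumes inv: "involutive_below n \<sigma>1" "involutive_below n \<sigma>2" "involutive_below n \<sigma>3"
    and dist: "distinct [e0,e1,f0,f1,g0,g1]"
    and less: "e0 < n" "e1 < n" "f0 < n" "f1 < n" "g0 < n" "g1 < n"
    and sig: "\<sigma>3 f0 = e0" "\<sigma>3 f1 = e1" "\<sigma>1 f0 = g0" "\<sigma>1 f1 = g1" "\<sigma>2 f0 = f1"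
    and A: "A1 \<subseteq> {f0,f1,g0,g1}" "A3 \<subseteq> {e0,e1,f0,f1}"
    and Z: "Z \<inter> {e0,e1,f0,f1} = {}" "g0 \<in> Z" "g1 \<in> Z" "Z \<subseteq> {..<n}" "\<And>i. i \<in> Z \<Longrightarrow> \<gamma> i = c"
    and g: "g = l * t1 * (y * z) * t3 * h"
    and l: "l \<in> supp_unitary n {..<n} \<beta>" and h: "h \<in> supp_unitary n {..<n} \<gamma>"
    and t1: "t1 \<in> torus n \<sigma>1 A1" and t3: "t3 \<in> torus n \<sigma>3 A3"
    and y: "y \<in> sub_unitary n {f0,f1}" and z: "z \<in> sub_unitary n Z"
  shows "\<exists>l \<in> supp_unitary n {..<n} \<beta>. \<exists>t1 \<in> torus n \<sigma>1 A1. \<exists>t2 \<in> torus n \<sigma>2 {f0}.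
    \<exists>t3 \<in> torus n \<sigma>3 A3. \<exists>h \<in> supp_unitary n {..<n} \<gamma>. g = l * t1 * t2 * t3 * h"
proof -
  have inv': "\<sigma>3 e0 = f0" "\<sigma>3 e1 = f1" "\<sigma>1 g0 = f0" "\<sigma>1 g1 = f1"
    using inv sig less unfolding involutive_below_def by metis+
  have f12: "\<sigma>2 f0 \<noteq> f0" "{f0,f1} \<subseteq> {..<n}" "{f0,f1} - {f0,\<sigma>2 f0} = {}" using sig dist less by auto
  have rows: "y $$ (r,j) = 0" if "r \<in> {f0,\<sigma>2 f0}" "j < n" "j \<notin> {f0,\<sigma>2 f0}" for r j
    using supp_unitary_outside[OF y, of r j] that less sig by auto
  obtain u h0 h1 \<theta> y' where u: "u \<in> sub_unitary n {\<sigma>2 f0}" and h0: "h0 \<in> sub_unitary n {f0}"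
    and h1: "h1 \<in> sub_unitary n {\<sigma>2 f0}" and y': "y' \<in> sub_unitary n ({f0,f1} - {f0,\<sigma>2 f0})"
    and ye: "y = u * rot n \<sigma>2 (plane_angle \<sigma>2 f0 \<theta>) * y' * (h1 * h0)"
    by (rule split_rot_of_plane[OF inv(2) y f12(2) _ _ f12(1) rows]) (use sig in auto)
  define R where "R = rot n \<sigma>2 (plane_angle \<sigma>2 f0 \<theta>)"
  have R: "R \<in> torus n \<sigma>2 {f0}" "R \<in> sub_unitary n {f0,f1}"
    unfolding R_def using f12 less inv sig by (auto intro!: plane_in_torus rot_plane_sub_unitary)
  have y1: "y' = 1\<^sub>m n" using y' unfolding f12(3) by (rule sub_unitary_empty)
  note u' = u[unfolded sig] and h1' = h1[unfolded sig]
  obtain \<tau>1 where \<tau>1: "t1 = rot n \<sigma>1 \<tau>1" "odd_angle n \<sigma>1 \<tau>1" using t1 by (auto simp: torus_def)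
  obtain \<tau>3 where \<tau>3: "t3 = rot n \<sigma>3 \<tau>3" "odd_angle n \<sigma>3 \<tau>3" using t3 by (auto simp: torus_def)
  have t1s: "t1 \<in> sub_unitary n {f0,f1,g0,g1}"
    by (rule torus_sub_unitary[OF inv(1) t1]) (use A(1) sig inv' in auto)
  have t3s: "t3 \<in> sub_unitary n {e0,e1,f0,f1}"
    by (rule torus_sub_unitary[OF inv(3) t3]) (use A(2) sig inv' in auto)
  have ne: "\<sigma>1 f1 \<noteq> f1" "\<sigma>3 f0 \<noteq> f0" "\<sigma>3 f1 \<noteq> f1" using sig dist by auto
  obtain a' a'' where a': "a' \<in> sub_unitary n {\<sigma>1 f1}" and a'': "a'' \<in> supp_unitary n {f1, \<sigma>1 f1} id"
    and ae: "t1 * u = a'' * t1 * a'"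
    using phase_rot_exchange[OF inv(1) less(4) ne(1) u'] \<tau>1 by metis
  obtain b' b'' where b': "b' \<in> sub_unitary n {\<sigma>3 f0}" and b'': "b'' \<in> supp_unitary n {f0, \<sigma>3 f0} id"
    and be: "h0 * t3 = b' * t3 * b''"
    using phase_rot_exchange[OF inv(3) less(3) ne(2) h0] \<tau>3 by metis
  obtain c' c'' where c': "c' \<in> sub_unitary n {\<sigma>3 f1}" and c'': "c'' \<in> supp_unitary n {f1, \<sigma>3 f1} id"
    and ce: "h1 * t3 = c' * t3 * c''"
    using phase_rot_exchange[OF inv(3) less(4) ne(3) h1'] \<tau>3 by metis
  note car [simp] = supp_unitary_carrier[OF u] supp_unitary_carrier[OF h0] supp_unitary_carrier[OF h1]
    supp_unitary_carrier[OF R(2)] supp_unitary_carrier[OF t1s] supp_unitary_carrier[OF t3s]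
    supp_unitary_carrier[OF a'] supp_unitary_carrier[OF a''] supp_unitary_carrier[OF b'] supp_unitary_carrier[OF b'']
    supp_unitary_carrier[OF c'] supp_unitary_carrier[OF c''] supp_unitary_carrier[OF l] supp_unitary_carrier[OF h]
    supp_unitary_carrier[OF z]
  note asc = sq_mult_assoc[of _ n]
  define E where "E = b' * c'"
  have E: "E \<in> sub_unitary n {e0,e1}"
    unfolding E_def using b' c' sig by (intro supp_unitary_mult) (auto elim: supp_unitary_sub)
  note Ec [simp] = supp_unitary_carrier[OF E]
  have zt: "z * t3 = t3 * z" by (rule supp_unitary_commute[OF z t3s Z(1)])
  have hb: "h1 * b' = b' * h1" by (rule supp_unitary_commute[OF h1 b']) (use sig dist in auto)
  have ER: "R * E = E * R" by (rule supp_unitary_commute[OF R(2) E]) (use dist in auto)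
  have Et: "t1 * E = E * t1" by (rule supp_unitary_commute[OF t1s E]) (use dist in auto)
  have aR: "a' * R = R * a'" by (rule supp_unitary_commute[OF a' R(2)]) (use sig dist in auto)
  have aE: "a' * E = E * a'" by (rule supp_unitary_commute[OF a' E]) (use sig dist in auto)
  have at: "a' * t3 = t3 * a'" by (rule supp_unitary_commute[OF a' t3s]) (use sig dist in auto)
  \<comment> \<open>The phase at \<open>f0\<close> crosses \<open>t3\<close> first; what it becomes
    at \<open>e0\<close> commutes with the phase at \<open>f1\<close>, which then crosses in the
    same way.\<close>
  have hht: "h1 * h0 * t3 = E * t3 * (c'' * b'')"
  proof -
    have "h1 * h0 * t3 = (h1 * b') * t3 * b''" using be by (simp add: asc)
    also have "\<dots> = b' * (h1 * t3) * b''" unfolding hb by (simp add: asc)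
    also have "\<dots> = E * t3 * (c'' * b'')" unfolding ce E_def by (simp add: asc)
    finally show ?thesis .
  qed
  have "y * z * t3 = u * R * (h1 * h0 * t3) * z"
    unfolding ye y1 R_def[symmetric] using zt by (simp add: asc)
  also have "\<dots> = u * (R * E) * t3 * (c'' * b'' * z)" unfolding hht by (simp add: asc)
  also have "\<dots> = u * E * (R * t3 * (c'' * b'' * z))" unfolding ER by (simp add: asc)
  finally have yz: "y * z * t3 = u * E * (R * t3 * (c'' * b'' * z))" .
  have yc: "y \<in> carrier_mat n n" using y by simp
  have "g = l * t1 * (y * z * t3) * h" unfolding g using yc by (simp add: asc)
  also have "\<dots> = l * (t1 * u) * E * R * t3 * (c'' * b'' * z * h)" unfolding yz by (simp add: asc)
  also have "\<dots> = l * a'' * t1 * (a' * E) * R * t3 * (c'' * b'' * z * h)" unfolding ae by (simp add: asc)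
  also have "\<dots> = l * a'' * (t1 * E) * (a' * R) * t3 * (c'' * b'' * z * h)" unfolding aE by (simp add: asc)
  also have "\<dots> = (l * a'' * E) * t1 * R * (a' * t3) * (c'' * b'' * z * h)" unfolding Et aR by (simp add: asc)
  also have "\<dots> = (l * a'' * E) * t1 * R * t3 * (a' * (c'' * b'' * z * h))" unfolding at by (simp add: asc)
  finally have ge: "g = (l * a'' * E) * t1 * R * t3 * (a' * (c'' * b'' * z * h))" .
  have diag: "d \<in> supp_unitary n {..<n} \<delta>" if "d \<in> sub_unitary n {k}" "k < n"
    for d k and \<delta> :: "nat \<Rightarrow> 'z"
    using sub_unitary_supp[OF that(1), of "{..<n}" \<delta> "\<delta> k"] that(2) by auto
  \<comment> \<open>Diagonal matrices belong to the block group of every labelling.\<close>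
  have dg: "a'' \<in> supp_unitary n {..<n} \<beta>" "b'' \<in> supp_unitary n {..<n} \<gamma>" "c'' \<in> supp_unitary n {..<n} \<gamma>"
    using a'' b'' c'' less sig by (auto elim!: supp_unitary_diag)
  have "E \<in> supp_unitary n {..<n} \<beta>" unfolding E_def
    using b' c' sig less by (intro supp_unitary_mult) (auto elim: diag)
  then have "l * a'' * E \<in> supp_unitary n {..<n} \<beta>" using l dg by (intro supp_unitary_mult)
  moreover have "a' \<in> supp_unitary n {..<n} \<gamma>" using a' sig less by (auto elim: diag)
  moreover have "z \<in> supp_unitary n {..<n} \<gamma>" by (rule sub_unitary_supp[OF z Z(4,5)])
  ultimately have "l * a'' * E \<in> supp_unitary n {..<n} \<beta>"
    "a' * (c'' * b'' * z * h) \<in> supp_unitary n {..<n} \<gamma>"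
    using dg h by (auto intro!: supp_unitary_mult)
  then show ?thesis using ge t1 t3 R(1) by blast
qed

section \<open>Three blocks against a two-dimensional first or last part\<close>

lemma unitary_iff_sub_unitary: "unitary_group n = sub_unitary n {..<n}"
  unfolding supp_unitary_def by auto

abbreviation swap_idx :: "nat \<Rightarrow> nat \<Rightarrow> nat \<Rightarrow> nat" where
  "swap_idx a b \<equiv> (\<lambda>x. if x = a then b else if x = b then a else x)"

lemma involutive_below_swap: "a < n \<Longrightarrow> b < n \<Longrightarrow> involutive_below n (swap_idx a b)"
  by (auto simp: involutive_below_def)

lemma involutive_below_interval:
  "hi \<le> n \<Longrightarrow> involutive_below n (\<lambda>x. if lo \<le> x \<and> x < hi then lo + hi - 1 - x else x)"
  by (auto simp: involutive_below_def)

definition three_label :: "nat \<Rightarrow> nat \<Rightarrow> nat \<Rightarrow> nat" where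
  "three_label a b x = (if x < a then 0 else if x < a + b then 1 else 2)"

text \<open>The inner application of the two-block result cuts on the right at \<open>n - 2\<close>
  because \<open>t3\<close> moves only \<open>0\<close>, \<open>1\<close>, \<open>n - 2\<close> and
  \<open>n - 1\<close>. The factor on \<open>{n1..<n - 2}\<close> then passes \<open>t3\<close> and
  lies in the right group, so only a unitary on the last two coordinates remains between the
  tori.\<close>

lemma unitary_three_block_decomp_p2:
  fixes n n1 n2 n3 :: nat
  defines "\<sigma>1 \<equiv> (\<lambda>x. if n1 \<le> x \<and> x < n then n1 + n - 1 - x else x)" and "\<sigma>3 \<equiv> (\<lambda>x. n - 1 - x)"
  assumes n: "n = n1 + n2 + n3" and ge: "n1 \<ge> 2" "n2 \<ge> 2" "n3 \<ge> 2" and g: "g \<in> unitary_group n"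
  shows "\<exists>l \<in> supp_unitary n {..<n} (three_label n1 n2). \<exists>t1 \<in> torus n \<sigma>1 {n1..<n1 + 2}.
    \<exists>t2 \<in> torus n (swap_idx (n - 1) (n - 2)) {n - 1}. \<exists>t3 \<in> torus n \<sigma>3 {0..<2}.
    \<exists>h \<in> supp_unitary n {..<n} (\<lambda>x. x < 2). g = l * t1 * t2 * t3 * h"
proof -
  have inv: "involutive_below n \<sigma>1" "involutive_below n \<sigma>3" "involutive_below n (swap_idx (n - 1) (n - 2))"
    unfolding \<sigma>1_def \<sigma>3_def
    by (rule involutive_below_interval involutive_below_reflect involutive_below_swap; use n ge in linarith)+
  have g0: "g \<in> sub_unitary n {0..<n}" using g unfolding unitary_iff_sub_unitary by (simp add: atLeast0LessThan)
  have "\<exists>l \<in> supp_unitary n {0..<n} (\<lambda>x. x < n1). \<exists>h \<in> supp_unitary n {0..<n} (\<lambda>x. x < 2).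
    \<exists>t \<in> torus n \<sigma>3 {0..<0 + 2}. g = l * t * h"
    by (rule unitary_two_block_decomp[OF inv(2)]) (use g0 n ge in \<open>auto simp: \<sigma>3_def\<close>)
  then obtain l h t3 where l: "l \<in> supp_unitary n {0..<n} (\<lambda>x. x < n1)" and h: "h \<in> supp_unitary n {0..<n} (\<lambda>x. x < 2)"
    and t3: "t3 \<in> torus n \<sigma>3 {0..<0 + 2}" and e: "g = l * t3 * h" by blast
  have sub: "{0..<n} \<subseteq> {..<n}" "{n1..<n} \<subseteq> {..<n}" by auto
  obtain B C where B: "B \<in> sub_unitary n {i \<in> {0..<n}. i < n1}" and C: "C \<in> sub_unitary n {i \<in> {0..<n}. \<not> i < n1}"
    and lBC: "l = B * C" by (rule supp_unitary_split[OF l sub(1)])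
  have C': "C \<in> sub_unitary n {n1..<n}" by (rule supp_unitary_sub[OF C]) auto
  have "\<exists>l \<in> supp_unitary n {n1..<n} (\<lambda>x. x < n1 + n2). \<exists>h \<in> supp_unitary n {n1..<n} (\<lambda>x. x < n - 2).
    \<exists>t \<in> torus n \<sigma>1 {n1..<n1 + 2}. C = l * t * h"
    by (rule unitary_two_block_decomp[OF inv(1)]) (use C' n ge in \<open>auto simp: \<sigma>1_def\<close>)
  then obtain l' h' t1 where l': "l' \<in> supp_unitary n {n1..<n} (\<lambda>x. x < n1 + n2)"
    and h': "h' \<in> supp_unitary n {n1..<n} (\<lambda>x. x < n - 2)"
    and t1: "t1 \<in> torus n \<sigma>1 {n1..<n1 + 2}" and Ce: "C = l' * t1 * h'" by blast
  obtain z y where z: "z \<in> sub_unitary n {i \<in> {n1..<n}. i < n - 2}" and y: "y \<in> sub_unitary n {i \<in> {n1..<n}. \<not> i < n - 2}"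
    and hzy: "h' = z * y" by (rule supp_unitary_split[OF h' sub(2)])
  have z': "z \<in> sub_unitary n {n1..<n - 2}" by (rule supp_unitary_sub[OF z]) auto
  have y': "y \<in> sub_unitary n {n - 1, n - 2}" by (rule supp_unitary_sub[OF y]) auto
  have "z * y = y * z" by (rule supp_unitary_commute[OF z y]) auto
  moreover have tc: "t1 \<in> carrier_mat n n" "t3 \<in> carrier_mat n n" using t1 t3 by (auto simp: torus_def)
  ultimately have ge': "g = (B * l') * t1 * (y * z) * t3 * h"
    unfolding e lBC Ce hzy
    using supp_unitary_carrier[OF B] supp_unitary_carrier[OF l'] supp_unitary_carrier[OF y]
      supp_unitary_carrier[OF z] supp_unitary_carrier[OF h] by (simp add: sq_mult_assoc[of _ n])
  have L: "B * l' \<in> supp_unitary n {..<n} (three_label n1 n2)"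
  proof (rule supp_unitary_mult)
    show "B \<in> supp_unitary n {..<n} (three_label n1 n2)"
      by (rule sub_unitary_supp[OF B]) (auto simp: three_label_def)
    show "l' \<in> supp_unitary n {..<n} (three_label n1 n2)"
      by (rule supp_unitary_mono[OF l']) (auto simp: three_label_def)
  qed
  have t3': "t3 \<in> torus n \<sigma>3 {0..<2}" using t3 by (simp only: add_0)
  have h2: "h \<in> supp_unitary n {..<n} (\<lambda>x. x < 2)" by (rule supp_unitary_subset[OF h]) auto
  show ?thesis
    by (rule three_block_assemble[OF inv(1,3,2), where ?e0.0 = 0 and ?e1.0 = 1 and ?f0.0 = "n - 1" and ?f1.0 = "n - 2"
          and ?g0.0 = n1 and ?g1.0 = "n1 + 1" and Z = "{n1..<n - 2}" and c = False and \<gamma> = "\<lambda>x. x < 2",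
          OF _ _ _ _ _ _ _ _ _ _ _ _ _ _ _ _ _ _ _ ge' L h2 t1 t3' y' z'])
       (use n ge in \<open>auto simp: \<sigma>1_def \<sigma>3_def\<close>)
qed

text \<open>Mirror image of the preceding case under reversal of the coordinates: the first two
  blocks are merged and the inner cut is at \<open>2\<close>. The literal zeros in
  \<open>\<sigma>1\<close> match the general interval reversal with lower end
  \<open>0\<close>.\<close>

lemma unitary_three_block_decomp_q2:
  fixes n n1 n2 n3 :: nat
  defines "\<sigma>1 \<equiv> (\<lambda>x. if 0 \<le> x \<and> x < n1 + n2 then 0 + (n1 + n2) - 1 - x else x)" and "\<sigma>3 \<equiv> (\<lambda>x. n - 1 - x)"
  assumes n: "n = n1 + n2 + n3" and ge: "n1 \<ge> 2" "n2 \<ge> 2" "n3 \<ge> 2" and g: "g \<in> unitary_group n"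
  shows "\<exists>l \<in> supp_unitary n {..<n} (three_label n1 n2). \<exists>t1 \<in> torus n \<sigma>1 {0..<2}.
    \<exists>t2 \<in> torus n (swap_idx 0 1) {0}. \<exists>t3 \<in> torus n \<sigma>3 {0..<2}.
    \<exists>h \<in> supp_unitary n {..<n} (\<lambda>x. x < n - 2). g = l * t1 * t2 * t3 * h"
proof -
  have inv: "involutive_below n \<sigma>1" "involutive_below n \<sigma>3" "involutive_below n (swap_idx 0 1)"
    unfolding \<sigma>1_def \<sigma>3_def
    by (rule involutive_below_interval involutive_below_reflect involutive_below_swap; use n ge in linarith)+
  have g0: "g \<in> sub_unitary n {0..<n}" using g unfolding unitary_iff_sub_unitary by (simp add: atLeast0LessThan)
  have "\<exists>l \<in> supp_unitary n {0..<n} (\<lambda>x. x < n1 + n2). \<exists>h \<in> supp_unitary n {0..<n} (\<lambda>x. x < n - 2).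
    \<exists>t \<in> torus n \<sigma>3 {0..<0 + 2}. g = l * t * h"
    by (rule unitary_two_block_decomp[OF inv(2)]) (use g0 n ge in \<open>auto simp: \<sigma>3_def\<close>)
  then obtain l h t3 where l: "l \<in> supp_unitary n {0..<n} (\<lambda>x. x < n1 + n2)" and h: "h \<in> supp_unitary n {0..<n} (\<lambda>x. x < n - 2)"
    and t3: "t3 \<in> torus n \<sigma>3 {0..<0 + 2}" and e: "g = l * t3 * h" by blast
  have sub: "{0..<n} \<subseteq> {..<n}" "{0..<n1 + n2} \<subseteq> {..<n}" using n by auto
  obtain C B where C: "C \<in> sub_unitary n {i \<in> {0..<n}. i < n1 + n2}" and B: "B \<in> sub_unitary n {i \<in> {0..<n}. \<not> i < n1 + n2}"
    and lCB: "l = C * B" by (rule supp_unitary_split[OF l sub(1)])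
  have lBC: "l = B * C" unfolding lCB by (rule supp_unitary_commute[OF C B]) auto
  have C': "C \<in> sub_unitary n {0..<n1 + n2}" by (rule supp_unitary_sub[OF C]) auto
  have "\<exists>l \<in> supp_unitary n {0..<n1 + n2} (\<lambda>x. x < n1). \<exists>h \<in> supp_unitary n {0..<n1 + n2} (\<lambda>x. x < 2).
    \<exists>t \<in> torus n \<sigma>1 {0..<0 + 2}. C = l * t * h"
    by (rule unitary_two_block_decomp[OF inv(1)]) (use C' n ge in \<open>auto simp: \<sigma>1_def\<close>)
  then obtain l' h' t1 where l': "l' \<in> supp_unitary n {0..<n1 + n2} (\<lambda>x. x < n1)"
    and h': "h' \<in> supp_unitary n {0..<n1 + n2} (\<lambda>x. x < 2)"
    and t1: "t1 \<in> torus n \<sigma>1 {0..<0 + 2}" and Ce: "C = l' * t1 * h'" by blast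
  obtain y z where y: "y \<in> sub_unitary n {i \<in> {0..<n1 + n2}. i < 2}" and z: "z \<in> sub_unitary n {i \<in> {0..<n1 + n2}. \<not> i < 2}"
    and hyz: "h' = y * z" by (rule supp_unitary_split[OF h' sub(2)])
  have z': "z \<in> sub_unitary n {2..<n1 + n2}" by (rule supp_unitary_sub[OF z]) auto
  have y': "y \<in> sub_unitary n {0, 1}" by (rule supp_unitary_sub[OF y]) auto
  have tc: "t1 \<in> carrier_mat n n" "t3 \<in> carrier_mat n n" using t1 t3 by (auto simp: torus_def)
  then have ge': "g = (B * l') * t1 * (y * z) * t3 * h"
    unfolding e lBC Ce hyz
    using supp_unitary_carrier[OF B] supp_unitary_carrier[OF l'] supp_unitary_carrier[OF y]
      supp_unitary_carrier[OF z] supp_unitary_carrier[OF h] by (simp add: sq_mult_assoc[of _ n])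
  have L: "B * l' \<in> supp_unitary n {..<n} (three_label n1 n2)"
  proof (rule supp_unitary_mult)
    show "B \<in> supp_unitary n {..<n} (three_label n1 n2)"
      by (rule sub_unitary_supp[OF B]) (auto simp: three_label_def)
    show "l' \<in> supp_unitary n {..<n} (three_label n1 n2)"
      by (rule supp_unitary_mono[OF l']) (use n in \<open>auto simp: three_label_def\<close>)
  qed
  have t1': "t1 \<in> torus n \<sigma>1 {0..<2}" and t3': "t3 \<in> torus n \<sigma>3 {0..<2}" using t1 t3 by (simp_all only: add_0)
  have h2: "h \<in> supp_unitary n {..<n} (\<lambda>x. x < n - 2)" by (rule supp_unitary_subset[OF h]) auto
  show ?thesis
    by (rule three_block_assemble[OF inv(1,3,2), where ?e0.0 = "n - 1" and ?e1.0 = "n - 2" and ?f0.0 = 0 and ?f1.0 = 1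
          and ?g0.0 = "n1 + n2 - 1" and ?g1.0 = "n1 + n2 - 2" and Z = "{2..<n1 + n2}" and c = True and \<gamma> = "\<lambda>x. x < n - 2",
          OF _ _ _ _ _ _ _ _ _ _ _ _ _ _ _ _ _ _ _ ge' L h2 t1' t3' y' z'])
       (use n ge in \<open>auto simp: \<sigma>1_def \<sigma>3_def\<close>)
qed

section \<open>Lines\<close>

text \<open>The blocks are disjoint, so a Householder matrix can be applied in all of them at once.
  The function \<open>r\<close> names the coordinate of each block at which its norm is
  collected.\<close>

lemma label_householder:
  fixes \<beta> :: "nat \<Rightarrow> 'b" and r :: "'b \<Rightarrow> nat"
  assumes r: "\<And>i. i < n \<Longrightarrow> r (\<beta> i) < n \<and> \<beta> (r (\<beta> i)) = \<beta> i" and g: "g \<in> carrier_mat n n" and z: "z < n"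
  obtains A where "A \<in> supp_unitary n {..<n} \<beta>"
    "\<And>i. i < n \<Longrightarrow> \<exists>x\<ge>0. (A * g) $$ (i,z) = of_real x \<and> (i \<noteq> r (\<beta> i) \<longrightarrow> x = 0)"
proof -
  define blk where "blk b = {k. k < n \<and> \<beta> k = b}" for b
  have "\<exists>A. A \<in> sub_unitary n (blk b) \<and> (\<forall>i\<in>blk b. (A * g) $$ (i,z) =
       (if i = r b then of_real (sqrt (\<Sum>k\<in>blk b. (cmod (g $$ (k,z)))\<^sup>2)) else 0))" if "b \<in> \<beta> ` {..<n}" for b
  proof -
    have "blk b \<subseteq> {..<n}" "r b \<in> blk b" using that r by (auto simp: blk_def)
    from householder_col[OF this g z] show ?thesis by metis
  qed
  then obtain F where F: "\<And>b. b \<in> \<beta> ` {..<n} \<Longrightarrow> F b \<in> sub_unitary n (blk b)"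
    "\<And>b i. b \<in> \<beta> ` {..<n} \<Longrightarrow> i \<in> blk b \<Longrightarrow> (F b * g) $$ (i,z) =
       (if i = r b then of_real (sqrt (\<Sum>k\<in>blk b. (cmod (g $$ (k,z)))\<^sup>2)) else 0)"
    by metis
  \<comment> \<open>Row \<open>i\<close> is taken from the matrix belonging to the block of
    \<open>i\<close>; this gives the block-diagonal matrix without ordering the blocks in a
    product.\<close>
  define A where "A = mat n n (\<lambda>(i,j). F (\<beta> i) $$ (i,j))"
  have Ac: "A \<in> carrier_mat n n" by (simp add: A_def)
  have Ae: "A $$ (i,j) = F (\<beta> i) $$ (i,j)" if "i < n" "j < n" for i j using that by (simp add: A_def)
  have A0: "A $$ (i,j) = 0" if "i < n" "j < n" "\<beta> i \<noteq> \<beta> j" for i j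
    using supp_unitary_outside[OF F(1)[of "\<beta> i"] that(1,2)] that Ae[OF that(1,2)] by (auto simp: blk_def)
  have "A \<in> unitary_group n"
  proof (rule unitary_rowsI[OF Ac])
    fix i j assume ij: "i < n" "j < n"
    show "(\<Sum>k<n. A $$ (i,k) * cnj (A $$ (j,k))) = (if i = j then 1 else 0)"
    proof (cases "\<beta> i = \<beta> j")
      case True
      have "(\<Sum>k<n. A $$ (i,k) * cnj (A $$ (j,k))) = (\<Sum>k<n. F (\<beta> i) $$ (i,k) * cnj (F (\<beta> i) $$ (j,k)))"
        using ij True by (intro sum.cong) (auto simp: Ae)
      then show ?thesis using unitary_rows[OF supp_unitary_unitary[OF F(1)[of "\<beta> i"]] ij] ij by simp
    next
      case False
      have "A $$ (i,k) * cnj (A $$ (j,k)) = 0" if "k < n" for k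
        using A0[OF ij(1) that] A0[OF ij(2) that] False by (cases "\<beta> i = \<beta> k") auto
      then have "(\<Sum>k<n. A $$ (i,k) * cnj (A $$ (j,k))) = 0" by (intro sum.neutral) blast
      then show ?thesis using False by auto
    qed
  qed
  then have A: "A \<in> supp_unitary n {..<n} \<beta>" by (rule supp_unitaryI) (auto simp: A0)
  show thesis
  proof (rule that[OF A])
    fix i assume i: "i < n"
    have "(A * g) $$ (i,z) = (F (\<beta> i) * g) $$ (i,z)"
    proof -
      have "(A * g) $$ (i,z) = (\<Sum>k<n. A $$ (i,k) * g $$ (k,z))" by (rule mat_mult_entry[OF Ac g i z])
      also have "\<dots> = (\<Sum>k<n. F (\<beta> i) $$ (i,k) * g $$ (k,z))" using i by (intro sum.cong) (auto simp: Ae)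
      also have "\<dots> = (F (\<beta> i) * g) $$ (i,z)"
        using supp_unitary_carrier[OF F(1)[of "\<beta> i"]] g i z by (intro mat_mult_entry[symmetric]) auto
      finally show ?thesis .
    qed
    also have "\<dots> = (if i = r (\<beta> i) then of_real (sqrt (\<Sum>k\<in>blk (\<beta> i). (cmod (g $$ (k,z)))\<^sup>2)) else 0)"
      by (rule F(2)) (use i in \<open>auto simp: blk_def\<close>)
    finally have e: "(A * g) $$ (i,z) = \<dots>" .
    show "\<exists>x\<ge>0. (A * g) $$ (i,z) = of_real x \<and> (i \<noteq> r (\<beta> i) \<longrightarrow> x = 0)"
      by (rule exI[of _ "if i = r (\<beta> i) then sqrt (\<Sum>k\<in>blk (\<beta> i). (cmod (g $$ (k,z)))\<^sup>2) else 0"])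
         (use e in \<open>auto simp: sum_nonneg\<close>)
  qed
qed

section \<open>Products of sets of orthogonal matrices and chains of tori\<close>

lemma orthogonal_mult:
  assumes "A \<in> orthogonal_group n" "B \<in> orthogonal_group n"
  shows "A * B \<in> orthogonal_group n"
proof -
  have u: "A \<in> unitary_group n" "B \<in> unitary_group n"
    and re: "\<And>i j. i < n \<Longrightarrow> j < n \<Longrightarrow> A $$ (i,j) \<in> \<real>" "\<And>i j. i < n \<Longrightarrow> j < n \<Longrightarrow> B $$ (i,j) \<in> \<real>"
    using assms by (auto simp: orthogonal_group_def)
  have "(A * B) $$ (i,j) \<in> \<real>" if "i < n" "j < n" for i j
  proof -
    have "(A * B) $$ (i,j) = (\<Sum>k<n. A $$ (i,k) * B $$ (k,j))"
      by (rule mat_mult_entry[OF unitary_carrier[OF u(1)] unitary_carrier[OF u(2)] that])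
    then show ?thesis using re that by (auto intro!: sum_in_Reals Reals_mult)
  qed
  then show ?thesis using unitary_mult[OF u] by (simp add: orthogonal_group_def)
qed

lemma orthogonal_carrier: "A \<in> orthogonal_group n \<Longrightarrow> A \<in> carrier_mat n n"
  unfolding orthogonal_group_def by auto

lemma orthogonal_one: "1\<^sub>m n \<in> orthogonal_group n"
  unfolding orthogonal_group_def by auto

lemma prod_sets_simps:
  "prod_sets n [] = {1\<^sub>m n}" "prod_sets n (T # Ts) = {x * y |x y. x \<in> T \<and> y \<in> prod_sets n Ts}"
  by (auto simp: prod_sets_def)

lemma prod_sets_orthogonal:
  "(\<And>T. T \<in> set Ts \<Longrightarrow> T \<subseteq> orthogonal_group n) \<Longrightarrow> prod_sets n Ts \<subseteq> orthogonal_group n"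
proof (induction Ts)
  case Nil
  then show ?case by (simp add: prod_sets_simps orthogonal_one)
next
  case (Cons T Ts)
  then have "T \<subseteq> orthogonal_group n" "prod_sets n Ts \<subseteq> orthogonal_group n" by auto
  then show ?case by (auto simp: prod_sets_simps intro: orthogonal_mult)
qed

text \<open>\<open>prod_sets\<close> unfolds from the left, whereas a chain gains its new torus on
  the right. Orthogonality supplies the dimensions that associativity asks for.\<close>

lemma prod_sets_snoc:
  assumes "\<And>T. T \<in> set Ts \<Longrightarrow> T \<subseteq> orthogonal_group n" "y \<in> T" "T \<subseteq> orthogonal_group n"
    "x \<in> prod_sets n Ts"
  shows "x * y \<in> prod_sets n (Ts @ [T])"
  using assms(1,4)
proof (induction Ts arbitrary: x)
  case Nil
  have yc: "y \<in> carrier_mat n n" using assms(2,3) orthogonal_carrier by blast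
  have "x * y = y * 1\<^sub>m n" using Nil yc by (simp add: prod_sets_simps)
  then show ?case using assms(2) by (auto simp: prod_sets_simps)
next
  case (Cons S Ts)
  obtain a b where ab: "x = a * b" "a \<in> S" "b \<in> prod_sets n Ts" using Cons.prems(2) by (auto simp: prod_sets_simps)
  have "b \<in> orthogonal_group n" using ab(3) prod_sets_orthogonal[of Ts n] Cons.prems(1) by auto
  moreover have "a \<in> orthogonal_group n" using ab(2) Cons.prems(1) by auto
  ultimately have "x * y = a * (b * y)" unfolding ab(1)
    using assms(2,3) by (intro sq_mult_assoc[of _ n]) (auto intro: orthogonal_carrier)
  moreover have "b * y \<in> prod_sets n (Ts @ [T])" using Cons.IH ab(3) Cons.prems(1) by auto
  ultimately show ?case using ab(2) by (auto simp: prod_sets_simps)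
qed

lemma torus_orthogonal: "involutive_below n \<sigma> \<Longrightarrow> torus n \<sigma> A \<subseteq> orthogonal_group n"
  unfolding torus_def using rot_orthogonal by blast

text \<open>The plane of the first two indices comes last in the product because the rightmost
  factor acts first on the basis vector at \<open>a\<close>: it fixes the share of \<open>a\<close>
  and sends the rest to \<open>b\<close>, from where the other tori distribute it.\<close>

fun chain_tori :: "nat \<Rightarrow> nat list \<Rightarrow> complex mat set list" where
  "chain_tori n (a # b # xs) = chain_tori n (b # xs) @ [torus n (swap_idx a b) {a}]"
| "chain_tori n [a] = []"
| "chain_tori n [] = []"

lemma length_chain_tori: "length (chain_tori n xs) = length xs - 1"
  by (induction n xs rule: chain_tori.induct) auto

lemma chain_tori_toral:
  "distinct xs \<Longrightarrow> set xs \<subseteq> {..<n} \<Longrightarrow> T \<in> set (chain_tori n xs) \<Longrightarrow>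
    toral_subgroup_O n 1 T \<and> T \<subseteq> orthogonal_group n"
proof (induction n xs rule: chain_tori.induct)
  case (1 n a b xs)
  have "involutive_below n (swap_idx a b)" using 1 by (intro involutive_below_swap) auto
  then have "toral_subgroup_O n (card {a}) (torus n (swap_idx a b) {a})"
    "torus n (swap_idx a b) {a} \<subseteq> orthogonal_group n"
    by (rule torus_toral; use "1.prems" in auto) (rule torus_orthogonal, fact)
  then show ?case using 1 by auto
qed auto

text \<open>Spherical coordinates: a vector is its first entry together with the norm of its tail.
  Multiplying by the norm instead of normalising \<open>v\<close> keeps the claim meaningful when a
  tail vanishes. Nonnegativity enters at the last index, where the norm has to equal the
  entry.\<close>

lemma chain_tori_reach:
  fixes v :: "nat \<Rightarrow> real"
  assumes "xs \<noteq> []" "distinct xs" "set xs \<subseteq> {..<n}" "\<And>i. i \<in> set xs \<Longrightarrow> v i \<ge> 0"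
  shows "\<exists>t \<in> prod_sets n (chain_tori n xs). t \<in> sub_unitary n (set xs) \<and>
    (\<forall>i\<in>set xs. t $$ (i, hd xs) * of_real (sqrt (\<Sum>k\<in>set xs. (v k)\<^sup>2)) = of_real (v i))"
  using assms
proof (induction n xs rule: chain_tori.induct)
  case (1 n a b xs)
  let ?c = "sqrt (\<Sum>k\<in>set (a # b # xs). (v k)\<^sup>2)" and ?c' = "sqrt (\<Sum>k\<in>set (b # xs). (v k)\<^sup>2)"
  have prem: "b # xs \<noteq> []" "distinct (b # xs)" "set (b # xs) \<subseteq> {..<n}" "\<And>i. i \<in> set (b # xs) \<Longrightarrow> v i \<ge> 0"
    using "1.prems" by auto
  obtain t where t: "t \<in> prod_sets n (chain_tori n (b # xs))" and ts: "t \<in> sub_unitary n (set (b # xs))"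
    and tv: "\<And>i. i \<in> set (b # xs) \<Longrightarrow> t $$ (i,b) * of_real ?c' = of_real (v i)"
    using "1.IH"[OF prem] by auto
  have ab: "a < n" "b < n" "a \<noteq> b" "a \<notin> set (b # xs)" using "1.prems" by auto
  have c2: "?c\<^sup>2 = (v a)\<^sup>2 + ?c'\<^sup>2" and c0: "?c \<ge> 0"
    using ab "1.prems"(2) by (auto simp: sum_nonneg)
  obtain \<theta> where th: "cos \<theta> * ?c = v a" "sin \<theta> * ?c = ?c'"
  proof (cases "?c = 0")
    case True
    then have "v a = 0" "?c' = 0" using c2 by (simp_all add: add_nonneg_eq_0_iff)
    then show thesis using that[of 0] True by simp
  next
    case False
    have "(v a / ?c)\<^sup>2 + (?c' / ?c)\<^sup>2 = ((v a)\<^sup>2 + ?c'\<^sup>2) / ?c\<^sup>2"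
      by (simp only: power_divide add_divide_distrib)
    also have "\<dots> = 1" unfolding c2[symmetric] using False by simp
    finally obtain \<theta> where "v a / ?c = cos \<theta>" "?c' / ?c = sin \<theta>" using sincos_total_2pi by blast
    then have "cos \<theta> * ?c = v a" "sin \<theta> * ?c = ?c'" using False by (metis nonzero_eq_divide_eq)+
    then show thesis by (rule that)
  qed
  define \<sigma> where "\<sigma> = swap_idx a b"
  have inv: "involutive_below n \<sigma>" unfolding \<sigma>_def using ab by (intro involutive_below_swap)
  have s: "\<sigma> a = b" "\<sigma> a \<noteq> a" "\<sigma> b = a" using ab by (auto simp: \<sigma>_def)
  define R where "R = rot n \<sigma> (plane_angle \<sigma> a \<theta>)"
  have R: "R \<in> torus n \<sigma> {a}" "R \<in> sub_unitary n {a,b}"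
    unfolding R_def using inv ab s by (auto intro!: plane_in_torus rot_plane_sub_unitary)
  have tR: "t * R \<in> prod_sets n (chain_tori n (a # b # xs))"
    using prod_sets_snoc[OF _ R(1) torus_orthogonal[OF inv] t] chain_tori_toral[OF prem(2,3)]
    by (auto simp: \<sigma>_def)
  have tRs: "t * R \<in> sub_unitary n (set (a # b # xs))"
    by (intro supp_unitary_mult supp_unitary_sub[OF ts] supp_unitary_sub[OF R(2)]) auto
  have ent: "(t * R) $$ (i,a) = t $$ (i,a) * of_real (cos \<theta>) + t $$ (i,b) * of_real (sin \<theta>)" if "i < n" for i
  proof -
    have sub: "{a,b} \<subseteq> {..<n}" using ab by simp
    have "(t * R) $$ (i,a) = (\<Sum>k\<in>{a,b}. t $$ (i,k) * R $$ (k,a))"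
      using mult_sub_unitary_entry[OF R(2) supp_unitary_carrier[OF ts] sub that ab(1)] by simp
    also have "\<dots> = t $$ (i,a) * of_real (cos \<theta>) + t $$ (i,b) * of_real (sin \<theta>)"
      using ab s by (simp add: R_def rot_entry plane_angle_def)
    finally show ?thesis .
  qed
  have "(t * R) $$ (i,a) * of_real ?c = of_real (v i)" if i: "i \<in> set (a # b # xs)" for i
  proof -
    have "i < n" using i "1.prems"(3) by auto
    note e = ent[OF this] and o = supp_unitary_outside[OF ts this]
    have "(t * R) $$ (i,a) * of_real ?c = t $$ (i,a) * of_real (cos \<theta> * ?c) + t $$ (i,b) * of_real (sin \<theta> * ?c)"
      unfolding e by (simp add: algebra_simps)
    also have "\<dots> = t $$ (i,a) * of_real (v a) + t $$ (i,b) * of_real ?c'" unfolding th ..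
    also have "\<dots> = of_real (v i)"
    proof (cases "i = a")
      case True
      then show ?thesis using o[OF ab(1)] o[OF ab(2)] ab by simp
    next
      case False
      then have "i \<in> set (b # xs)" using i by simp
      then show ?thesis using tv[of i] o[OF ab(1)] ab(4) False by simp
    qed
    finally show ?thesis .
  qed
  then show ?case using tR tRs by (intro bexI[of _ "t * R"]) auto
next
  case (2 n a)
  then show ?case by (intro bexI[of _ "1\<^sub>m n"]) (auto simp: prod_sets_simps)
qed simp

text \<open>One column suffices. If \<open>t\<close> has the same column \<open>hd xs\<close> as the
  reduced matrix \<open>f\<close>, then the adjoint of \<open>t\<close> times \<open>f\<close> has a
  1 at that diagonal position, so it fixes this basis vector and acts on the remaining coordinates,
  where \<open>\<gamma>\<close> is constant.\<close>

lemma unitary_line_decomp: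
  fixes \<beta> :: "nat \<Rightarrow> 'b" and r :: "'b \<Rightarrow> nat"
  assumes r: "\<And>i. i < n \<Longrightarrow> r (\<beta> i) < n \<and> \<beta> (r (\<beta> i)) = \<beta> i"
    and xs: "xs \<noteq> []" "distinct xs" "set xs \<subseteq> {..<n}" "\<And>i. i < n \<Longrightarrow> r (\<beta> i) \<in> set xs"
    and \<gamma>: "\<And>i. i < n \<Longrightarrow> i \<noteq> hd xs \<Longrightarrow> \<gamma> i = c" and g: "g \<in> unitary_group n"
  shows "\<exists>l \<in> supp_unitary n {..<n} \<beta>. \<exists>t \<in> prod_sets n (chain_tori n xs).
    \<exists>h \<in> supp_unitary n {..<n} \<gamma>. g = l * t * h"
proof -
  let ?z = "hd xs"
  have z: "?z < n" using xs by (cases xs) auto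
  note gc = unitary_carrier[OF g]
  obtain A where A: "A \<in> supp_unitary n {..<n} \<beta>"
    and Av: "\<And>i. i < n \<Longrightarrow> \<exists>x\<ge>0. (A * g) $$ (i,?z) = of_real x \<and> (i \<noteq> r (\<beta> i) \<longrightarrow> x = 0)"
    using label_householder[of n r \<beta> g ?z] r gc z by metis
  define f where "f = A * g"
  have fu: "f \<in> unitary_group n" unfolding f_def by (intro unitary_mult g supp_unitary_unitary[OF A])
  note fc = unitary_carrier[OF fu]
  obtain v where v: "\<And>i. i < n \<Longrightarrow> v i \<ge> 0 \<and> f $$ (i,?z) = of_real (v i) \<and> (i \<noteq> r (\<beta> i) \<longrightarrow> v i = 0)"
    using Av unfolding f_def by metis
  have v0: "v i = 0" if "i < n" "i \<notin> set xs" for i using v[OF that(1)] xs(4)[OF that(1)] that(2) by metis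
  have "(\<Sum>k<n. cnj (f $$ (k,?z)) * f $$ (k,?z)) = 1" using unitary_cols[OF fu z z] by simp
  then have "(\<Sum>k<n. complex_of_real ((v k)\<^sup>2)) = 1" using v by (simp add: power2_eq_square)
  then have "(\<Sum>k<n. (v k)\<^sup>2) = 1" by (metis of_real_eq_1_iff of_real_sum)
  moreover have "(\<Sum>k<n. (v k)\<^sup>2) = (\<Sum>k\<in>set xs. (v k)\<^sup>2)"
    using xs(3) v0 by (intro sum.mono_neutral_right) auto
  ultimately have v1: "(\<Sum>k\<in>set xs. (v k)\<^sup>2) = 1" by simp
  have vp: "v i \<ge> 0" if "i \<in> set xs" for i using v that xs(3) by blast
  obtain t where t: "t \<in> prod_sets n (chain_tori n xs)" and ts: "t \<in> sub_unitary n (set xs)"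
    and tv: "\<And>i. i \<in> set xs \<Longrightarrow> t $$ (i,?z) = of_real (v i)"
    using chain_tori_reach[OF xs(1-3), of v] vp unfolding v1 by auto
  note tu = supp_unitary_unitary[OF ts] and tc = supp_unitary_carrier[OF ts]
  have tf: "t $$ (i,?z) = f $$ (i,?z)" if "i < n" for i
  proof (cases "i \<in> set xs")
    case True
    then show ?thesis using tv v[OF that] by simp
  next
    case False
    moreover have "?z \<in> set xs" using xs(1) by simp
    ultimately show ?thesis using supp_unitary_outside[OF ts that z] v0[OF that] v[OF that] by auto
  qed
  define h where "h = mat_adj t * f"
  have hu: "h \<in> unitary_group n" unfolding h_def by (intro unitary_mult unitary_adj tu fu)
  have "h $$ (?z,?z) = (\<Sum>k<n. mat_adj t $$ (?z,k) * f $$ (k,?z))"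
    unfolding h_def by (rule mat_mult_entry[OF mat_adj_carrier[OF tc] fc z z])
  also have "\<dots> = (\<Sum>k<n. cnj (t $$ (k,?z)) * t $$ (k,?z))"
    using tf z tc by (intro sum.cong) (auto simp: mat_adj_entry[of _ n])
  also have "\<dots> = 1" using unitary_cols[OF tu z z] by simp
  finally have "h \<in> sub_unitary n ({..<n} - {?z})"
    using hu z unfolding unitary_iff_sub_unitary by (intro sub_unitary_remove)
  then have h: "h \<in> supp_unitary n {..<n} \<gamma>"
    by (rule sub_unitary_supp[of _ _ _ _ _ c]) (use \<gamma> in auto)
  have "f = t * h" unfolding h_def using tc fc tu by (simp flip: sq_mult_assoc[of _ n])
  moreover have "g = mat_adj A * f" unfolding f_def
    using gc supp_unitary_carrier[OF A] supp_unitary_unitary[OF A] by (simp flip: sq_mult_assoc[of _ n])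
  ultimately have "g = mat_adj A * t * h"
    using tc unitary_carrier[OF hu] supp_unitary_carrier[OF A] by (simp add: sq_mult_assoc[of _ n])
  then show ?thesis using supp_unitary_adj[OF A] t h by blast
qed

section \<open>The four cases\<close>

lemma block_unitary_supp:
  assumes "sum_list ns = n" "\<And>i j. i < n \<Longrightarrow> j < n \<Longrightarrow> same_block ns i j \<longleftrightarrow> \<beta> i = \<beta> j"
  shows "block_unitary ns = supp_unitary n {..<n} \<beta>"
  using assms unfolding block_unitary_def supp_unitary_def by auto

lemma same_block_two: "i < a + b \<Longrightarrow> j < a + b \<Longrightarrow> same_block [a,b] i j \<longleftrightarrow> (i < a) = (j < a)"
  by (auto simp: same_block_def Ex_less_Suc)

lemma same_block_three:
  "i < a + b + c \<Longrightarrow> j < a + b + c \<Longrightarrow> same_block [a,b,c] i j \<longleftrightarrow> three_label a b i = three_label a b j"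
  by (auto simp: same_block_def Ex_less_Suc three_label_def)

text \<open>Products lie in the unitary group because all three factors do, so only the existence of
  a factorisation has to be supplied.\<close>

lemma triple_decompI:
  assumes "L = supp_unitary n {..<n} \<beta>" "H = supp_unitary n {..<n} \<gamma>" "B \<subseteq> orthogonal_group n"
    and "\<And>g. g \<in> unitary_group n \<Longrightarrow>
      \<exists>l \<in> supp_unitary n {..<n} \<beta>. \<exists>b \<in> B. \<exists>h \<in> supp_unitary n {..<n} \<gamma>. g = l * b * h"
  shows "triple_decomp (unitary_group n) L B H"
proof -
  have "x * b * h \<in> unitary_group n" if "x \<in> L" "b \<in> B" "h \<in> H" for x b h
    using that assms(1-3) by (intro unitary_mult) (auto simp: orthogonal_group_def dest: supp_unitary_unitary)
  then show ?thesis unfolding triple_decomp_def using assms(1,2,4) by fast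
qed

lemma toral_orthogonal: "toral_subgroup_O n a T \<Longrightarrow> T \<subseteq> orthogonal_group n"
  unfolding toral_subgroup_O_def by auto

lemma torus_carrier: "t \<in> torus n \<sigma> A \<Longrightarrow> t \<in> carrier_mat n n"
  by (auto simp: torus_def)

text \<open>Turns the relation \<open>same_block\<close> into equality of labels, as
  \<open>supp_unitary\<close> requires, for any number of blocks. The least \<open>m\<close> is the
  right one because partial sums increase.\<close>

definition block_index :: "nat list \<Rightarrow> nat \<Rightarrow> nat" where
  "block_index ns i = (LEAST m. i < sum_list (take (Suc m) ns))"

lemma sum_list_take_mono: "m \<le> m' \<Longrightarrow> sum_list (take m ns) \<le> sum_list (take m' (ns :: nat list))"
proof -
  assume "m \<le> m'"
  then have "take m' ns = take m ns @ take (m' - m) (drop m ns)" by (metis le_add_diff_inverse take_add)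
  then show ?thesis by simp
qed

lemma block_index_eq:
  assumes "sum_list (take m ns) \<le> i" "i < sum_list (take (Suc m) ns)"
  shows "block_index ns i = m"
  unfolding block_index_def
proof (rule Least_equality)
  fix m' assume "i < sum_list (take (Suc m') ns)"
  then show "m \<le> m'"
    using assms(1) sum_list_take_mono[of "Suc m'" m ns] by (cases "m \<le> m'") auto
qed (rule assms(2))

lemma block_index_bounds:
  assumes "i < sum_list ns"
  shows "block_index ns i < length ns" "sum_list (take (block_index ns i) ns) \<le> i"
    "i < sum_list (take (Suc (block_index ns i)) ns)"
proof -
  have ne: "ns \<noteq> []" using assms by auto
  then have last: "i < sum_list (take (Suc (length ns - 1)) ns)" using assms by simp
  show "i < sum_list (take (Suc (block_index ns i)) ns)"
    unfolding block_index_def by (rule LeastI[of _ "length ns - 1"]) (rule last)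
  have "block_index ns i \<le> length ns - 1" unfolding block_index_def by (rule Least_le) (rule last)
  then show "block_index ns i < length ns" using ne by (cases ns) auto
  show "sum_list (take (block_index ns i) ns) \<le> i"
  proof (cases "block_index ns i")
    case (Suc m)
    then have "\<not> i < sum_list (take (Suc m) ns)"
      unfolding block_index_def by (intro not_less_Least) simp
    then show ?thesis using Suc by simp
  qed simp
qed

lemma same_block_index:
  assumes "i < sum_list ns" "j < sum_list ns"
  shows "same_block ns i j \<longleftrightarrow> block_index ns i = block_index ns j"
proof
  assume "same_block ns i j"
  then show "block_index ns i = block_index ns j"
    unfolding same_block_def using block_index_eq by metis
next
  assume e: "block_index ns i = block_index ns j"
  show "same_block ns i j"
    unfolding same_block_def
    using block_index_bounds[OF assms(1)] block_index_bounds[OF assms(2)] e by metis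
qed

section \<open>Translation of each case to tori and block groups\<close>

lemma two_blocks:
  assumes "a > 0" "b > 0" "p > 0" "q > 0" "a + b = n" "p + q = n"
  shows "\<exists>T. toral_subgroup_O n (min (min a b) (min p q)) T \<and> prod_sets n [T] \<subseteq> orthogonal_group n \<and>
     triple_decomp (unitary_group n) (block_unitary [a,b]) (prod_sets n [T]) (block_unitary [p,q])"
proof -
  define m where "m = min (min a b) (min p q)"
  define T where "T = torus n (\<lambda>x. n - 1 - x) {0..<0 + m}"
  have inv: "involutive_below n (\<lambda>x. n - 1 - x)" by (rule involutive_below_reflect)
  have "toral_subgroup_O n (card {0..<0 + m}) T"
    unfolding T_def by (rule torus_toral[OF inv]) (use assms in \<open>auto simp: m_def\<close>)
  then have T: "toral_subgroup_O n m T" by simp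
  have o: "prod_sets n [T] \<subseteq> orthogonal_group n"
    by (rule prod_sets_orthogonal) (use toral_orthogonal[OF T] in auto)
  have "triple_decomp (unitary_group n) (block_unitary [a,b]) (prod_sets n [T]) (block_unitary [p,q])"
  proof (rule triple_decompI[OF block_unitary_supp block_unitary_supp o])
    fix g assume "g \<in> unitary_group n"
    then have g: "g \<in> sub_unitary n {0..<n}" unfolding unitary_iff_sub_unitary by (simp add: atLeast0LessThan)
    have "\<exists>l \<in> supp_unitary n {0..<n} (\<lambda>x. x < a). \<exists>h \<in> supp_unitary n {0..<n} (\<lambda>x. x < p).
      \<exists>t \<in> torus n (\<lambda>x. n - 1 - x) {0..<0 + m}. g = l * t * h"
      by (rule unitary_two_block_decomp[OF inv]) (use g assms in \<open>auto simp: m_def\<close>)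
    then obtain l h t where lht: "l \<in> supp_unitary n {0..<n} (\<lambda>x. x < a)" "h \<in> supp_unitary n {0..<n} (\<lambda>x. x < p)"
      "t \<in> T" "g = l * t * h" unfolding T_def by blast
    have "t = t * 1\<^sub>m n" using torus_carrier[of t] lht(3) unfolding T_def by simp
    then have "t \<in> prod_sets n [T]" using lht(3) by (auto simp: prod_sets_simps)
    then show "\<exists>l \<in> supp_unitary n {..<n} (\<lambda>x. x < a). \<exists>b \<in> prod_sets n [T].
      \<exists>h \<in> supp_unitary n {..<n} (\<lambda>x. x < p). g = l * b * h"
      using lht unfolding atLeast0LessThan by blast
  qed (use assms same_block_two in auto)
  then show ?thesis using T o unfolding m_def by blast
qed

lemma one_block_of_size_one:
  assumes "b > 0" "c > 0" "p > 0" "q > 0" "1 + b + c = n" "p + q = n"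
  shows "\<exists>T1 T2. toral_subgroup_O n (min (min p q) (min b c)) T1 \<and>
     toral_subgroup_O n (min (min p q) (min (b + 1) (c + 1))) T2 \<and>
     prod_sets n [T1, T2] \<subseteq> orthogonal_group n \<and>
     triple_decomp (unitary_group n) (block_unitary [1,b,c]) (prod_sets n [T1, T2]) (block_unitary [p,q])"
proof -
  define m1 where "m1 = min (min p q) (min b c)"
  define m2 where "m2 = min (min p q) (min (b + 1) (c + 1))"
  \<comment> \<open>The first matching fixes \<open>0\<close>, so its planes are
    \<open>(i, n - i)\<close> from \<open>i = 1\<close> on; the bound of \<open>m1\<close> by
    \<open>b\<close> and \<open>c\<close> keeps \<open>i\<close> below \<open>n - i\<close>.\<close>
  define T1 where "T1 = torus n (\<lambda>x. if x = 0 then 0 else n - x) {Suc 0..m1}"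
  define T2 where "T2 = torus n (\<lambda>x. n - 1 - x) {0..<m2}"
  have "toral_subgroup_O n (card {Suc 0..m1}) T1"
    unfolding T1_def by (rule torus_toral[OF involutive_below_reflect1]) (use assms in \<open>auto simp: m1_def\<close>)
  then have T1: "toral_subgroup_O n m1 T1" by simp
  have "toral_subgroup_O n (card {0..<m2}) T2"
    unfolding T2_def by (rule torus_toral[OF involutive_below_reflect]) (use assms in \<open>auto simp: m2_def\<close>)
  then have T2: "toral_subgroup_O n m2 T2" by simp
  have o: "prod_sets n [T1,T2] \<subseteq> orthogonal_group n"
    by (rule prod_sets_orthogonal) (use toral_orthogonal[OF T1] toral_orthogonal[OF T2] in auto)
  have "triple_decomp (unitary_group n) (block_unitary [1,b,c]) (prod_sets n [T1,T2]) (block_unitary [p,q])"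
  proof (rule triple_decompI[OF block_unitary_supp block_unitary_supp o])
    fix g assume "g \<in> unitary_group n"
    then have g: "g \<in> sub_unitary n {0..<n - 0}" unfolding unitary_iff_sub_unitary by (simp add: atLeast0LessThan)
    obtain l t1 t2 h where l: "l \<in> supp_unitary n {Suc 0..<n - 0} (\<lambda>x. x \<le> b)" and t: "t1 \<in> T1" "t2 \<in> T2"
      and h: "h \<in> supp_unitary n {0..<n - 0} (\<lambda>x. x < p)" and e: "g = l * t1 * t2 * h"
      using unitary_line_block_decomp[OF assms(5)[symmetric] assms(6)[symmetric] _ g,
          folded m1_def m2_def, folded T1_def T2_def] by blast
    have c: "t1 \<in> carrier_mat n n" "t2 \<in> carrier_mat n n" using t unfolding T1_def T2_def by (auto dest: torus_carrier)
    have "t1 * t2 = t1 * (t2 * 1\<^sub>m n)" using c by simp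
    then have "t1 * t2 \<in> prod_sets n [T1,T2]" using t by (auto simp: prod_sets_simps)
    moreover have "l \<in> supp_unitary n {..<n} (three_label 1 b)"
      by (rule supp_unitary_mono[OF l]) (auto simp: three_label_def)
    moreover have "h \<in> supp_unitary n {..<n} (\<lambda>x. x < p)" by (rule supp_unitary_subset[OF h]) auto
    moreover have "g = l * (t1 * t2) * h"
      using e c supp_unitary_carrier[OF l] supp_unitary_carrier[OF h] by (simp add: sq_mult_assoc[of _ n])
    ultimately show "\<exists>l \<in> supp_unitary n {..<n} (three_label 1 b). \<exists>b \<in> prod_sets n [T1,T2].
      \<exists>h \<in> supp_unitary n {..<n} (\<lambda>x. x < p). g = l * b * h" by blast
  qed (use assms same_block_two same_block_three[of _ 1 b c] in auto)
  then show ?thesis using T1 T2 o unfolding m1_def m2_def by blast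
qed

lemma three_blocks:
  assumes "a \<ge> 2" "b \<ge> 2" "c \<ge> 2" "min p q = 2" "a + b + c = n" "p + q = n"
  shows "\<exists>T1 T2 T3. toral_subgroup_O n 2 T1 \<and> toral_subgroup_O n 1 T2 \<and> toral_subgroup_O n 2 T3 \<and>
     prod_sets n [T1, T2, T3] \<subseteq> orthogonal_group n \<and>
     triple_decomp (unitary_group n) (block_unitary [a,b,c]) (prod_sets n [T1, T2, T3]) (block_unitary [p,q])"
proof -
  \<comment> \<open>The cases \<open>p = 2\<close> and \<open>q = 2\<close> use different matchings;
    these are the only properties on which the rest depends.\<close>
  have "\<exists>\<sigma>1 \<sigma>2 \<sigma>3 A1 A2 A3. involutive_below n \<sigma>1 \<and> involutive_below n \<sigma>2 \<and> involutive_below n \<sigma>3 \<and>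
    A1 \<subseteq> {..<n} \<and> A2 \<subseteq> {..<n} \<and> A3 \<subseteq> {..<n} \<and>
    (\<forall>i\<in>A1. \<sigma>1 i \<notin> A1) \<and> (\<forall>i\<in>A2. \<sigma>2 i \<notin> A2) \<and> (\<forall>i\<in>A3. \<sigma>3 i \<notin> A3) \<and>
    card A1 = 2 \<and> card A2 = 1 \<and> card A3 = 2 \<and>
    (\<forall>g \<in> unitary_group n. \<exists>l \<in> supp_unitary n {..<n} (three_label a b). \<exists>t1 \<in> torus n \<sigma>1 A1.
      \<exists>t2 \<in> torus n \<sigma>2 A2. \<exists>t3 \<in> torus n \<sigma>3 A3. \<exists>h \<in> supp_unitary n {..<n} (\<lambda>x. x < p). g = l * t1 * t2 * t3 * h)"
  proof (cases "p = 2")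
    case True
    have less: "n - 1 < n" "n - 2 < n" using assms by linarith+
    show ?thesis
      unfolding True
      by (rule exI[of _ "\<lambda>x. if a \<le> x \<and> x < n then a + n - 1 - x else x"],
          rule exI[of _ "swap_idx (n - 1) (n - 2)"], rule exI[of _ "\<lambda>x. n - 1 - x"],
          rule exI[of _ "{a..<a + 2}"], rule exI[of _ "{n - 1}"], rule exI[of _ "{0..<2}"],
          intro conjI ballI involutive_below_interval involutive_below_reflect involutive_below_swap less
            unitary_three_block_decomp_p2[OF assms(5)[symmetric] assms(1-3)])
         (use assms in auto)
  next
    case False
    then have q: "q = 2" "p = n - 2" using assms by (auto simp: min_def split: if_splits)
    have less: "0 < n" "1 < n" "a + b \<le> n" using assms by linarith+
    show ?thesis
      unfolding q(2)
      by (rule exI[of _ "\<lambda>x. if 0 \<le> x \<and> x < a + b then 0 + (a + b) - 1 - x else x"],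
          rule exI[of _ "swap_idx 0 1"], rule exI[of _ "\<lambda>x. n - 1 - x"],
          rule exI[of _ "{0..<2}"], rule exI[of _ "{0}"], rule exI[of _ "{0..<2}"],
          intro conjI ballI involutive_below_interval involutive_below_reflect involutive_below_swap less
            unitary_three_block_decomp_q2[OF assms(5)[symmetric] assms(1-3)])
         (use assms in auto)
  qed
  then obtain \<sigma>1 \<sigma>2 \<sigma>3 A1 A2 A3 where inv: "involutive_below n \<sigma>1" "involutive_below n \<sigma>2" "involutive_below n \<sigma>3"
    and A: "A1 \<subseteq> {..<n}" "A2 \<subseteq> {..<n}" "A3 \<subseteq> {..<n}"
    and d: "\<forall>i\<in>A1. \<sigma>1 i \<notin> A1" "\<forall>i\<in>A2. \<sigma>2 i \<notin> A2" "\<forall>i\<in>A3. \<sigma>3 i \<notin> A3"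
    and ca: "card A1 = 2" "card A2 = 1" "card A3 = 2"
    and dec: "\<forall>g \<in> unitary_group n. \<exists>l \<in> supp_unitary n {..<n} (three_label a b). \<exists>t1 \<in> torus n \<sigma>1 A1.
      \<exists>t2 \<in> torus n \<sigma>2 A2. \<exists>t3 \<in> torus n \<sigma>3 A3. \<exists>h \<in> supp_unitary n {..<n} (\<lambda>x. x < p). g = l * t1 * t2 * t3 * h"
    by (elim exE conjE)
  let ?T1 = "torus n \<sigma>1 A1" and ?T2 = "torus n \<sigma>2 A2" and ?T3 = "torus n \<sigma>3 A3"
  have T: "toral_subgroup_O n 2 ?T1" "toral_subgroup_O n 1 ?T2" "toral_subgroup_O n 2 ?T3"
    using torus_toral[OF inv(1) A(1)] torus_toral[OF inv(2) A(2)] torus_toral[OF inv(3) A(3)] d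
    unfolding ca by blast+
  have o: "prod_sets n [?T1,?T2,?T3] \<subseteq> orthogonal_group n"
    by (rule prod_sets_orthogonal) (use T[THEN toral_orthogonal] in auto)
  have "triple_decomp (unitary_group n) (block_unitary [a,b,c]) (prod_sets n [?T1,?T2,?T3]) (block_unitary [p,q])"
  proof (rule triple_decompI[OF block_unitary_supp block_unitary_supp o])
    fix g assume "g \<in> unitary_group n"
    with dec obtain l t1 t2 t3 h where l: "l \<in> supp_unitary n {..<n} (three_label a b)"
      and t: "t1 \<in> ?T1" "t2 \<in> ?T2" "t3 \<in> ?T3" and h: "h \<in> supp_unitary n {..<n} (\<lambda>x. x < p)"
      and e: "g = l * t1 * t2 * t3 * h" by blast
    note c = t[THEN torus_carrier]
    have "t1 * (t2 * t3) = t1 * (t2 * (t3 * 1\<^sub>m n))" using c by simp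
    then have "t1 * (t2 * t3) \<in> prod_sets n [?T1,?T2,?T3]"
      unfolding prod_sets_simps using t by blast
    moreover have "g = l * (t1 * (t2 * t3)) * h"
      using e c supp_unitary_carrier[OF l] supp_unitary_carrier[OF h] by (simp add: sq_mult_assoc[of _ n])
    ultimately show "\<exists>l \<in> supp_unitary n {..<n} (three_label a b). \<exists>b \<in> prod_sets n [?T1,?T2,?T3].
      \<exists>h \<in> supp_unitary n {..<n} (\<lambda>x. x < p). g = l * b * h" using l h by blast
  qed (use assms same_block_two same_block_three[of _ a b c] in auto)
  then show ?thesis using T o by blast
qed

lemma line_blocks:
  assumes "ns \<noteq> []" "\<forall>m\<in>set ns. m > 0" "sum_list ns = n" "p + q = n" "min p q = 1"
  shows "\<exists>Ts. length Ts = length ns - 1 \<and> (\<forall>T\<in>set Ts. toral_subgroup_O n 1 T) \<and>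
     prod_sets n Ts \<subseteq> orthogonal_group n \<and>
     triple_decomp (unitary_group n) (block_unitary ns) (prod_sets n Ts) (block_unitary [p,q])"
proof -
  let ?off = "\<lambda>m. sum_list (take m ns)" and ?k = "length ns" and ?\<beta> = "block_index ns"
  have offk: "?off ?k = n" using assms by simp
  have step: "?off m < ?off (Suc m)" if "m < ?k" for m
    using that assms(2) by (simp add: take_Suc_conv_app_nth)
  have offn: "?off m \<le> n" if "m \<le> ?k" for m using sum_list_take_mono[OF that, of ns] offk by simp
  \<comment> \<open>\<open>r\<close> selects one coordinate in each block. The selection must
    contain the single coordinate separated off by the right group, and the list must begin with it:
    first elements of the blocks serve for \<open>p = 1\<close>, last elements for
    \<open>q = 1\<close>.\<close>
  have "\<exists>r xs. (\<forall>m<?k. r m < n \<and> ?\<beta> (r m) = m) \<and> xs \<noteq> [] \<and> distinct xs \<and> length xs = ?k \<and>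
    set xs = r ` {..<?k} \<and> (\<exists>c. \<forall>i<n. i \<noteq> hd xs \<longrightarrow> (i < p) = c)"
  proof (cases "p = 1")
    case True
    define xs where "xs = map ?off [0..<?k]"
    have r: "\<forall>m<?k. ?off m < n \<and> ?\<beta> (?off m) = m"
    proof (intro allI impI)
      fix m assume m: "m < ?k"
      then show "?off m < n \<and> ?\<beta> (?off m) = m"
        using step[OF m] offn[of "Suc m"] block_index_eq[of m ns "?off m"] by simp
    qed
    have "inj_on ?off {..<?k}" by (rule inj_on_inverseI[of _ ?\<beta>]) (use r in auto)
    then have "distinct xs" by (simp add: xs_def distinct_map atLeast0LessThan)
    moreover have "hd xs = 0" using assms(1) by (simp add: xs_def hd_map)
    moreover have "xs \<noteq> []" "length xs = ?k" "set xs = ?off ` {..<?k}" using assms(1) by (auto simp: xs_def)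
    ultimately show ?thesis using r True
      by (intro exI[of _ ?off] exI[of _ xs]) auto
  next
    case False
    then have q: "q = 1" "p = n - 1" using assms by (auto simp: min_def split: if_splits)
    let ?r = "\<lambda>m. ?off (Suc m) - 1"
    \<comment> \<open>Reversed, so that the list begins with \<open>n - 1\<close>, the coordinate
      that the cut at \<open>p\<close> separates from all others.\<close>
    define xs where "xs = rev (map ?r [0..<?k])"
    have r: "\<forall>m<?k. ?r m < n \<and> ?\<beta> (?r m) = m"
    proof (intro allI impI)
      fix m assume m: "m < ?k"
      have "?off (Suc m) \<le> n" using m by (intro offn) simp
      moreover have "?off m \<le> ?r m" "?r m < ?off (Suc m)" using step[OF m] by linarith+
      ultimately show "?r m < n \<and> ?\<beta> (?r m) = m"
        using block_index_eq[of m ns "?r m"] by linarith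
    qed
    have "inj_on ?r {..<?k}" by (rule inj_on_inverseI[of _ ?\<beta>]) (use r in auto)
    then have "distinct xs" by (simp add: xs_def distinct_map atLeast0LessThan)
    moreover have "hd xs = n - 1"
    proof -
      have "hd xs = ?r (?k - 1)" using assms(1) by (simp add: xs_def hd_rev last_map)
      then show ?thesis using assms(1) offk by simp
    qed
    moreover have "xs \<noteq> []" "length xs = ?k" "set xs = ?r ` {..<?k}" using assms(1) by (auto simp: xs_def)
    ultimately show ?thesis using r q
      by (intro exI[of _ ?r] exI[of _ xs]) auto
  qed
  then obtain r xs c where r: "\<And>m. m < ?k \<Longrightarrow> r m < n \<and> ?\<beta> (r m) = m"
    and xs: "xs \<noteq> []" "distinct xs" "length xs = ?k" "set xs = r ` {..<?k}"
    and c: "\<And>i. i < n \<Longrightarrow> i \<noteq> hd xs \<Longrightarrow> (i < p) = c" by blast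
  have sx: "set xs \<subseteq> {..<n}" using xs(4) r by auto
  have bk: "?\<beta> i < ?k" if "i < n" for i using block_index_bounds(1)[of i ns] that assms(3) by simp
  have r': "r (?\<beta> i) < n \<and> ?\<beta> (r (?\<beta> i)) = ?\<beta> i" "r (?\<beta> i) \<in> set xs" if "i < n" for i
    using r[OF bk[OF that]] bk[OF that] xs(4) by auto
  let ?Ts = "chain_tori n xs"
  have T: "toral_subgroup_O n 1 T" "T \<subseteq> orthogonal_group n" if "T \<in> set ?Ts" for T
    using chain_tori_toral[OF xs(2) sx that] by auto
  have o: "prod_sets n ?Ts \<subseteq> orthogonal_group n" by (rule prod_sets_orthogonal) (rule T(2))
  have "triple_decomp (unitary_group n) (block_unitary ns) (prod_sets n ?Ts) (block_unitary [p,q])"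
  proof (rule triple_decompI[OF block_unitary_supp block_unitary_supp o])
    fix g assume "g \<in> unitary_group n"
    then show "\<exists>l \<in> supp_unitary n {..<n} ?\<beta>. \<exists>b \<in> prod_sets n ?Ts.
      \<exists>h \<in> supp_unitary n {..<n} (\<lambda>x. x < p). g = l * b * h"
      by (intro unitary_line_decomp[of n r ?\<beta> xs "\<lambda>x. x < p" c] r' xs sx c)
  qed (use assms same_block_two same_block_index in auto)
  then show ?thesis using T(1) o length_chain_tori[of n xs] xs(3) by metis
qed

theorem theoremB:
  fixes ns :: "nat list" and p q n :: nat
  defines "G \<equiv> unitary_group n"
  defines "L \<equiv> block_unitary ns"
  defines "H \<equiv> block_unitary [p, q]"
  assumes "length ns \<ge> 2" and "\<forall>m\<in>set ns. m > 0" and "p > 0" and "q > 0"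
    and "sum_list ns = n" and "p + q = n"
  shows
    "(length ns = 2 \<longrightarrow>
       (\<exists>T. toral_subgroup_O n (min (min (ns!0) (ns!1)) (min p q)) T \<and>
            prod_sets n [T] \<subseteq> orthogonal_group n \<and>
            triple_decomp G L (prod_sets n [T]) H))
   \<and> (length ns = 3 \<and> ns!0 = 1 \<longrightarrow>
       (\<exists>T1 T2. toral_subgroup_O n (min (min p q) (min (ns!1) (ns!2))) T1 \<and>
            toral_subgroup_O n (min (min p q) (min (ns!1 + 1) (ns!2 + 1))) T2 \<and>
            prod_sets n [T1, T2] \<subseteq> orthogonal_group n \<and>
            triple_decomp G L (prod_sets n [T1, T2]) H))
   \<and> (length ns = 3 \<and> min (min (ns!0) (ns!1)) (ns!2) \<ge> 2 \<and> min p q = 2 \<longrightarrow>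
       (\<exists>T1 T2 T3. toral_subgroup_O n 2 T1 \<and> toral_subgroup_O n 1 T2 \<and>
            toral_subgroup_O n 2 T3 \<and>
            prod_sets n [T1, T2, T3] \<subseteq> orthogonal_group n \<and>
            triple_decomp G L (prod_sets n [T1, T2, T3]) H))
   \<and> (min p q = 1 \<longrightarrow>
       (\<exists>Ts. length Ts = length ns - 1 \<and> (\<forall>T\<in>set Ts. toral_subgroup_O n 1 T) \<and>
            prod_sets n Ts \<subseteq> orthogonal_group n \<and>
            triple_decomp G L (prod_sets n Ts) H))"
proof -
  have two: "\<exists>a b. ns = [a,b]" if "length ns = 2"
    using that by (auto simp: numeral_2_eq_2 length_Suc_conv)
  have three: "\<exists>a b c. ns = [a,b,c]" if "length ns = 3"
    using that by (auto simp: numeral_3_eq_3 length_Suc_conv)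
  show ?thesis
    unfolding G_def L_def H_def
  proof (intro conjI impI)
    assume "length ns = 2"
    then obtain a b where "ns = [a,b]" using two by blast
    then show "\<exists>T. toral_subgroup_O n (min (min (ns!0) (ns!1)) (min p q)) T \<and>
        prod_sets n [T] \<subseteq> orthogonal_group n \<and>
        triple_decomp (unitary_group n) (block_unitary ns) (prod_sets n [T]) (block_unitary [p, q])"
      using two_blocks[of a b p q n] assms by simp
  next
    assume h: "length ns = 3 \<and> ns!0 = 1"
    then obtain a b c where "ns = [a,b,c]" using three by blast
    with h have "ns = [1,b,c]" by simp
    then show "\<exists>T1 T2. toral_subgroup_O n (min (min p q) (min (ns!1) (ns!2))) T1 \<and>
        toral_subgroup_O n (min (min p q) (min (ns!1 + 1) (ns!2 + 1))) T2 \<and>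
        prod_sets n [T1, T2] \<subseteq> orthogonal_group n \<and>
        triple_decomp (unitary_group n) (block_unitary ns) (prod_sets n [T1, T2]) (block_unitary [p, q])"
      using one_block_of_size_one[of b c p q n] assms by simp
  next
    assume h: "length ns = 3 \<and> min (min (ns!0) (ns!1)) (ns!2) \<ge> 2 \<and> min p q = 2"
    then obtain a b c where "ns = [a,b,c]" using three by blast
    with h show "\<exists>T1 T2 T3. toral_subgroup_O n 2 T1 \<and> toral_subgroup_O n 1 T2 \<and>
        toral_subgroup_O n 2 T3 \<and> prod_sets n [T1, T2, T3] \<subseteq> orthogonal_group n \<and>
        triple_decomp (unitary_group n) (block_unitary ns) (prod_sets n [T1, T2, T3]) (block_unitary [p, q])"
      using three_blocks[of a b c p q n] assms by simp
  next
    assume "min p q = 1"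
    moreover have "ns \<noteq> []" using assms by auto
    ultimately show "\<exists>Ts. length Ts = length ns - 1 \<and> (\<forall>T\<in>set Ts. toral_subgroup_O n 1 T) \<and>
        prod_sets n Ts \<subseteq> orthogonal_group n \<and>
        triple_decomp (unitary_group n) (block_unitary ns) (prod_sets n Ts) (block_unitary [p, q])"
      using line_blocks[of ns n p q] assms by simp
  qed
qed

end
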